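(* Every infinite, cubic, bridgeless graph $G$ has two (not necessarily distinct) perfect matchings $M_1,M_2$ such that the graph $G-(M_1\cup M_2)$, obtained from $G$ by deleting the edges in $M_1\cup M_2$, is bipartite.
   Context: Graphs are simple (no loops, no parallel edges), not necessarily connected, and may be infinite. A graph is cubic if every vertex has degree exactly 3, and bridgeless if it has no edge whose deletion increases the number of connected components. A perfect matching of $G$ is a set $M\subseteq E(G)$ such that every vertex of $G$ is incident with exactly one edge of $M$. *)

theory Defs
  imports Main
begin

text \<open>
  A graph is given by a vertex set \<open>V\<close> and a set \<open>E\<close> of edges, each edge being a two-element
  set of vertices. Both may be infinite.
\<close>

definition simple_graph :: "'a set \<Rightarrow> 'a set set \<Rightarrow> bool" where
  "simple_graph V E \<longleftrightarrow> (\<forall>e\<in>E. e \<subseteq> V \<and> card e = 2)"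

definition incident_edges :: "'a set set \<Rightarrow> 'a \<Rightarrow> 'a set set" where
  "incident_edges E v = {e \<in> E. v \<in> e}"

text \<open>Since \<open>card\<close> of an infinite set is 0, this also excludes vertices of infinite degree.\<close>

definition cubic :: "'a set \<Rightarrow> 'a set set \<Rightarrow> bool" where
  "cubic V E \<longleftrightarrow> (\<forall>v\<in>V. card (incident_edges E v) = 3)"

definition adj :: "'a set set \<Rightarrow> ('a \<times> 'a) set" where
  "adj E = {(u, v). {u, v} \<in> E}"

definition conn_rel :: "'a set \<Rightarrow> 'a set set \<Rightarrow> ('a \<times> 'a) set" where
  "conn_rel V E = {(u, v). u \<in> V \<and> v \<in> V \<and> (u, v) \<in> (adj E)\<^sup>*}"

definition components :: "'a set \<Rightarrow> 'a set set \<Rightarrow> 'a set set" where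
  "components V E = V // conn_rel V E"

text \<open>
  A bridge is an edge whose deletion increases the number of components. As a graph may have
  infinitely many components, the increase is not measured by comparing cardinals of the sets of all
  components (these would agree whenever there are infinitely many), but by some component
  falling apart into at least two. The lemma \<open>is_bridge_iff_card\<close> below shows that for
  finitely many components this is the same as an increase in number.
\<close>

definition is_bridge :: "'a set \<Rightarrow> 'a set set \<Rightarrow> 'a set \<Rightarrow> bool" where
  "is_bridge V E e \<longleftrightarrow> e \<in> E \<and>
     (\<exists>C \<in> components V E. \<exists>D1 \<in> components V (E - {e}). \<exists>D2 \<in> components V (E - {e}).
        D1 \<noteq> D2 \<and> D1 \<subseteq> C \<and> D2 \<subseteq> C)"

definition bridgeless :: "'a set \<Rightarrow> 'a set set \<Rightarrow> bool" where
  "bridgeless V E \<longleftrightarrow> (\<forall>e\<in>E. \<not> is_bridge V E e)"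

definition perfect_matching :: "'a set \<Rightarrow> 'a set set \<Rightarrow> 'a set set \<Rightarrow> bool" where
  "perfect_matching V E M \<longleftrightarrow> M \<subseteq> E \<and> (\<forall>v\<in>V. \<exists>!e. e \<in> M \<and> v \<in> e)"

definition bipartite :: "'a set \<Rightarrow> 'a set set \<Rightarrow> bool" where
  "bipartite V E \<longleftrightarrow>
     (\<exists>A B. A \<union> B = V \<and> A \<inter> B = {} \<and> (\<forall>e\<in>E. \<exists>a\<in>A. \<exists>b\<in>B. e = {a, b}))"

lemma equiv_conn_rel: "equiv V (conn_rel V E)"
proof (rule equivI)
  show "conn_rel V E \<subseteq> V \<times> V" by (auto simp: conn_rel_def)
  show "refl_on V (conn_rel V E)" by (auto simp: conn_rel_def refl_on_def)
  have "sym ((adj E)\<^sup>*)" by (rule sym_rtrancl) (auto simp: adj_def sym_def insert_commute)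
  then show "sym (conn_rel V E)" by (auto simp: conn_rel_def sym_def)
  show "trans (conn_rel V E)" by (auto simp: conn_rel_def trans_def intro: rtrancl_trans)
qed

lemma conn_rel_mono: "F \<subseteq> E \<Longrightarrow> conn_rel V F \<subseteq> conn_rel V E"
  unfolding conn_rel_def using rtrancl_mono[of "adj F" "adj E"] by (auto simp: adj_def)

lemma finite_components_delete:
  assumes "simple_graph V E" "e \<in> E" "finite (components V E)"
  shows "finite (components V (E - {e}))"
proof -
  obtain a b where e: "e = {a, b}"
    using assms by (meson card_2_iff simple_graph_def)
  have split: "(u, v) \<in> (adj (E - {e}))\<^sup>* \<or> (a, v) \<in> (adj (E - {e}))\<^sup>* \<or> (b, v) \<in> (adj (E - {e}))\<^sup>*"
    if "(u, v) \<in> (adj E)\<^sup>*" for u v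
    using that
  proof (induction rule: rtrancl_induct)
    case base
    then show ?case by simp
  next
    case (step y z)
    show ?case
    proof (cases "{y, z} = e")
      case True
      then have "z = a \<or> z = b" using e by (auto simp: doubleton_eq_iff)
      then show ?thesis by auto
    next
      case False
      then have "(y, z) \<in> adj (E - {e})" using step.hyps by (auto simp: adj_def)
      then show ?thesis using step.IH by (meson rtrancl.rtrancl_into_rtrancl)
    qed
  qed
  let ?R = "conn_rel V (E - {e})"
  define r where "r C = (SOME x. x \<in> C)" for C :: "'a set"
  have "D \<in> (\<lambda>C. ?R `` {r C}) ` components V E \<union> {?R `` {a}, ?R `` {b}}"
    if D: "D \<in> components V (E - {e})" for D
  proof -
    obtain v where v: "v \<in> V" "D = ?R `` {v}"
      using D by (auto simp: components_def elim: quotientE)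
    define C where "C = conn_rel V E `` {v}"
    have C: "C \<in> components V E" using v by (auto simp: C_def components_def intro: quotientI)
    have "v \<in> C" using v by (simp add: C_def conn_rel_def)
    then have "r C \<in> C" unfolding r_def by (rule someI)
    then have "(v, r C) \<in> conn_rel V E" by (simp add: C_def)
    then have rv: "(r C, v) \<in> conn_rel V E"
      using equiv_conn_rel by (meson equiv_def symD)
    have ab: "a \<in> V" "b \<in> V" using assms e by (auto simp: simple_graph_def)
    have "(r C, v) \<in> ?R \<or> (a, v) \<in> ?R \<or> (b, v) \<in> ?R"
      using split[of "r C" v] rv v ab by (auto simp: conn_rel_def)
    then have "D = ?R `` {r C} \<or> D = ?R `` {a} \<or> D = ?R `` {b}"
      using equiv_class_eq[OF equiv_conn_rel] v by metis
    then show ?thesis using C by auto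
  qed
  then have "components V (E - {e}) \<subseteq> (\<lambda>C. ?R `` {r C}) ` components V E \<union> {?R `` {a}, ?R `` {b}}"
    by auto
  then show ?thesis using assms(3) by (meson finite.emptyI finite.insertI finite_UnI finite_imageI finite_subset)
qed

lemma is_bridge_iff_card:
  assumes "simple_graph V E" "e \<in> E" "finite (components V E)"
  shows "is_bridge V E e \<longleftrightarrow> card (components V E) < card (components V (E - {e}))"
proof -
  let ?S = "conn_rel V E" and ?R = "conn_rel V (E - {e})"
  let ?f = "\<lambda>D. ?S `` D"
  have RS: "?R \<subseteq> ?S" by (rule conn_rel_mono) auto
  have f: "?f (?R `` {v}) = ?S `` {v}" if "v \<in> V" for v
  proof -
    have "v \<in> ?R `` {v}" using that by (simp add: conn_rel_def)
    moreover have "?S `` (?R `` {v}) \<subseteq> ?S `` {v}"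
      using RS equiv_conn_rel[of V E] by (auto simp: equiv_def dest: transD)
    ultimately show ?thesis by blast
  qed
  have img: "?f ` components V (E - {e}) = components V E"
    using f by (auto simp: components_def quotient_def image_iff)
  have fin: "finite (components V (E - {e}))" by (rule finite_components_delete[OF assms])
  have sub: "D \<subseteq> C \<longleftrightarrow> ?f D = C"
    if DC: "D \<in> components V (E - {e})" "C \<in> components V E" for C D
  proof -
    obtain v where v: "v \<in> V" "D = ?R `` {v}"
      using DC by (auto simp: components_def elim: quotientE)
    obtain w where w: "w \<in> V" "C = ?S `` {w}"
      using DC by (auto simp: components_def elim: quotientE)
    have "v \<in> D" using v by (simp add: conn_rel_def)
    have "D \<subseteq> ?S `` {v}" using v RS by auto
    show ?thesis
    proof
      assume "D \<subseteq> C"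
      then have "(w, v) \<in> ?S" using \<open>v \<in> D\<close> w by auto
      then have "?S `` {w} = ?S `` {v}" by (rule equiv_class_eq[OF equiv_conn_rel])
      then show "?f D = C" using f v w by simp
    next
      assume "?f D = C"
      then show "D \<subseteq> C" using f v \<open>D \<subseteq> ?S `` {v}\<close> by simp
    qed
  qed
  have "is_bridge V E e \<longleftrightarrow> \<not> inj_on ?f (components V (E - {e}))"
  proof
    assume "is_bridge V E e"
    show "\<not> inj_on ?f (components V (E - {e}))"
    proof -
      obtain C D1 D2 where C: "C \<in> components V E" and D: "D1 \<in> components V (E - {e})"
        "D2 \<in> components V (E - {e})" "D1 \<noteq> D2" "D1 \<subseteq> C" "D2 \<subseteq> C"
        using \<open>is_bridge V E e\<close> unfolding is_bridge_def by blast
      have "?f D1 = ?f D2" using sub[OF D(1) C] sub[OF D(2) C] D(4,5) by simp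
      then show ?thesis using D(1-3) by (meson inj_onD)
    qed
  next
    assume "\<not> inj_on ?f (components V (E - {e}))"
    then obtain D1 D2 where D: "D1 \<in> components V (E - {e})" "D2 \<in> components V (E - {e})"
      "D1 \<noteq> D2" "?f D1 = ?f D2" unfolding inj_on_def by blast
    have C: "?f D1 \<in> components V E" using img D(1) by blast
    have "D1 \<subseteq> ?f D1" using sub[OF D(1) C] by simp
    moreover have "D2 \<subseteq> ?f D1" using sub[OF D(2) C] D(4) by simp
    ultimately show "is_bridge V E e" unfolding is_bridge_def using assms(2) D(1-3) C by blast
  qed
  also have "\<dots> \<longleftrightarrow> card (components V E) < card (components V (E - {e}))"
    using card_image_le[OF fin, of ?f] inj_on_iff_eq_card[OF fin, of ?f] unfolding img by linarith
  finally show ?thesis .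
qed

end

theory Submission imports Defs
begin

text \<open>
  By compactness it suffices to treat a finite set \<open>X\<close> of vertices. Joining the edges that leave \<open>X\<close>
  to the vertices of a new circuit gives a finite bridgeless cubic multigraph. There take any perfect
  matching \<open>M1\<close>, and then a perfect matching \<open>M2\<close> that meets every odd circuit of the complement of \<open>M1\<close>.

  The existence of \<open>M2\<close> is the case without restrictions of the following statement: for any two
  edges \<open>f\<close>, \<open>g\<close> and any disjoint odd circuits there is a perfect matching that avoids \<open>f\<close> and \<open>g\<close>
  and meets all the circuits. With two forbidden edges the statement is inherited across cuts of size 3,
  because each side can use at least two of the three cut edges. If all such cuts are trivial,
  let \<open>f = au\<close>, let \<open>b\<close>, \<open>w\<close> be the other neighbours of \<open>u\<close> and \<open>c\<close>, \<open>d\<close> those of \<open>w\<close>; replace \<open>u\<close>, \<open>w\<close> by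
  edges \<open>ac\<close>, \<open>bd\<close> and forbid \<open>ac\<close> instead of \<open>f\<close>. A matching of the smaller graph
  lifts by \<open>uw\<close>, or by \<open>bu\<close> and \<open>wd\<close> if it contains \<open>bd\<close>. This works if each circuit through \<open>u\<close> or \<open>w\<close>
  uses \<open>uw\<close>: it is either shortened by two edges or met by every lift. Otherwise the ends
  of \<open>f\<close> lie on no circuit while some neighbour \<open>w\<close> of them lies on a circuit, and the reduction
  is done twice: at \<open>uw\<close>, and at the edge \<open>c1c2\<close> of that circuit, where \<open>w\<close>, \<open>c1\<close>, \<open>c2\<close> are consecutive.
\<close>

text \<open>Finite multigraphs: an edge is a name, and \<open>\<eta>\<close> gives its two ends.\<close>

definition crosses :: "'v set \<Rightarrow> 'v set \<Rightarrow> bool" where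
  "crosses X s \<longleftrightarrow> s \<inter> X \<noteq> {} \<and> \<not> s \<subseteq> X"

definition deg :: "('e \<Rightarrow> 'v set) \<Rightarrow> 'e set \<Rightarrow> 'v \<Rightarrow> nat" where
  "deg \<eta> K v = card {e \<in> K. v \<in> \<eta> e}"

definition cut_size :: "('e \<Rightarrow> 'v set) \<Rightarrow> 'e set \<Rightarrow> 'v set \<Rightarrow> nat" where
  "cut_size \<eta> E X = card {e \<in> E. crosses X (\<eta> e)}"

definition mcubic :: "'v set \<Rightarrow> 'e set \<Rightarrow> ('e \<Rightarrow> 'v set) \<Rightarrow> bool" where
  "mcubic V E \<eta> \<longleftrightarrow> finite V \<and> finite E \<and> (\<forall>e\<in>E. \<eta> e \<subseteq> V \<and> card (\<eta> e) = 2) \<and> (\<forall>v\<in>V. deg \<eta> E v = 3)"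

text \<open>A bridge is the only edge of some cut. Expressed through cuts, the property passes to
  modified graphs by comparing cut sizes edge by edge, without walks or components.\<close>

definition mbridgeless :: "'e set \<Rightarrow> ('e \<Rightarrow> 'v set) \<Rightarrow> bool" where
  "mbridgeless E \<eta> \<longleftrightarrow> (\<forall>X. cut_size \<eta> E X \<noteq> 1)"

definition pmatching :: "'v set \<Rightarrow> 'e set \<Rightarrow> ('e \<Rightarrow> 'v set) \<Rightarrow> 'e set \<Rightarrow> bool" where
  "pmatching V E \<eta> M \<longleftrightarrow> M \<subseteq> E \<and> (\<forall>v\<in>V. deg \<eta> M v = 1)"

definition even_degrees :: "'v set \<Rightarrow> ('e \<Rightarrow> 'v set) \<Rightarrow> 'e set \<Rightarrow> bool" where
  "even_degrees V \<eta> K \<longleftrightarrow> (\<forall>v\<in>V. even (deg \<eta> K v))"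

text \<open>Disjoint odd circuits are replaced by edge-disjoint sets of odd size that have even degree at
  every vertex: each of these contains an odd circuit, in a cubic graph they are automatically
  vertex-disjoint, and unlike circuits they are preserved by contractions.\<close>

definition odd_family :: "'v set \<Rightarrow> 'e set \<Rightarrow> ('e \<Rightarrow> 'v set) \<Rightarrow> 'e set set \<Rightarrow> bool" where
  "odd_family V E \<eta> \<C> \<longleftrightarrow> (\<forall>K\<in>\<C>. K \<subseteq> E \<and> even_degrees V \<eta> K \<and> odd (card K)) \<and> pairwise disjnt \<C>"

text \<open>The statement proved by induction. The names \<open>f\<close> and \<open>g\<close> may
  coincide or lie outside \<open>E\<close>, so fewer than two forbidden edges are covered as
  well.\<close>

definition quelled :: "'v set \<Rightarrow> 'e set \<Rightarrow> ('e \<Rightarrow> 'v set) \<Rightarrow> 'e \<Rightarrow> 'e \<Rightarrow> 'e set set \<Rightarrow> bool" where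
  "quelled V E \<eta> f g \<C> \<longleftrightarrow> (\<exists>M. pmatching V E \<eta> M \<and> f \<notin> M \<and> g \<notin> M \<and> (\<forall>K\<in>\<C>. M \<inter> K \<noteq> {}))"

section \<open>Counting and parity in finite multigraphs\<close>

lemma cr_pair [simp]: "crosses X {x, y} \<longleftrightarrow> (x \<in> X \<longleftrightarrow> y \<notin> X)"
  by (auto simp: crosses_def)

text \<open>For splitting a few named edges off a count: degrees and cut sizes before and after a
  local change then differ only by sums of truth values.\<close>

lemma card_filter_split:
  assumes "finite K" "distinct xs"
  shows "card {e \<in> K. P e} = card {e \<in> K - set xs. P e} + (\<Sum>x\<leftarrow>xs. of_bool (x \<in> K \<and> P x))"
  using assms(2)
proof (induction xs)
  case (Cons x xs)
  have "{e \<in> K - set xs. P e} = {e \<in> K - set (x # xs). P e} \<union> (if x \<in> K \<and> P x then {x} else {})"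
    using Cons.prems by auto
  moreover have "card \<dots> = card {e \<in> K - set (x # xs). P e} + of_bool (x \<in> K \<and> P x)"
    using assms(1) by (subst card_Un_disjoint) auto
  ultimately show ?case using Cons by simp
qed simp

lemma card_split:
  assumes "finite K" "distinct xs"
  shows "card K = card (K - set xs) + (\<Sum>x\<leftarrow>xs. of_bool (x \<in> K))"
  using card_filter_split[OF assms, of "\<lambda>_. True"] by (simp flip: set_diff_eq)

lemma handshake:
  assumes "finite N" "finite K"
  shows "(\<Sum>v\<in>N. deg \<eta> K v) = (\<Sum>e\<in>K. card (\<eta> e \<inter> N))"
proof -
  have "(\<Sum>v\<in>N. deg \<eta> K v) = (\<Sum>v\<in>N. \<Sum>e\<in>K. of_bool (v \<in> \<eta> e))"
    using assms by (simp add: deg_def Int_def)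
  also have "\<dots> = (\<Sum>e\<in>K. \<Sum>v\<in>N. of_bool (v \<in> \<eta> e))" by (rule sum.swap)
  also have "\<dots> = (\<Sum>e\<in>K. card (\<eta> e \<inter> N))"
    using assms by (simp add: Int_def conj_commute)
  finally show ?thesis .
qed

text \<open>Adding up the degrees over \<open>Y\<close> counts an edge once for each of its ends in
  \<open>Y\<close>; modulo 2 only the crossing edges survive.\<close>

lemma even_crossing:
  assumes fin: "finite Y" "finite K" and two: "\<And>e. e \<in> K \<Longrightarrow> card (\<eta> e) = 2" and ev: "\<And>v. v \<in> Y \<Longrightarrow> even (deg \<eta> K v)"
  shows "even (card {e \<in> K. crosses Y (\<eta> e)})"
proof -
  have "even (\<Sum>v\<in>Y. deg \<eta> K v)" using ev by (intro dvd_sum) auto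
  then have "even (card {e \<in> K. odd (card (\<eta> e \<inter> Y))})"
    unfolding handshake[OF fin] using fin by (simp add: even_sum_iff)
  moreover have "odd (card (\<eta> e \<inter> Y)) \<longleftrightarrow> crosses Y (\<eta> e)" if e: "e \<in> K" for e
  proof -
    obtain p q where pq: "\<eta> e = {p, q}" "p \<noteq> q" using two[OF e] by (auto simp: card_2_iff)
    then have "\<eta> e \<inter> Y = (if p \<in> Y then {p} else {}) \<union> (if q \<in> Y then {q} else {})" by auto
    then show ?thesis using pq by auto
  qed
  then have "{e \<in> K. odd (card (\<eta> e \<inter> Y))} = {e \<in> K. crosses Y (\<eta> e)}" by blast
  ultimately show ?thesis by simp
qed

lemma mcubicD:
  assumes "mcubic V E \<eta>"
  shows "finite V" "finite E" "\<And>e. e \<in> E \<Longrightarrow> \<eta> e \<subseteq> V" "\<And>e. e \<in> E \<Longrightarrow> card (\<eta> e) = 2"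
    "\<And>v. v \<in> V \<Longrightarrow> card {e \<in> E. v \<in> \<eta> e} = 3"
  using assms by (auto simp: mcubic_def deg_def)

lemma other_end:
  assumes "card s = 2" "x \<in> s"
  obtains y where "s = {x, y}" "y \<noteq> x"
proof -
  obtain p q where "s = {p, q}" "p \<noteq> q" using assms(1) by (auto simp: card_2_iff)
  then show thesis using that[of p] that[of q] assms(2) by (auto simp: insert_commute)
qed

lemma card3_obtain2:
  assumes "card S = 3" "x \<in> S"
  obtains y z where "S = {x, y, z}" "distinct [x, y, z]"
proof -
  have "finite S" using assms(1) by (metis card.infinite zero_neq_numeral)
  then have "card (S - {x}) = 2" using assms by simp
  then obtain y z where "S - {x} = {y, z}" "y \<noteq> z" by (auto simp: card_2_iff)
  then show thesis using that[of y z] assms(2) by (metis Diff_iff distinct_length_2_or_more distinct_singleton insertCI insert_Diff)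
qed

lemma card3_obtain1:
  assumes "card S = 3" "x \<in> S" "y \<in> S" "x \<noteq> y"
  obtains z where "S = {x, y, z}" "distinct [x, y, z]"
proof -
  obtain p q where "S = {x, p, q}" "distinct [x, p, q]" by (rule card3_obtain2[OF assms(1,2)])
  then show thesis using that[of p] that[of q] assms(3,4) by (auto simp: insert_commute)
qed

lemma third_edge:
  assumes cubic: "mcubic V E \<eta>" and v: "v \<in> V" "e \<in> E" "e' \<in> E" "v \<in> \<eta> e" "v \<in> \<eta> e'" "e \<noteq> e'"
  shows "\<exists>z. {x \<in> E. v \<in> \<eta> x} = {e, e', z} \<and> distinct [e, e', z]"
proof -
  have "e \<in> {x \<in> E. v \<in> \<eta> x}" "e' \<in> {x \<in> E. v \<in> \<eta> x}" using assms by auto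
  from card3_obtain1[OF mcubicD(5)[OF cubic v(1)] this assms(7)] show ?thesis by metis
qed

lemma other_edges:
  assumes cubic: "mcubic V E \<eta>" and v: "v \<in> V" "e \<in> E" "v \<in> \<eta> e"
  shows "\<exists>y z. {x \<in> E. v \<in> \<eta> x} = {e, y, z} \<and> distinct [e, y, z]"
proof -
  have "e \<in> {x \<in> E. v \<in> \<eta> x}" using assms by auto
  from card3_obtain2[OF mcubicD(5)[OF cubic v(1)] this] show ?thesis by metis
qed

subsection \<open>The edge reduction\<close>

text \<open>The vertices \<open>u\<close> and \<open>w\<close> are deleted and edges \<open>ac\<close> and \<open>bd\<close> are added; these reuse the names
  \<open>eA\<close> and \<open>eB\<close>, so that a perfect matching of the reduced graph is contained in its lift.\<close>

locale edge_reduction =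
  fixes V :: "'v set" and E :: "'e set" and \<eta> :: "'e \<Rightarrow> 'v set"
    and u w a b c d :: 'v and eA eB h eC eD :: 'e
  assumes cubic: "mcubic V E \<eta>"
    and inc_u: "{e \<in> E. u \<in> \<eta> e} = {eA, eB, h}" and inc_w: "{e \<in> E. w \<in> \<eta> e} = {h, eC, eD}"
    and edges: "distinct [eA, eB, h, eC, eD]"
    and ends: "\<eta> eA = {u, a}" "\<eta> eB = {u, b}" "\<eta> h = {u, w}" "\<eta> eC = {w, c}" "\<eta> eD = {w, d}"
    and ne: "a \<noteq> c" "b \<noteq> d"
begin

definition "V' = V - {u, w}"
definition "E' = E - {h, eC, eD}"
definition "\<eta>' = \<eta>(eA := {a, c}, eB := {b, d})"

lemma fin: "finite V" "finite E" and inV: "u \<in> V" "w \<in> V" and inE: "eA \<in> E" "eB \<in> E" "h \<in> E" "eC \<in> E" "eD \<in> E"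
proof -
  show "finite V" "finite E" using mcubicD[OF cubic] by auto
  show inE: "eA \<in> E" "eB \<in> E" "h \<in> E" "eC \<in> E" "eD \<in> E" using inc_u inc_w by blast+
  show "u \<in> V" "w \<in> V" using mcubicD(3)[OF cubic inE(3)] ends by auto
qed

lemma vs: "u \<noteq> w" "a \<notin> {u, w}" "b \<notin> {u, w}" "c \<notin> {u, w}" "d \<notin> {u, w}"
  and vsV: "a \<in> V" "b \<in> V" "c \<in> V" "d \<in> V"
proof -
  show "a \<in> V" "b \<in> V" "c \<in> V" "d \<in> V"
    using mcubicD(3)[OF cubic inE(1)] mcubicD(3)[OF cubic inE(2)] mcubicD(3)[OF cubic inE(4)]
      mcubicD(3)[OF cubic inE(5)] unfolding ends by blast+
  have iw: "e \<in> {h, eC, eD}" if "e \<in> E" "w \<in> \<eta> e" for e using inc_w that by blast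
  have iu: "e \<in> {eA, eB, h}" if "e \<in> E" "u \<in> \<eta> e" for e using inc_u that by blast
  have "u \<noteq> w" "a \<noteq> u" "b \<noteq> u" "c \<noteq> w" "d \<noteq> w"
    using mcubicD(4)[OF cubic inE(1)] mcubicD(4)[OF cubic inE(2)] mcubicD(4)[OF cubic inE(3)]
      mcubicD(4)[OF cubic inE(4)] mcubicD(4)[OF cubic inE(5)] unfolding ends by (auto simp: card_insert_if split: if_splits)
  moreover have "w \<notin> \<eta> eA" "w \<notin> \<eta> eB" "u \<notin> \<eta> eC" "u \<notin> \<eta> eD"
    using iu[OF inE(4)] iu[OF inE(5)] iw[OF inE(1)] iw[OF inE(2)] edges by auto
  ultimately show "u \<noteq> w" "a \<notin> {u, w}" "b \<notin> {u, w}" "c \<notin> {u, w}" "d \<notin> {u, w}"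
    unfolding ends by simp_all
qed

lemma rest: "e \<in> E - set [eA, eB, h, eC, eD] \<Longrightarrow> u \<notin> \<eta> e \<and> w \<notin> \<eta> e \<and> \<eta>' e = \<eta> e"
  using inc_u inc_w by (auto simp: \<eta>'_def)

text \<open>In the reduced graph \<open>c\<close> loses \<open>eC\<close> and gains
  \<open>eA\<close>, \<open>d\<close> loses \<open>eD\<close> and gains \<open>eB\<close>, and
  \<open>a\<close>, \<open>b\<close> keep their edges. Losses stand on the left to avoid subtraction
  of natural numbers.\<close>

lemma dg_red:
  assumes "K \<subseteq> E" "v \<notin> {u, w}"
  shows "deg \<eta>' (K - {h, eC, eD}) v + of_bool (eC \<in> K \<and> v = c) + of_bool (eD \<in> K \<and> v = d) =
    deg \<eta> K v + of_bool (eA \<in> K \<and> v = c) + of_bool (eB \<in> K \<and> v = d)"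
proof -
  let ?xs = "[eA, eB, h, eC, eD]"
  have finK: "finite K" using assms(1) fin finite_subset by blast
  have "{e \<in> K - {h, eC, eD} - set ?xs. v \<in> \<eta>' e} = {e \<in> K - set ?xs. v \<in> \<eta> e}"
    using rest assms(1) by auto
  then have "deg \<eta>' (K - {h, eC, eD}) v = card {e \<in> K - set ?xs. v \<in> \<eta> e}
      + of_bool (eA \<in> K \<and> v \<in> {a, c}) + of_bool (eB \<in> K \<and> v \<in> {b, d})"
    unfolding deg_def using edges finK
    by (subst card_filter_split[where xs = ?xs]) (auto simp: \<eta>'_def)
  moreover have "deg \<eta> K v = card {e \<in> K - set ?xs. v \<in> \<eta> e}
      + of_bool (eA \<in> K \<and> v = a) + of_bool (eB \<in> K \<and> v = b) + of_bool (eC \<in> K \<and> v = c) + of_bool (eD \<in> K \<and> v = d)"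
    unfolding deg_def using edges finK assms(2)
    by (subst card_filter_split[where xs = ?xs]) (auto simp: ends)
  ultimately show ?thesis using ne by auto
qed

lemma dg_uw:
  assumes "K \<subseteq> E"
  shows "deg \<eta> K u = of_bool (eA \<in> K) + of_bool (eB \<in> K) + of_bool (h \<in> K)"
    and "deg \<eta> K w = of_bool (h \<in> K) + of_bool (eC \<in> K) + of_bool (eD \<in> K)"
proof -
  let ?xs = "[eA, eB, h, eC, eD]"
  have finK: "finite K" using assms(1) fin finite_subset by blast
  have "{e \<in> K - set ?xs. u \<in> \<eta> e} = {}" "{e \<in> K - set ?xs. w \<in> \<eta> e} = {}"
    using rest assms by auto
  then show "deg \<eta> K u = of_bool (eA \<in> K) + of_bool (eB \<in> K) + of_bool (h \<in> K)"
    "deg \<eta> K w = of_bool (h \<in> K) + of_bool (eC \<in> K) + of_bool (eD \<in> K)"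
    unfolding deg_def using edges finK vs
    by (subst card_filter_split[where xs = ?xs]; auto simp: ends)+
qed

lemma ct_red:
  shows "cut_size \<eta>' E' X + of_bool (crosses X {u, a}) + of_bool (crosses X {u, b}) + of_bool (crosses X {u, w}) + of_bool (crosses X {w, c})
     + of_bool (crosses X {w, d}) = cut_size \<eta> E X + of_bool (crosses X {a, c}) + of_bool (crosses X {b, d})"
proof -
  let ?xs = "[eA, eB, h, eC, eD]"
  have "{e \<in> E' - set ?xs. crosses X (\<eta>' e)} = {e \<in> E - set ?xs. crosses X (\<eta> e)}"
    using rest by (auto simp: E'_def)
  then have "cut_size \<eta>' E' X = card {e \<in> E - set ?xs. crosses X (\<eta> e)} + of_bool (crosses X {a, c}) + of_bool (crosses X {b, d})"
    unfolding cut_size_def using edges fin inE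
    by (subst card_filter_split[where xs = ?xs]) (auto simp: \<eta>'_def E'_def)
  moreover have "cut_size \<eta> E X = card {e \<in> E - set ?xs. crosses X (\<eta> e)} + of_bool (crosses X {u, a}) + of_bool (crosses X {u, b})
      + of_bool (crosses X {u, w}) + of_bool (crosses X {w, c}) + of_bool (crosses X {w, d})"
    unfolding cut_size_def using edges fin inE
    by (subst card_filter_split[where xs = ?xs]) (auto simp: ends)
  ultimately show ?thesis by simp
qed

lemma ends'_sub: "e \<in> E' \<Longrightarrow> \<eta>' e \<subseteq> V'"
  using rest[of e] mcubicD(3)[OF cubic, of e] vs vsV by (auto simp: E'_def V'_def \<eta>'_def)

text \<open>Allows \<open>u\<close> and \<open>w\<close> to be put on either side of a cut of the
  reduced graph.\<close>

lemma ct_local: "X \<inter> V' = Y \<inter> V' \<Longrightarrow> cut_size \<eta>' E' X = cut_size \<eta>' E' Y"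
proof -
  assume XY: "X \<inter> V' = Y \<inter> V'"
  have "crosses X (\<eta>' e) = crosses Y (\<eta>' e)" if "e \<in> E'" for e
    using ends'_sub[OF that] XY unfolding crosses_def by blast
  then show ?thesis unfolding cut_size_def by (metis (mono_tags, lifting) Collect_cong)
qed

lemma cubic': "mcubic V' E' \<eta>'"
proof -
  have "card (\<eta>' e) = 2" if "e \<in> E'" for e
    using that ne mcubicD(4)[OF cubic, of e] by (auto simp: \<eta>'_def E'_def)
  moreover have "deg \<eta>' E' v = 3" if "v \<in> V'" for v
    using dg_red[of E v] that cubic inE by (auto simp: V'_def E'_def mcubic_def)
  ultimately show ?thesis using fin ends'_sub by (auto simp: mcubic_def V'_def E'_def)
qed

lemma card': "card V' < card V"
  using fin inV by (auto simp: V'_def intro!: psubset_card_mono)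

lemma pm_lift:
  assumes "pmatching V' E' \<eta>' M" "eA \<notin> M"
  shows "pmatching V E \<eta> (insert (if eB \<in> M then eD else h) M)"
proof -
  define N where "N = insert (if eB \<in> M then eD else h) M"
  have M: "M \<subseteq> E" "h \<notin> M" "eC \<notin> M" "eD \<notin> M" using assms by (auto simp: pmatching_def E'_def)
  then have N: "N \<subseteq> E" "N - {h, eC, eD} = M" "eA \<notin> N" "eB \<in> N \<longleftrightarrow> eD \<in> N" "eD \<in> N \<longleftrightarrow> h \<notin> N" "eC \<notin> N"
    using assms edges inE by (auto simp: N_def)
  have "deg \<eta> N v = 1" if "v \<in> V" for v
  proof (cases "v \<in> {u, w}")
    case True
    then show ?thesis using dg_uw[OF N(1)] N by auto
  next
    case False
    then have "deg \<eta>' M v = 1" using assms that by (auto simp: pmatching_def V'_def)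
    then show ?thesis using dg_red[OF N(1) False] N by auto
  qed
  then show ?thesis using N(1) unfolding N_def[symmetric] by (auto simp: pmatching_def)
qed

text \<open>The deleted edges \<open>h\<close>, \<open>eC\<close>, \<open>eD\<close> are all the
  edges at \<open>w\<close>, so \<open>K\<close> loses an even number of them. By the two
  equivalences the new edges make up for the lost ones at \<open>c\<close> and
  \<open>d\<close>.\<close>

lemma cyc_red:
  assumes "K \<subseteq> E" "even_degrees V \<eta> K" "odd (card K)" "eA \<in> K \<longleftrightarrow> eC \<in> K" "eB \<in> K \<longleftrightarrow> eD \<in> K"
  shows "even_degrees V' \<eta>' (K - {h, eC, eD}) \<and> odd (card (K - {h, eC, eD}))"
proof
  show "even_degrees V' \<eta>' (K - {h, eC, eD})"
    unfolding even_degrees_def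
  proof
    fix v assume v: "v \<in> V'"
    then show "even (deg \<eta>' (K - {h, eC, eD}) v)"
      using dg_red[OF assms(1), of v] assms(2,4,5) by (auto simp: V'_def even_degrees_def)
  qed
  have "finite K" using assms(1) fin finite_subset by blast
  then have "card K = card (K - {h, eC, eD}) + deg \<eta> K w"
    using dg_uw[OF assms(1)] card_split[of K "[h, eC, eD]"] edges by simp
  then show "odd (card (K - {h, eC, eD}))" using assms(2,3) inV by (auto simp: even_degrees_def)
qed

text \<open>Members with both or neither of \<open>eA\<close>, \<open>eC\<close> survive in the
  reduced graph. Any other member contains \<open>h\<close> by \<open>touch\<close> and one of
  \<open>eB\<close>, \<open>eD\<close> by parity. Every lift contains \<open>h\<close> or both
  \<open>eB\<close> and \<open>eD\<close>, so it meets such a member.\<close>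

lemma quelled_red:
  assumes IH: "\<And>g \<C>. odd_family V' E' \<eta>' \<C> \<Longrightarrow> quelled V' E' \<eta>' eA g \<C>"
    and fam: "odd_family V E \<eta> \<C>" and gh: "g \<noteq> h"
    and touch: "\<And>K. K \<in> \<C> \<Longrightarrow> h \<in> K \<or> K \<inter> {eA, eB, eC, eD} = {}"
  shows "quelled V E \<eta> eA g \<C>"
proof -
  define \<C>' where "\<C>' = (\<lambda>K. K - {h, eC, eD}) ` {K \<in> \<C>. eA \<in> K \<longleftrightarrow> eC \<in> K}"
  have par: "eB \<in> K \<longleftrightarrow> eD \<in> K" if "K \<in> \<C>" "eA \<in> K \<longleftrightarrow> eC \<in> K" for K
  proof -
    have "even (deg \<eta> K u)" "even (deg \<eta> K w)" "K \<subseteq> E" using fam that inV by (auto simp: odd_family_def even_degrees_def)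
    then show ?thesis using dg_uw[of K] that(2) by (auto split: if_splits)
  qed
  have "odd_family V' E' \<eta>' \<C>'"
    unfolding odd_family_def
  proof
    show "\<forall>K\<in>\<C>'. K \<subseteq> E' \<and> even_degrees V' \<eta>' K \<and> odd (card K)"
      using fam cyc_red par by (auto simp: \<C>'_def odd_family_def E'_def)
    show "pairwise disjnt \<C>'"
      using fam by (fastforce simp: odd_family_def pairwise_def \<C>'_def disjnt_def)
  qed
  \<comment> \<open>The lift contains \<open>eD\<close> only together with \<open>eB\<close>, so
    forbidding \<open>eB\<close> keeps it from using \<open>eD\<close>.\<close>
  from IH[OF this, of "if g = eD then eB else g"] obtain M where
    M: "pmatching V' E' \<eta>' M" "eA \<notin> M" "(if g = eD then eB else g) \<notin> M" "\<forall>K\<in>\<C>'. M \<inter> K \<noteq> {}"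
    unfolding quelled_def by blast
  define N where "N = insert (if eB \<in> M then eD else h) M"
  have "N \<inter> K \<noteq> {}" if "K \<in> \<C>" for K
  proof (cases "eA \<in> K \<longleftrightarrow> eC \<in> K")
    case True
    then have "M \<inter> (K - {h, eC, eD}) \<noteq> {}" using M(4) that by (auto simp: \<C>'_def)
    then show ?thesis by (auto simp: N_def)
  next
    case False
    have "even (deg \<eta> K u)" "even (deg \<eta> K w)" "K \<subseteq> E" using fam that inV by (auto simp: odd_family_def even_degrees_def)
    then have "h \<in> K" "eB \<in> K \<or> eD \<in> K" using dg_uw[of K] False touch[OF that] by (auto split: if_splits)
    then show ?thesis by (auto simp: N_def)
  qed
  moreover have "eA \<notin> N" "g \<notin> N" using M edges gh by (auto simp: N_def pmatching_def E'_def split: if_splits)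
  ultimately show ?thesis using pm_lift[OF M(1,2)] unfolding quelled_def N_def[symmetric] by blast
qed

text \<open>Let \<open>X\<close>, without \<open>u\<close> and \<open>w\<close>, have a cut of size
  1 in the reduced graph. By \<open>ct_red\<close> its cut in \<open>E\<close> has size 1 plus twice
  the number of pairs \<open>{a, c}\<close>, \<open>{b, d}\<close> inside \<open>X\<close>; for
  \<open>X \<union> {u, w}\<close> it is 1 plus twice the number of pairs disjoint from
  \<open>X\<close>. Neither size is 1, so one pair is inside and the other outside. Then
  \<open>X\<close> has a cut of size 3 with at least two vertices on both sides.\<close>

lemma bridgeless_red:
  assumes nb: "mbridgeless E \<eta>"
    and c3: "\<And>X. X \<subseteq> V \<Longrightarrow> cut_size \<eta> E X = 3 \<Longrightarrow> card X \<le> 1 \<or> card (V - X) \<le> 1"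
  shows "mbridgeless E' \<eta>'"
  unfolding mbridgeless_def
proof (intro allI notI)
  fix X0 assume "cut_size \<eta>' E' X0 = 1"
  define X where "X = X0 \<inter> V'"
  have XV: "X \<subseteq> V" and uX: "u \<notin> X" "w \<notin> X" by (auto simp: X_def V'_def)
  have loc: "cut_size \<eta>' E' X = 1" "cut_size \<eta>' E' (X \<union> {u, w}) = 1"
    using \<open>cut_size \<eta>' E' X0 = 1\<close> ct_local[of X X0] ct_local[of "X \<union> {u, w}" X0] by (auto simp: X_def V'_def)
  have two: "2 \<le> card S" if "p \<in> S" "q \<in> S" "p \<noteq> q" "S \<subseteq> V" for p q S
  proof -
    have "card {p, q} \<le> card S" using that fin by (intro card_mono) (auto intro: finite_subset)
    then show ?thesis using that by simp
  qed
  have "2 \<le> card (V - X)" using two[of u "V - X" w] inV vs uX by auto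
  moreover have "2 \<le> card X" if "a \<in> X \<and> c \<in> X \<or> b \<in> X \<and> d \<in> X" using two[of a X c] two[of b X d] ne XV that by auto
  ultimately have X3: "cut_size \<eta> E X \<noteq> 3" if "a \<in> X \<and> c \<in> X \<or> b \<in> X \<and> d \<in> X" using c3[OF XV] that by linarith
  have n1: "cut_size \<eta> E X \<noteq> 1" "cut_size \<eta> E (X \<union> {u, w}) \<noteq> 1" using nb by (auto simp: mbridgeless_def)
  show False
    using ct_red[of X] ct_red[of "X \<union> {u, w}"] loc X3 n1 vs uX
    by (cases "a \<in> X"; cases "b \<in> X"; cases "c \<in> X"; cases "d \<in> X") simp_all
qed

end

subsection \<open>Contracting one side of a cut\<close>

text \<open>A vertex \<open>y\<close> of \<open>Y\<close> represents the contracted side, and edges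
  keep their names. Hence the vertex type does not change, and a set of edges of the contracted
  graph is also a set of edges of \<open>E\<close>.\<close>

locale contraction =
  fixes V :: "'v set" and E :: "'e set" and \<eta> :: "'e \<Rightarrow> 'v set" and Y :: "'v set" and y :: 'v
  assumes cubic: "mcubic V E \<eta>" and Y: "Y \<subseteq> V" "y \<in> Y" and cut3: "cut_size \<eta> E Y = 3"
begin

definition "\<phi> v = (if v \<in> Y then y else v)"
definition "VC = insert y (V - Y)"
definition "EC = {e \<in> E. \<not> \<eta> e \<subseteq> Y}"
definition "\<eta>C e = \<phi> ` \<eta> e"
definition "D = {e \<in> E. crosses Y (\<eta> e)}"

lemma dg_out: "K \<subseteq> E \<Longrightarrow> v \<in> V - Y \<Longrightarrow> deg \<eta>C (K \<inter> EC) v = deg \<eta> K v"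
proof -
  assume K: "K \<subseteq> E" and v: "v \<in> V - Y"
  have "v \<in> \<eta>C e \<longleftrightarrow> v \<in> \<eta> e" for e using v Y by (auto simp: \<eta>C_def \<phi>_def image_iff)
  moreover have "e \<in> EC" if "e \<in> K" "v \<in> \<eta> e" for e using that v K by (auto simp: EC_def)
  ultimately have "{e \<in> K \<inter> EC. v \<in> \<eta>C e} = {e \<in> K. v \<in> \<eta> e}" by blast
  then show ?thesis by (simp add: deg_def)
qed

lemma dg_in: "K \<subseteq> E \<Longrightarrow> deg \<eta>C (K \<inter> EC) y = card (K \<inter> D)"
proof -
  assume K: "K \<subseteq> E"
  have "y \<in> \<eta>C e \<longleftrightarrow> \<eta> e \<inter> Y \<noteq> {}" for e using Y by (auto simp: \<eta>C_def \<phi>_def image_iff)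
  then have "{e \<in> K \<inter> EC. y \<in> \<eta>C e} = K \<inter> D" using K by (auto simp: EC_def D_def crosses_def)
  then show ?thesis by (simp add: deg_def)
qed

lemma card_D: "card D = 3" and D_EC: "D \<subseteq> EC" and fin: "finite V" "finite E"
  using cut3 mcubicD[OF cubic] by (auto simp: cut_size_def D_def EC_def crosses_def)

lemma cubicC: "mcubic VC EC \<eta>C"
proof -
  have "\<eta>C e \<subseteq> VC \<and> card (\<eta>C e) = 2" if e: "e \<in> EC" for e
  proof
    have eE: "e \<in> E" "\<not> \<eta> e \<subseteq> Y" using e by (auto simp: EC_def)
    then show "\<eta>C e \<subseteq> VC" using mcubicD(3)[OF cubic] by (auto simp: \<eta>C_def \<phi>_def VC_def)
    obtain x where x: "x \<in> \<eta> e" "x \<notin> Y" using eE by blast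
    obtain z where "\<eta> e = {x, z}" "z \<noteq> x" by (rule other_end[OF mcubicD(4)[OF cubic eE(1)] x(1)])
    then show "card (\<eta>C e) = 2" using x Y by (cases "z \<in> Y") (auto simp: \<eta>C_def \<phi>_def)
  qed
  moreover have "deg \<eta>C EC v = 3" if "v \<in> VC" for v
  proof (cases "v = y")
    case True
    have "E \<inter> EC = EC" "E \<inter> D = D" by (auto simp: EC_def D_def)
    then show ?thesis using dg_in[of E] card_D True by simp
  next
    case False
    have "E \<inter> EC = EC" by (auto simp: EC_def)
    then show ?thesis using dg_out[of E v] False that cubic by (auto simp: mcubic_def VC_def)
  qed
  ultimately show ?thesis using fin by (auto simp: mcubic_def VC_def EC_def)
qed

text \<open>A cut of the contracted graph consists of the same edges as the cut of the preimage
  under \<open>\<phi>\<close> in the original graph.\<close>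

lemma bridgelessC: "mbridgeless E \<eta> \<Longrightarrow> mbridgeless EC \<eta>C"
proof -
  assume nb: "mbridgeless E \<eta>"
  have "cut_size \<eta>C EC Z = cut_size \<eta> E (\<phi> -` Z)" for Z
  proof -
    have "crosses Z (\<phi> ` s) \<longleftrightarrow> crosses (\<phi> -` Z) s" for s by (auto simp: crosses_def)
    moreover have "\<not> crosses (\<phi> -` Z) (\<eta> e)" if "\<eta> e \<subseteq> Y" for e
    proof -
      have "\<phi> x = y" if "x \<in> \<eta> e" for x using that \<open>\<eta> e \<subseteq> Y\<close> by (auto simp: \<phi>_def)
      then have "\<phi> p = \<phi> q" if "p \<in> \<eta> e" "q \<in> \<eta> e" for p q using that by simp
      then show ?thesis unfolding crosses_def by blast
    qed
    ultimately have "{e \<in> EC. crosses Z (\<eta>C e)} = {e \<in> E. crosses (\<phi> -` Z) (\<eta> e)}"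
      by (auto simp: EC_def \<eta>C_def)
    then show ?thesis by (simp add: cut_size_def)
  qed
  then show ?thesis using nb by (simp add: mbridgeless_def)
qed

lemma cardC: "2 \<le> card Y \<Longrightarrow> card VC < card V"
proof -
  assume "2 \<le> card Y"
  moreover have "card VC = Suc (card (V - Y))" using fin Y by (simp add: VC_def)
  moreover have "card (V - Y) + card Y = card V"
    using card_Diff_subset[of Y V] card_mono[of V Y] fin Y finite_subset by fastforce
  ultimately show ?thesis by linarith
qed

lemma even_cut: "K \<subseteq> E \<Longrightarrow> even_degrees V \<eta> K \<Longrightarrow> even (card (K \<inter> D))"
proof -
  assume K: "K \<subseteq> E" and even_degrees: "even_degrees V \<eta> K"
  have finK: "finite K" "finite Y" using K Y fin finite_subset by blast+
  have "even (card {e \<in> K. crosses Y (\<eta> e)})"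
    using K even_degrees Y mcubicD(4)[OF cubic] by (intro even_crossing finK) (auto simp: even_degrees_def)
  moreover have "{e \<in> K. crosses Y (\<eta> e)} = K \<inter> D" using K by (auto simp: D_def)
  ultimately show ?thesis by simp
qed

text \<open>At \<open>y\<close> the degree of \<open>K \<inter> EC\<close> is
  \<open>card (K \<inter> D)\<close>, which is even by \<open>even_cut\<close>. Members whose part
  on this side has even size are left to the other side.\<close>

lemma odd_familyC:
  assumes "odd_family V E \<eta> \<C>"
  shows "odd_family VC EC \<eta>C ((\<lambda>K. K \<inter> EC) ` {K \<in> \<C>. odd (card (K \<inter> EC))})"
proof -
  have "even_degrees VC \<eta>C (K \<inter> EC)" if "K \<in> \<C>" for K
  proof -
    have K: "K \<subseteq> E" "even_degrees V \<eta> K" using assms that by (auto simp: odd_family_def)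
    show ?thesis using dg_out[OF K(1)] dg_in[OF K(1)] even_cut[OF K] K(2) by (auto simp: VC_def even_degrees_def)
  qed
  moreover have "pairwise disjnt ((\<lambda>K. K \<inter> EC) ` {K \<in> \<C>. odd (card (K \<inter> EC))})"
    using assms by (fastforce simp: odd_family_def pairwise_def disjnt_def)
  ultimately show ?thesis by (auto simp: odd_family_def)
qed

lemma side:
  assumes "quelled VC EC \<eta>C f g ((\<lambda>K. K \<inter> EC) ` {K \<in> \<C>. odd (card (K \<inter> EC))})"
  shows "\<exists>M. (M \<subseteq> EC \<and> (\<forall>v\<in>V - Y. deg \<eta> M v = 1) \<and> card (M \<inter> D) = 1 \<and>
      (\<forall>K\<in>\<C>. odd (card (K \<inter> EC)) \<longrightarrow> M \<inter> K \<noteq> {})) \<and> f \<notin> M \<and> g \<notin> M"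
proof -
  obtain M where M: "pmatching VC EC \<eta>C M" "f \<notin> M" "g \<notin> M"
    "\<And>K. K \<in> \<C> \<Longrightarrow> odd (card (K \<inter> EC)) \<Longrightarrow> M \<inter> (K \<inter> EC) \<noteq> {}"
    using assms by (auto simp: quelled_def)
  have ME: "M \<subseteq> E" "M \<inter> EC = M" "M \<subseteq> EC" using M(1) by (auto simp: pmatching_def EC_def)
  have "deg \<eta> M v = 1" if "v \<in> V - Y" for v
    using dg_out[OF ME(1) that] M(1) that ME(2) by (simp add: pmatching_def VC_def)
  moreover have "card (M \<inter> D) = 1"
    using dg_in[OF ME(1)] M(1) ME(2) by (simp add: pmatching_def VC_def)
  moreover have "M \<inter> K \<noteq> {}" if "K \<in> \<C>" "odd (card (K \<inter> EC))" for K
    using M(4)[OF that] by blast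
  ultimately show ?thesis using M(2,3) ME(3) by (intro exI[of _ M]) simp
qed

end

section \<open>Gluing matchings along a cut of size 3\<close>

text \<open>If one of the forbidden edges lies strictly on each side, the first side can use at least two
  of the three cut edges, and the second side can be kept from using the third.\<close>

lemma match_at_cut:
  assumes D: "D = E1 \<inter> E2" "card D = 3"
    and P1: "\<And>M. P1 M \<Longrightarrow> M \<subseteq> E1 \<and> card (M \<inter> D) = 1" and P2: "\<And>M. P2 M \<Longrightarrow> M \<subseteq> E2 \<and> card (M \<inter> D) = 1"
    and S1: "\<And>f g. \<exists>M. P1 M \<and> f \<notin> M \<and> g \<notin> M" and S2: "\<And>f g. \<exists>M. P2 M \<and> f \<notin> M \<and> g \<notin> M"
  shows "\<exists>M1 M2. P1 M1 \<and> P2 M2 \<and> M1 \<inter> D = M2 \<inter> D \<and> f \<notin> M1 \<union> M2 \<and> g \<notin> M1 \<union> M2"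
proof -
  \<comment> \<open>Here no forbidden edge lies strictly on the second side. A matching of the first
    side that avoids both uses one cut edge \<open>i\<close>; forbidding the other two cut edges
    forces \<open>i\<close> on the second side. A forbidden edge in \<open>M2\<close> would be a cut
    edge, hence in \<open>M1\<close>.\<close>
  have same: "\<exists>M1 M2. Q1 M1 \<and> Q2 M2 \<and> M1 \<inter> D = M2 \<inter> D \<and> f \<notin> M1 \<union> M2 \<and> g \<notin> M1 \<union> M2"
    if QD: "D = F1 \<inter> F2"
      and Q1: "\<And>M. Q1 M \<Longrightarrow> M \<subseteq> F1 \<and> card (M \<inter> D) = 1" and Q2: "\<And>M. Q2 M \<Longrightarrow> M \<subseteq> F2 \<and> card (M \<inter> D) = 1"
      and T1: "\<And>f g. \<exists>M. Q1 M \<and> f \<notin> M \<and> g \<notin> M" and T2: "\<And>f g. \<exists>M. Q2 M \<and> f \<notin> M \<and> g \<notin> M"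
      and fg: "f \<notin> F2 - F1" "g \<notin> F2 - F1" for Q1 Q2 F1 F2
  proof -
    obtain M1 where M1: "Q1 M1" "f \<notin> M1" "g \<notin> M1" using T1 by blast
    obtain i where i: "M1 \<inter> D = {i}" using Q1[OF M1(1)] by (auto simp: card_1_singleton_iff)
    then obtain j k where jk: "D = {i, j, k}" "distinct [i, j, k]"
      using card3_obtain2[OF D(2), of i] by blast
    obtain M2 where M2: "Q2 M2" "j \<notin> M2" "k \<notin> M2" using T2 by blast
    obtain i' where i': "M2 \<inter> D = {i'}" using Q2[OF M2(1)] by (auto simp: card_1_singleton_iff)
    then have "i' \<in> M2" "i' \<in> {i, j, k}" using jk(1) by blast+
    then have i2: "M2 \<inter> D = {i}" using M2 i' by auto
    have "h \<notin> M2" if "h \<notin> F2 - F1" "h \<notin> M1" for h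
    proof
      assume h: "h \<in> M2"
      then have "h \<in> M2 \<inter> D" using Q2[OF M2(1)] that(1) QD by blast
      then have "h \<in> M1 \<inter> D" unfolding i i2 .
      then show False using that(2) by blast
    qed
    then have "f \<notin> M2" "g \<notin> M2" using fg M1 by auto
    then show ?thesis using M1 M2 i i2 by blast
  qed
  have diff: "\<exists>M1 M2. Q1 M1 \<and> Q2 M2 \<and> M1 \<inter> D = M2 \<inter> D \<and> f \<notin> M1 \<union> M2 \<and> g \<notin> M1 \<union> M2"
    if Q1: "\<And>M. Q1 M \<Longrightarrow> M \<subseteq> F1 \<and> card (M \<inter> D) = 1" and Q2: "\<And>M. Q2 M \<Longrightarrow> M \<subseteq> F2 \<and> card (M \<inter> D) = 1"
      and T1: "\<And>f g. \<exists>M. Q1 M \<and> f \<notin> M \<and> g \<notin> M" and T2: "\<And>f g. \<exists>M. Q2 M \<and> f \<notin> M \<and> g \<notin> M"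
      and fg: "f \<notin> F2" "g \<notin> F1" for Q1 Q2 F1 F2
  proof -
    obtain M1 where M1: "Q1 M1" "f \<notin> M1" using T1 by blast
    obtain i where i: "M1 \<inter> D = {i}" using Q1[OF M1(1)] by (auto simp: card_1_singleton_iff)
    obtain M1' where M1': "Q1 M1'" "f \<notin> M1'" "i \<notin> M1'" using T1 by blast
    obtain j where j: "M1' \<inter> D = {j}" using Q1[OF M1'(1)] by (auto simp: card_1_singleton_iff)
    obtain k where k: "D = {i, j, k}" "distinct [i, j, k]"
    proof (rule card3_obtain1[OF D(2), of i j])
      show "i \<in> D" "j \<in> D" using i j by blast+
      have "j \<in> M1'" using j by blast
      then show "i \<noteq> j" using M1' by blast
    qed
    obtain M2 where M2: "Q2 M2" "g \<notin> M2" "k \<notin> M2" using T2 by blast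
    obtain l where l: "M2 \<inter> D = {l}" using Q2[OF M2(1)] by (auto simp: card_1_singleton_iff)
    have "l \<in> M2" "l \<in> {i, j, k}" using l k(1) by blast+
    then have "l = i \<or> l = j" using M2 by auto
    moreover have "f \<notin> M2" "g \<notin> M1" "g \<notin> M1'" using Q2[OF M2(1)] Q1[OF M1(1)] Q1[OF M1'(1)] fg by blast+
    ultimately show ?thesis using M1 M1' M2 i j l by blast
  qed
  have D': "D = E2 \<inter> E1" using D by blast
  consider "f \<notin> E2 - E1" "g \<notin> E2 - E1" | "f \<notin> E1 - E2" "g \<notin> E1 - E2" | "f \<notin> E2" "g \<notin> E1" | "f \<notin> E1" "g \<notin> E2"
    by blast
  then show ?thesis
  proof cases
    case 1 then show ?thesis using same[OF D(1) P1 P2 S1 S2] by blast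
  next
    case 2
    then obtain M2 M1 where "P2 M2 \<and> P1 M1 \<and> M2 \<inter> D = M1 \<inter> D \<and> f \<notin> M2 \<union> M1 \<and> g \<notin> M2 \<union> M1"
      using same[OF D' P2 P1 S2 S1] by blast
    then show ?thesis by (metis Un_commute)
  next
    case 3 then show ?thesis using diff[OF P1 P2 S1 S2] by blast
  next
    case 4
    then obtain M2 M1 where "P2 M2 \<and> P1 M1 \<and> M2 \<inter> D = M1 \<inter> D \<and> f \<notin> M2 \<union> M1 \<and> g \<notin> M2 \<union> M1"
      using diff[OF P2 P1 S2 S1] by blast
    then show ?thesis by (metis Un_commute)
  qed
qed

text \<open>Both contractions have fewer vertices, and \<open>match_at_cut\<close> makes their
  matchings agree on the cut, so that the union is a perfect matching. The two parts of a member
  \<open>K\<close> have total size \<open>card K\<close> plus the even number of its cut edges;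
  hence one part is odd and is met on its side.\<close>

lemma quelled_3cut:
  fixes V :: "'v set" and E :: "'e set"
  assumes IH: "\<And>V' E' (\<eta>' :: 'e \<Rightarrow> 'v set) f g \<C>. card V' < card V \<Longrightarrow> mcubic V' E' \<eta>' \<Longrightarrow> mbridgeless E' \<eta>' \<Longrightarrow>
      odd_family V' E' \<eta>' \<C> \<Longrightarrow> quelled V' E' \<eta>' f g \<C>"
    and cubic: "mcubic V E \<eta>" and nb: "mbridgeless E \<eta>" and fam: "odd_family V E \<eta> \<C>"
    and X: "X \<subseteq> V" "2 \<le> card X" "2 \<le> card (V - X)" "cut_size \<eta> E X = 3"
  shows "quelled V E \<eta> f g \<C>"
proof -
  obtain x where x: "x \<in> X" using X(2) by fastforce
  obtain y where y: "y \<in> V - X" using X(3) by (metis card.empty equals0I not_numeral_le_zero)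
  have crosses: "crosses (V - X) (\<eta> e) \<longleftrightarrow> crosses X (\<eta> e)" if "e \<in> E" for e
    using mcubicD(3)[OF cubic that] by (auto simp: crosses_def)
  then have "cut_size \<eta> E (V - X) = 3" using X(4) by (simp add: cut_size_def cong: conj_cong)
  \<comment> \<open>The contraction \<open>c1\<close> keeps the side \<open>X\<close> and shrinks
    its complement; \<open>c2\<close> does the reverse.\<close>
  then interpret c1: contraction V E \<eta> "V - X" y by unfold_locales (use cubic y in auto)
  interpret c2: contraction V E \<eta> X x by unfold_locales (use cubic x X in auto)
  let ?P1 = "\<lambda>M. M \<subseteq> c1.EC \<and> (\<forall>v\<in>X. deg \<eta> M v = 1) \<and> card (M \<inter> c2.D) = 1 \<and>
      (\<forall>K\<in>\<C>. odd (card (K \<inter> c1.EC)) \<longrightarrow> M \<inter> K \<noteq> {})"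
  let ?P2 = "\<lambda>M. M \<subseteq> c2.EC \<and> (\<forall>v\<in>V - X. deg \<eta> M v = 1) \<and> card (M \<inter> c2.D) = 1 \<and>
      (\<forall>K\<in>\<C>. odd (card (K \<inter> c2.EC)) \<longrightarrow> M \<inter> K \<noteq> {})"
  have DD: "c1.D = c2.D" using crosses by (auto simp: c1.D_def c2.D_def)
  have VX: "V - (V - X) = X" using X(1) by blast
  have S1: "\<exists>M. ?P1 M \<and> f \<notin> M \<and> g \<notin> M" for f g
    using c1.side[OF IH[OF c1.cardC[OF X(3)] c1.cubicC c1.bridgelessC[OF nb] c1.odd_familyC[OF fam]]] VX DD by metis
  have S2: "\<exists>M. ?P2 M \<and> f \<notin> M \<and> g \<notin> M" for f g
    by (rule c2.side[OF IH[OF c2.cardC[OF X(2)] c2.cubicC c2.bridgelessC[OF nb] c2.odd_familyC[OF fam]]])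
  have DE: "c2.D = c1.EC \<inter> c2.EC"
    using mcubicD(3)[OF cubic] by (auto simp: c2.D_def c1.EC_def c2.EC_def crosses_def)
  obtain M1 M2 where M: "?P1 M1" "?P2 M2" "M1 \<inter> c2.D = M2 \<inter> c2.D" "f \<notin> M1 \<union> M2" "g \<notin> M1 \<union> M2"
    using match_at_cut[OF DE c2.card_D, of ?P1 ?P2 f g] S1 S2 by blast
  have "deg \<eta> (M1 \<union> M2) v = 1" if v: "v \<in> V" for v
  proof (cases "v \<in> X")
    case True
    have "{e \<in> M1 \<union> M2. v \<in> \<eta> e} = {e \<in> M1. v \<in> \<eta> e}"
    proof -
      have "e \<in> M1" if "e \<in> M2" "v \<in> \<eta> e" for e
      proof -
        have "e \<in> c2.D" using that M(2) True by (auto simp: c2.D_def c2.EC_def crosses_def)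
        then show ?thesis using M(3) that by blast
      qed
      then show ?thesis by blast
    qed
    then show ?thesis using M(1) True by (simp add: deg_def)
  next
    case False
    have "{e \<in> M1 \<union> M2. v \<in> \<eta> e} = {e \<in> M2. v \<in> \<eta> e}"
    proof -
      have "e \<in> M2" if "e \<in> M1" "v \<in> \<eta> e" for e
      proof -
        have "e \<in> c1.EC" using that M(1) by blast
        then have "e \<in> E" "\<not> \<eta> e \<subseteq> V - X" "\<eta> e \<subseteq> V" using mcubicD(3)[OF cubic] by (auto simp: c1.EC_def)
        then have "e \<in> c2.D" using that False by (auto simp: c2.D_def crosses_def)
        then show ?thesis using M(3) that by blast
      qed
      then show ?thesis by blast
    qed
    then show ?thesis using M(2) v False by (simp add: deg_def)
  qed
  moreover have "M1 \<union> M2 \<subseteq> E" using M(1,2) by (auto simp: c1.EC_def c2.EC_def)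
  moreover have "(M1 \<union> M2) \<inter> K \<noteq> {}" if K: "K \<in> \<C>" for K
  proof -
    have KE: "K \<subseteq> E" "even_degrees V \<eta> K" "odd (card K)" using fam K by (auto simp: odd_family_def)
    have finK: "finite K" using KE c1.fin finite_subset by blast
    have ne: "\<eta> e \<noteq> {}" if "e \<in> E" for e using mcubicD(4)[OF cubic that] by auto
    have "K = (K \<inter> c1.EC) \<union> (K \<inter> c2.EC)" using KE(1) ne by (fastforce simp: c1.EC_def c2.EC_def)
    moreover have "(K \<inter> c1.EC) \<inter> (K \<inter> c2.EC) = K \<inter> c2.D" using DE by blast
    ultimately have "card (K \<inter> c1.EC) + card (K \<inter> c2.EC) = card K + card (K \<inter> c2.D)"
      using card_Un_Int[of "K \<inter> c1.EC" "K \<inter> c2.EC"] finK by simp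
    then have "odd (card (K \<inter> c1.EC)) \<or> odd (card (K \<inter> c2.EC))"
      using c2.even_cut[OF KE(1,2)] KE(3) by (metis even_add)
    then show ?thesis using M(1,2) K by blast
  qed
  ultimately show ?thesis using M(4,5) unfolding quelled_def pmatching_def by blast
qed

subsection \<open>Parallel edges\<close>

text \<open>Three parallel edges form a component, which is removed. Each member contains an even
  number of them and so stays odd, and at least one of the three is not forbidden.\<close>

lemma quelled_theta:
  fixes V :: "'v set" and E :: "'e set"
  assumes IH: "\<And>V' E' (\<eta>' :: 'e \<Rightarrow> 'v set) f g \<C>. card V' < card V \<Longrightarrow> mcubic V' E' \<eta>' \<Longrightarrow> mbridgeless E' \<eta>' \<Longrightarrow>
      odd_family V' E' \<eta>' \<C> \<Longrightarrow> quelled V' E' \<eta>' f g \<C>"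
    and cubic: "mcubic V E \<eta>" and nb: "mbridgeless E \<eta>" and fam: "odd_family V E \<eta> \<C>"
    and inc: "{e \<in> E. x \<in> \<eta> e} = {e1, e2, e3}" and d: "distinct [e1, e2, e3]"
    and ends: "\<eta> e1 = {x, y}" "\<eta> e2 = {x, y}" "\<eta> e3 = {x, y}"
  shows "quelled V E \<eta> f g \<C>"
proof -
  have e: "e1 \<in> E" "e2 \<in> E" "e3 \<in> E" using inc by blast+
  have xy: "x \<in> V" "y \<in> V" "x \<noteq> y" using mcubicD(3,4)[OF cubic e(1)] ends by auto
  have fin: "finite V" "finite E" using mcubicD[OF cubic] by auto
  have "{e1, e2, e3} = {e \<in> E. y \<in> \<eta> e}"
    using e ends d mcubicD(5)[OF cubic xy(2)] fin by (intro card_subset_eq) auto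
  then have inc_y: "{e \<in> E. y \<in> \<eta> e} = {e1, e2, e3}" by simp
  define E' where "E' = E - {e1, e2, e3}"
  have E': "x \<notin> \<eta> e \<and> y \<notin> \<eta> e" if "e \<in> E'" for e using inc inc_y that unfolding E'_def by blast
  have deg: "deg \<eta> (K - {e1, e2, e3}) v = deg \<eta> K v" if "v \<notin> {x, y}" for K v
  proof -
    have "{e \<in> K - {e1, e2, e3}. v \<in> \<eta> e} = {e \<in> K. v \<in> \<eta> e}" using that ends by auto
    then show ?thesis by (simp add: deg_def)
  qed
  have dgxy: "deg \<eta> K v = card (K \<inter> {e1, e2, e3})" if "v \<in> {x, y}" "K \<subseteq> E" for K v
  proof -
    have "{e \<in> K. v \<in> \<eta> e} = K \<inter> {e1, e2, e3}" using that inc inc_y by blast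
    then show ?thesis by (simp add: deg_def)
  qed
  have cubic': "mcubic (V - {x, y}) E' \<eta>"
    using fin mcubicD(3,4)[OF cubic] E' deg[of _ E] cubic unfolding mcubic_def E'_def by auto
  have nb': "mbridgeless E' \<eta>"
    unfolding mbridgeless_def
  proof
    fix X
    have "crosses X (\<eta> e) \<longleftrightarrow> crosses (X - {x, y}) (\<eta> e)" if "e \<in> E'" for e using E'[OF that] by (auto simp: crosses_def)
    moreover have "\<not> crosses (X - {x, y}) (\<eta> e)" if "e \<in> {e1, e2, e3}" for e using ends that by auto
    ultimately have "{e \<in> E'. crosses X (\<eta> e)} = {e \<in> E. crosses (X - {x, y}) (\<eta> e)}"
      unfolding E'_def by blast
    then show "cut_size \<eta> E' X \<noteq> 1" using nb by (auto simp: mbridgeless_def cut_size_def)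
  qed
  have "odd (card (K - {e1, e2, e3}))" if "K \<in> \<C>" for K
  proof -
    have K: "K \<subseteq> E" "even_degrees V \<eta> K" "odd (card K)" using fam that by (auto simp: odd_family_def)
    have "finite K" using K(1) fin finite_subset by blast
    then have "card K = card (K - {e1, e2, e3}) + card (K \<inter> {e1, e2, e3})"
      by (metis Int_commute add.commute card_Int_Diff)
    then show ?thesis using K(2,3) dgxy[of x K] K(1) xy(1) unfolding even_degrees_def by (metis even_add insertI1)
  qed
  moreover have "even_degrees (V - {x, y}) \<eta> (K - {e1, e2, e3})" if "K \<in> \<C>" for K
    using fam that deg by (auto simp: odd_family_def even_degrees_def)
  moreover have "pairwise disjnt ((\<lambda>K. K - {e1, e2, e3}) ` \<C>)"
    using fam by (fastforce simp: odd_family_def pairwise_def disjnt_def)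
  ultimately have fam': "odd_family (V - {x, y}) E' \<eta> ((\<lambda>K. K - {e1, e2, e3}) ` \<C>)"
    using fam by (auto simp: odd_family_def E'_def)
  have "card (V - {x, y}) < card V" using fin xy by (intro psubset_card_mono) auto
  from IH[OF this cubic' nb' fam', of f g] obtain M where
    M: "pmatching (V - {x, y}) E' \<eta> M" "f \<notin> M" "g \<notin> M" "\<forall>K\<in>\<C>. M \<inter> (K - {e1, e2, e3}) \<noteq> {}"
    unfolding quelled_def by auto
  obtain i where i: "i \<in> {e1, e2, e3}" "i \<notin> {f, g}" using d by auto
  have ME: "insert i M \<subseteq> E" "insert i M - {e1, e2, e3} = M" "insert i M \<inter> {e1, e2, e3} = {i}"
    using M(1) e i(1) by (auto simp: pmatching_def E'_def)
  have "pmatching V E \<eta> (insert i M)"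
    unfolding pmatching_def
  proof (intro conjI ballI ME(1))
    fix v assume "v \<in> V"
    show "deg \<eta> (insert i M) v = 1"
    proof (cases "v \<in> {x, y}")
      case True
      then show ?thesis using dgxy[OF True ME(1)] ME(3) by simp
    next
      case False
      then show ?thesis using deg[OF False, of "insert i M"] ME(2) M(1) \<open>v \<in> V\<close> by (auto simp: pmatching_def)
    qed
  qed
  then show ?thesis using M i unfolding quelled_def by blast
qed

text \<open>The path from \<open>p\<close> over the digon to \<open>q\<close> is replaced by one
  edge \<open>pq\<close> that reuses the name \<open>e3\<close>. A matching is lifted by
  \<open>e4\<close> if it contains \<open>e3\<close>, and by \<open>e1\<close> or \<open>e2\<close>
  otherwise.\<close>

lemma quelled_digon:
  fixes V :: "'v set" and E :: "'e set"
  assumes IH: "\<And>V' E' (\<eta>' :: 'e \<Rightarrow> 'v set) f g \<C>. card V' < card V \<Longrightarrow> mcubic V' E' \<eta>' \<Longrightarrow> mbridgeless E' \<eta>' \<Longrightarrow>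
      odd_family V' E' \<eta>' \<C> \<Longrightarrow> quelled V' E' \<eta>' f g \<C>"
    and cubic: "mcubic V E \<eta>" and nb: "mbridgeless E \<eta>" and fam: "odd_family V E \<eta> \<C>"
    and inc_x: "{e \<in> E. x \<in> \<eta> e} = {e1, e2, e3}" and inc_y: "{e \<in> E. y \<in> \<eta> e} = {e1, e2, e4}"
    and d: "distinct [e1, e2, e3, e4]" and xy: "x \<noteq> y"
    and ends: "\<eta> e1 = {x, y}" "\<eta> e2 = {x, y}" "\<eta> e3 = {x, p}" "\<eta> e4 = {y, q}"
  shows "quelled V E \<eta> f g \<C>"
proof -
  let ?xs = "[e1, e2, e3, e4]"
  have e: "e1 \<in> E" "e2 \<in> E" "e3 \<in> E" "e4 \<in> E" using inc_x inc_y by blast+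
  have fin: "finite V" "finite E" using mcubicD[OF cubic] by auto
  have V: "x \<in> V" "y \<in> V" "p \<in> V" "q \<in> V"
    using mcubicD(3)[OF cubic e(1)] mcubicD(3)[OF cubic e(3)] mcubicD(3)[OF cubic e(4)] unfolding ends by auto
  have pq: "p \<noteq> x" "q \<noteq> y" using mcubicD(4)[OF cubic e(3)] mcubicD(4)[OF cubic e(4)] unfolding ends by auto
  have "y \<notin> \<eta> e3" "x \<notin> \<eta> e4" using inc_x inc_y e d by auto
  then have pq2: "p \<noteq> y" "q \<noteq> x" unfolding ends by auto
  have rest: "x \<notin> \<eta> e \<and> y \<notin> \<eta> e" if "e \<in> E - set ?xs" for e using inc_x inc_y that by auto
  have cut_size: "cut_size \<eta> E X = card {e \<in> E - set ?xs. crosses X (\<eta> e)} + of_bool (crosses X {x, y}) + of_bool (crosses X {x, y})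
      + of_bool (crosses X {x, p}) + of_bool (crosses X {y, q})" for X
    unfolding cut_size_def using d fin e by (subst card_filter_split[where xs = ?xs]) (auto simp: ends)
  \<comment> \<open>Otherwise the third edge \<open>r\<close> at \<open>p\<close> would be the only
    edge leaving \<open>{x, y, p}\<close>.\<close>
  have "p \<noteq> q"
  proof
    assume "p = q"
    then have "p \<in> \<eta> e3" "p \<in> \<eta> e4" "e3 \<noteq> e4" using ends d by auto
    then obtain r where r: "{e \<in> E. p \<in> \<eta> e} = {e3, e4, r}" "distinct [e3, e4, r]"
      using third_edge[OF cubic V(3) e(3,4)] by blast
    have re: "r \<in> E" "p \<in> \<eta> r" using r by blast+
    have "r \<noteq> e1" "r \<noteq> e2" using re ends pq pq2 by auto
    then have "r \<in> E - set ?xs" using re r by auto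
    obtain s where s: "\<eta> r = {p, s}" "s \<noteq> p" by (rule other_end[OF mcubicD(4)[OF cubic re(1)] re(2)])
    have "{e \<in> E - set ?xs. crosses {x, y, p} (\<eta> e)} = {r}"
    proof -
      have "crosses {x, y, p} (\<eta> e) \<longleftrightarrow> e = r" if "e \<in> E - set ?xs" for e
      proof
        assume "crosses {x, y, p} (\<eta> e)"
        then have "p \<in> \<eta> e" using rest[OF that] by (auto simp: crosses_def)
        then show "e = r" using that r by auto
      next
        assume "e = r"
        then show "crosses {x, y, p} (\<eta> e)" using s rest[OF \<open>r \<in> E - set ?xs\<close>] by auto
      qed
      then show ?thesis using \<open>r \<in> E - set ?xs\<close> by blast
    qed
    then have "cut_size \<eta> E {x, y, p} = 1" unfolding cut_size using \<open>p = q\<close> by simp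
    then show False using nb by (simp add: mbridgeless_def)
  qed
  define \<eta>' where "\<eta>' = \<eta>(e3 := {p, q})"
  define E' where "E' = E - {e1, e2, e4}"
  have rest': "\<eta>' e = \<eta> e" if "e \<notin> set ?xs" for e using that by (simp add: \<eta>'_def)
  have sub': "\<eta>' e \<subseteq> V - {x, y}" if "e \<in> E'" for e
  proof (cases "e = e3")
    case False
    then have "e \<in> E - set ?xs" using that by (auto simp: E'_def)
    then show ?thesis using rest[of e] mcubicD(3)[OF cubic, of e] False by (auto simp: \<eta>'_def)
  qed (use V pq pq2 in \<open>auto simp: \<eta>'_def\<close>)
  have dg': "deg \<eta>' (K - {e1, e2, e4}) v + of_bool (e4 \<in> K \<and> v = q) = deg \<eta> K v + of_bool (e3 \<in> K \<and> v = q)"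
    if "K \<subseteq> E" "v \<notin> {x, y}" for K v
  proof -
    have finK: "finite K" using that fin finite_subset by blast
    have "{e \<in> K - {e1, e2, e4} - set ?xs. v \<in> \<eta>' e} = {e \<in> K - set ?xs. v \<in> \<eta> e}"
      using rest' by auto
    then have "deg \<eta>' (K - {e1, e2, e4}) v = card {e \<in> K - set ?xs. v \<in> \<eta> e} + of_bool (e3 \<in> K \<and> v \<in> {p, q})"
      unfolding deg_def using d finK
      by (subst card_filter_split[where xs = ?xs]) (auto simp: \<eta>'_def)
    moreover have "deg \<eta> K v = card {e \<in> K - set ?xs. v \<in> \<eta> e} + of_bool (e3 \<in> K \<and> v = p) + of_bool (e4 \<in> K \<and> v = q)"
      unfolding deg_def using d finK that(2)
      by (subst card_filter_split[where xs = ?xs]) (auto simp: ends)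
    ultimately show ?thesis using \<open>p \<noteq> q\<close> by auto
  qed
  have dgx: "deg \<eta> K x = of_bool (e1 \<in> K) + of_bool (e2 \<in> K) + of_bool (e3 \<in> K)"
    "deg \<eta> K y = of_bool (e1 \<in> K) + of_bool (e2 \<in> K) + of_bool (e4 \<in> K)" if "K \<subseteq> E" for K
  proof -
    have finK: "finite K" using that fin finite_subset by blast
    have "{e \<in> K - set ?xs. x \<in> \<eta> e} = {}" "{e \<in> K - set ?xs. y \<in> \<eta> e} = {}" using rest that by auto
    then show "deg \<eta> K x = of_bool (e1 \<in> K) + of_bool (e2 \<in> K) + of_bool (e3 \<in> K)"
      "deg \<eta> K y = of_bool (e1 \<in> K) + of_bool (e2 \<in> K) + of_bool (e4 \<in> K)"
      unfolding deg_def using d finK pq pq2 xy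
      by (subst card_filter_split[where xs = ?xs]; auto simp: ends)+
  qed
  have "card (\<eta>' e) = 2" if "e \<in> E'" for e
    using that \<open>p \<noteq> q\<close> mcubicD(4)[OF cubic, of e] by (auto simp: \<eta>'_def E'_def)
  moreover have "deg \<eta>' E' v = 3" if "v \<in> V - {x, y}" for v
    using dg'[of E v] that cubic e by (auto simp: E'_def mcubic_def)
  ultimately have cubic': "mcubic (V - {x, y}) E' \<eta>'"
    using fin sub' by (auto simp: mcubic_def E'_def)
  have nb': "mbridgeless E' \<eta>'"
    unfolding mbridgeless_def
  proof
    fix X0
    \<comment> \<open>With \<open>x\<close> and \<open>y\<close> on the side of \<open>p\<close>,
      neither the digon nor \<open>e3\<close> is crossed in the original graph, and
      \<open>e4\<close> is crossed exactly if the new edge \<open>pq\<close> is.\<close>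
    define X where "X = (if p \<in> X0 then X0 \<union> {x, y} else X0 - {x, y})"
    have "{e \<in> E' - set ?xs. crosses X0 (\<eta>' e)} = {e \<in> E - set ?xs. crosses X (\<eta> e)}"
    proof -
      have "crosses X0 (\<eta>' e) \<longleftrightarrow> crosses X (\<eta> e)" if "e \<in> E - set ?xs" for e
        using rest[OF that] rest'[of e] that by (auto simp: X_def crosses_def)
      moreover have "E' - set ?xs = E - set ?xs" by (auto simp: E'_def)
      ultimately show ?thesis by auto
    qed
    then have "cut_size \<eta>' E' X0 = card {e \<in> E - set ?xs. crosses X (\<eta> e)} + of_bool (crosses X0 {p, q})"
      unfolding cut_size_def using d fin e
      by (subst card_filter_split[where xs = ?xs]) (auto simp: \<eta>'_def E'_def)
    also have "\<dots> = cut_size \<eta> E X" unfolding cut_size using pq pq2 by (auto simp: X_def)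
    finally show "cut_size \<eta>' E' X0 \<noteq> 1" using nb by (simp add: mbridgeless_def)
  qed
  have K': "K - {e1, e2, e4} \<subseteq> E' \<and> even_degrees (V - {x, y}) \<eta>' (K - {e1, e2, e4}) \<and> odd (card (K - {e1, e2, e4}))"
    if "K \<in> \<C>" for K
  proof -
    have K: "K \<subseteq> E" "even_degrees V \<eta> K" "odd (card K)" using fam that by (auto simp: odd_family_def)
    have "finite K" using K(1) fin finite_subset by blast
    then have "card K = card (K - {e1, e2, e4}) + deg \<eta> K y"
      using dgx(2)[OF K(1)] card_split[of K "[e1, e2, e4]"] d by simp
    moreover have "even (deg \<eta> K x)" "even (deg \<eta> K y)" using K(2) V by (auto simp: even_degrees_def)
    moreover have "e3 \<in> K \<longleftrightarrow> e4 \<in> K" using calculation dgx[OF K(1)] by (auto split: if_splits)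
    moreover have "even_degrees (V - {x, y}) \<eta>' (K - {e1, e2, e4})"
      unfolding even_degrees_def
    proof
      fix v assume v: "v \<in> V - {x, y}"
      then show "even (deg \<eta>' (K - {e1, e2, e4}) v)"
        using dg'[OF K(1), of v] K(2) \<open>e3 \<in> K \<longleftrightarrow> e4 \<in> K\<close> by (auto simp: even_degrees_def)
    qed
    ultimately show ?thesis using K by (auto simp: E'_def)
  qed
  then have fam': "odd_family (V - {x, y}) E' \<eta>' ((\<lambda>K. K - {e1, e2, e4}) ` \<C>)"
    using fam unfolding odd_family_def by (fastforce simp: pairwise_def disjnt_def)
  have less: "card (V - {x, y}) < card V" using fin V by (intro psubset_card_mono) auto
  have main: "quelled V E \<eta> f g \<C>"
    if M: "pmatching (V - {x, y}) E' \<eta>' M" "\<forall>K\<in>\<C>. M \<inter> (K - {e1, e2, e4}) \<noteq> {}" "f \<notin> M" "g \<notin> M"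
      and i: "i \<notin> {f, g}" "if e3 \<in> M then i = e4 else i \<in> {e1, e2}" for M i
  proof -
    have ME: "insert i M \<subseteq> E" "insert i M - {e1, e2, e4} = M" "e4 \<in> insert i M \<longleftrightarrow> e3 \<in> insert i M"
      "e3 \<in> insert i M \<longleftrightarrow> e1 \<notin> insert i M \<and> e2 \<notin> insert i M" "e1 \<notin> insert i M \<or> e2 \<notin> insert i M"
      using M(1) e i(2) d by (auto simp: pmatching_def E'_def split: if_splits)
    have "pmatching V E \<eta> (insert i M)"
      unfolding pmatching_def
    proof (intro conjI ballI ME(1))
      fix v assume "v \<in> V"
      show "deg \<eta> (insert i M) v = 1"
      proof (cases "v \<in> {x, y}")
        case True
        then show ?thesis using dgx[OF ME(1)] ME(3-5) by auto
      next
        case False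
        then show ?thesis using dg'[OF ME(1) False] ME(2,3) M(1) \<open>v \<in> V\<close> by (auto simp: pmatching_def)
      qed
    qed
    moreover have "insert i M \<inter> K \<noteq> {}" if "K \<in> \<C>" for K using M(2) that by fastforce
    moreover have "f \<notin> insert i M" "g \<notin> insert i M" using M(3,4) i(1) by auto
    ultimately show ?thesis unfolding quelled_def by (intro exI[of _ "insert i M"] conjI ballI)
  qed
  show ?thesis
  proof (cases "{f, g} = {e1, e2}")
    case True
    \<comment> \<open>With both digon edges forbidden the lift has to use \<open>e3\<close> and
      \<open>e4\<close>. Forbidding the other two edges \<open>r\<close>, \<open>s\<close> at
      \<open>p\<close> forces \<open>e3\<close> into the matching.\<close>
    have pV: "p \<in> V - {x, y}" using V pq pq2 by blast
    have "e3 \<in> E'" "p \<in> \<eta>' e3" using e d by (auto simp: E'_def \<eta>'_def)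
    then obtain r s where rs: "{e \<in> E'. p \<in> \<eta>' e} = {e3, r, s}"
      using other_edges[OF cubic' pV] by blast
    obtain M where M: "pmatching (V - {x, y}) E' \<eta>' M" "\<forall>K\<in>\<C>. M \<inter> (K - {e1, e2, e4}) \<noteq> {}" "r \<notin> M" "s \<notin> M"
      using IH[OF less cubic' nb' fam', of r s] unfolding quelled_def by auto
    have "card {e \<in> M. p \<in> \<eta>' e} = 1" using M(1) V pq pq2 by (auto simp: pmatching_def deg_def)
    then obtain t where "t \<in> M" "p \<in> \<eta>' t" by (metis (mono_tags, lifting) card_1_singletonE insertI1 mem_Collect_eq)
    then have "t \<in> {e \<in> E'. p \<in> \<eta>' e}" using M(1) by (auto simp: pmatching_def)
    then have "t \<in> {e3, r, s}" unfolding rs .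
    then have "e3 \<in> M" using \<open>t \<in> M\<close> M(3,4) by auto
    have fg: "f \<in> {e1, e2}" "g \<in> {e1, e2}" using True by blast+
    then have "f \<notin> M" "g \<notin> M" using M(1) by (auto simp: pmatching_def E'_def)
    moreover have "e4 \<notin> {f, g}" using fg d by auto
    ultimately show ?thesis using main[OF M(1,2), of e4] \<open>e3 \<in> M\<close> by simp
  next
    case False
    \<comment> \<open>The lift uses \<open>e3\<close> and \<open>e4\<close> together or not at all,
      so \<open>e3\<close> is forbidden in place of \<open>e4\<close>.\<close>
    define s where "s z = (if z = e4 then e3 else z)" for z
    obtain M where M: "pmatching (V - {x, y}) E' \<eta>' M" "\<forall>K\<in>\<C>. M \<inter> (K - {e1, e2, e4}) \<noteq> {}" "s f \<notin> M" "s g \<notin> M"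
      using IH[OF less cubic' nb' fam', of "s f" "s g"] unfolding quelled_def by auto
    have fg: "f \<notin> M" "g \<notin> M" using M(1,3,4) by (auto simp: s_def pmatching_def E'_def split: if_splits)
    show ?thesis
    proof (cases "e3 \<in> M")
      case True
      then have "e4 \<notin> {f, g}" using M(3,4) by (auto simp: s_def)
      then show ?thesis using main[OF M(1,2) fg, of e4] True by auto
    next
      assume e3: "e3 \<notin> M"
      obtain i where "i \<in> {e1, e2}" "i \<notin> {f, g}" using False d by auto
      then show ?thesis using main[OF M(1,2) fg, of i] e3 by auto
    qed
  qed
qed

subsection \<open>The reduction step\<close>

text \<open>Each member with an edge at \<open>v\<close> has at least two edges there; two disjoint
  members would need four, but \<open>v\<close> has only three.\<close>

lemma odd_family_touch:
  assumes cubic: "mcubic V E \<eta>" and fam: "odd_family V E \<eta> \<C>"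
    and K: "K \<in> \<C>" "K' \<in> \<C>" "e \<in> K" "e' \<in> K'" "v \<in> \<eta> e" "v \<in> \<eta> e'"
  shows "K = K'"
proof (rule ccontr)
  assume "K \<noteq> K'"
  have KE: "K \<subseteq> E" "K' \<subseteq> E" "even_degrees V \<eta> K" "even_degrees V \<eta> K'" "K \<inter> K' = {}"
    using fam K \<open>K \<noteq> K'\<close> by (auto simp: odd_family_def pairwise_def disjnt_def)
  have fin: "finite E" using mcubicD[OF cubic] by auto
  have v: "v \<in> V" using mcubicD(3)[OF cubic, of e] KE K by auto
  have ge2: "2 \<le> card {x \<in> L. v \<in> \<eta> x}" if "L \<subseteq> E" "even_degrees V \<eta> L" "y \<in> L" "v \<in> \<eta> y" for L y
  proof -
    have "finite L" using that fin finite_subset by blast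
    then have "card {x \<in> L. v \<in> \<eta> x} \<noteq> 0" using that by auto
    moreover have "even (card {x \<in> L. v \<in> \<eta> x})" using that v by (auto simp: even_degrees_def deg_def)
    ultimately show ?thesis by presburger
  qed
  have "card ({x \<in> K. v \<in> \<eta> x} \<union> {x \<in> K'. v \<in> \<eta> x}) = card {x \<in> K. v \<in> \<eta> x} + card {x \<in> K'. v \<in> \<eta> x}"
    using KE fin by (intro card_Un_disjoint) (auto intro: finite_subset)
  moreover have "card ({x \<in> K. v \<in> \<eta> x} \<union> {x \<in> K'. v \<in> \<eta> x}) \<le> card {x \<in> E. v \<in> \<eta> x}"
    using KE fin by (intro card_mono) auto
  ultimately show False
    using ge2[of K e] ge2[of K' e'] KE K mcubicD(5)[OF cubic v] by linarith
qed

text \<open>The case that remains in the induction step after nontrivial cuts of size 3 and parallel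
  edges; the induction hypothesis is carried along as \<open>IH\<close>.\<close>

locale core_graph =
  fixes V :: "'v set" and E :: "'e set" and \<eta> :: "'e \<Rightarrow> 'v set"
  assumes cubic: "mcubic V E \<eta>" and nb: "mbridgeless E \<eta>"
    and c3: "\<And>X. X \<subseteq> V \<Longrightarrow> cut_size \<eta> E X = 3 \<Longrightarrow> card X \<le> 1 \<or> card (V - X) \<le> 1"
    and simple: "\<And>e1 e2. e1 \<in> E \<Longrightarrow> e2 \<in> E \<Longrightarrow> \<eta> e1 = \<eta> e2 \<Longrightarrow> e1 = e2"
    and IH: "\<And>V' E' (\<eta>' :: 'e \<Rightarrow> 'v set) f g \<C>. card V' < card V \<Longrightarrow> mcubic V' E' \<eta>' \<Longrightarrow> mbridgeless E' \<eta>' \<Longrightarrow>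
      odd_family V' E' \<eta>' \<C> \<Longrightarrow> quelled V' E' \<eta>' f g \<C>"
begin

lemma fin: "finite V" "finite E"
  using mcubicD[OF cubic] by auto

lemma edgeD: "e \<in> E \<Longrightarrow> \<eta> e = {x, y} \<Longrightarrow> x \<noteq> y \<and> x \<in> V \<and> y \<in> V"
  using mcubicD(3,4)[OF cubic, of e] by auto

lemma same_edge: "e1 \<in> E \<Longrightarrow> e2 \<in> E \<Longrightarrow> x \<noteq> y \<Longrightarrow> x \<in> \<eta> e1 \<Longrightarrow> y \<in> \<eta> e1 \<Longrightarrow> x \<in> \<eta> e2 \<Longrightarrow> y \<in> \<eta> e2 \<Longrightarrow> e1 = e2"
proof -
  assume a: "e1 \<in> E" "e2 \<in> E" "x \<noteq> y" "x \<in> \<eta> e1" "y \<in> \<eta> e1" "x \<in> \<eta> e2" "y \<in> \<eta> e2"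
  obtain p where "\<eta> e1 = {x, p}" by (rule other_end[OF mcubicD(4)[OF cubic a(1)] a(4)])
  moreover obtain q where "\<eta> e2 = {x, q}" by (rule other_end[OF mcubicD(4)[OF cubic a(2)] a(6)])
  ultimately show ?thesis using a simple[of e1 e2] by auto
qed

text \<open>The degrees in a triangle add up to 9, of which its three edges take 6, so its cut has
  size 3. The vertices \<open>p\<close> and \<open>q\<close> make this cut nontrivial.\<close>

lemma no_triangle:
  assumes e: "e1 \<in> E" "e2 \<in> E" "e3 \<in> E" "\<eta> e1 = {x, y}" "\<eta> e2 = {y, z}" "\<eta> e3 = {x, z}"
    and pq: "p \<in> V - {x, y, z}" "q \<in> V - {x, y, z}" "p \<noteq> q"
  shows False
proof -
  define X where "X = {x, y, z}"
  define T where "T = {e1, e2, e3}"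
  have d: "x \<noteq> y" "y \<noteq> z" "x \<noteq> z" and XV: "x \<in> V" "y \<in> V" "z \<in> V"
    using edgeD[OF e(1,4)] edgeD[OF e(2,5)] edgeD[OF e(3,6)] by auto
  have ed: "e1 \<noteq> e2" "e2 \<noteq> e3" "e1 \<noteq> e3" using e d by (auto simp: doubleton_eq_iff)
  have pt: "card (\<eta> e \<inter> X) = of_bool (crosses X (\<eta> e)) + 2 * of_bool (e \<in> {e1, e2, e3})" if eE: "e \<in> E" for e
  proof (cases "e \<in> {e1, e2, e3}")
    case True
    then have "\<eta> e \<subseteq> X" using e by (auto simp: X_def)
    then show ?thesis using True mcubicD(4)[OF cubic eE] by (simp add: crosses_def Int_absorb2)
  next
    case False
    obtain r s where rs: "\<eta> e = {r, s}" "r \<noteq> s" using mcubicD(4)[OF cubic eE] by (auto simp: card_2_iff)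
    have "\<not> {r, s} \<subseteq> X"
    proof
      assume "{r, s} \<subseteq> X"
      then have "{r, s} = {x, y} \<or> {r, s} = {y, z} \<or> {r, s} = {x, z}" using rs(2) by (auto simp: X_def)
      then show False using simple[OF eE e(1)] simple[OF eE e(2)] simple[OF eE e(3)] e rs(1) False by auto
    qed
    then have "{r, s} \<inter> X = (if r \<in> X then {r} else if s \<in> X then {s} else {})" by auto
    moreover have "crosses X {r, s} \<longleftrightarrow> r \<in> X \<or> s \<in> X" using \<open>\<not> {r, s} \<subseteq> X\<close> by auto
    ultimately have "card ({r, s} \<inter> X) = of_bool (crosses X {r, s})" by (simp only: split: if_split) simp
    then show ?thesis using False rs(1) by simp
  qed
  have "(\<Sum>v\<in>X. deg \<eta> E v) = 9" using d XV cubic by (simp add: mcubic_def X_def)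
  also have "(\<Sum>v\<in>X. deg \<eta> E v) = (\<Sum>e\<in>E. of_bool (crosses X (\<eta> e)) + 2 * of_bool (e \<in> T))"
    unfolding T_def using handshake[of X E \<eta>] fin pt by (simp add: X_def)
  also have "\<dots> = cut_size \<eta> E X + 2 * card (E \<inter> T)"
    using fin by (simp add: sum.distrib cut_size_def Int_def flip: sum_distrib_left)
  also have "E \<inter> T = {e1, e2, e3}" using e by (auto simp: T_def)
  finally have "cut_size \<eta> E X = 3" using ed by simp
  then have "card (V - X) \<le> 1" using c3[of X] XV d by (simp add: X_def)
  moreover have "card {p, q} \<le> card (V - X)" using pq fin by (intro card_mono) (auto simp: X_def)
  ultimately show False using pq(3) by simp
qed

text \<open>The two further neighbours of \<open>w\<close> can be named in either order. Since
  \<open>a \<noteq> b\<close> and \<open>c \<noteq> d\<close> by simplicity, at least one order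
  creates no loop.\<close>

lemma edge_reduction_exists:
  assumes "f \<in> E" "h \<in> E" "f \<noteq> h" "\<eta> f = {u, a}" "\<eta> h = {u, w}"
  obtains b c d eB eC eD where "edge_reduction V E \<eta> u w a b c d f eB h eC eD"
proof -
  have uw: "u \<noteq> w" "u \<in> V" "w \<in> V" using edgeD[OF assms(2,5)] by auto
  obtain eB where incu: "{e \<in> E. u \<in> \<eta> e} = {f, h, eB}" and du: "distinct [f, h, eB]"
    using card3_obtain1[OF mcubicD(5)[OF cubic uw(2)], of f h] assms by auto
  obtain p q where incw: "{e \<in> E. w \<in> \<eta> e} = {h, p, q}" and dw: "distinct [h, p, q]"
    using card3_obtain2[OF mcubicD(5)[OF cubic uw(3)], of h] assms by auto
  have E: "eB \<in> E" "p \<in> E" "q \<in> E" and m: "u \<in> \<eta> eB" "w \<in> \<eta> p" "w \<in> \<eta> q" using incu incw by blast+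
  obtain b where b: "\<eta> eB = {u, b}" by (rule other_end[OF mcubicD(4)[OF cubic E(1)] m(1)])
  obtain c where c: "\<eta> p = {w, c}" by (rule other_end[OF mcubicD(4)[OF cubic E(2)] m(2)])
  obtain d where d: "\<eta> q = {w, d}" by (rule other_end[OF mcubicD(4)[OF cubic E(3)] m(3)])
  have uh: "e = h" if "e \<in> E" "u \<in> \<eta> e" "w \<in> \<eta> e" for e using same_edge[OF that(1) assms(2) uw(1)] that assms(5) by auto
  have dist: "distinct [f, eB, h, p, q]"
    using du dw uh[of f] uh[of eB] assms E m by auto
  have "a \<noteq> b" using simple[OF assms(1) E(1)] assms b du by auto
  have "c \<noteq> d" using simple[OF E(2,3)] c d dw by auto
  have incu': "{e \<in> E. u \<in> \<eta> e} = {f, eB, h}" and incw': "{e \<in> E. w \<in> \<eta> e} = {h, q, p}" using incu incw by auto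
  show thesis
  proof (cases "a \<noteq> c \<and> b \<noteq> d")
    case True
    then show thesis
      by (intro that[of b c d eB p q] edge_reduction.intro cubic incu' incw dist assms(4,5) b c d) auto
  next
    case False
    have dist': "distinct [f, eB, h, q, p]" using dist by auto
    show thesis
      using False \<open>a \<noteq> b\<close> \<open>c \<noteq> d\<close>
      by (intro that[of b d c eB q p] edge_reduction.intro cubic incu' incw' dist' assms(4,5) b c d) auto
  qed
qed

lemma single_step:
  assumes fam: "odd_family V E \<eta> \<C>" and fh: "f \<in> E" "h \<in> E" "f \<noteq> h" "\<eta> f = {u, a}" "\<eta> h = {u, w}" and gh: "g \<noteq> h"
    and touch: "\<And>K e. K \<in> \<C> \<Longrightarrow> h \<notin> K \<Longrightarrow> e \<in> K \<Longrightarrow> u \<notin> \<eta> e \<and> w \<notin> \<eta> e"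
  shows "quelled V E \<eta> f g \<C>"
proof -
  obtain b c d eB eC eD where "edge_reduction V E \<eta> u w a b c d f eB h eC eD"
    using edge_reduction_exists[OF fh] by blast
  then interpret r: edge_reduction V E \<eta> u w a b c d f eB h eC eD .
  show ?thesis
  proof (rule r.quelled_red[OF _ fam gh])
    fix g \<C> assume "odd_family r.V' r.E' r.\<eta>' \<C>"
    then show "quelled r.V' r.E' r.\<eta>' f g \<C>"
      using IH[OF r.card' r.cubic' r.bridgeless_red[OF nb c3]] by blast
  next
    fix K assume K: "K \<in> \<C>"
    have "e \<notin> K" if "h \<notin> K" "e \<in> {f, eB, eC, eD}" for e
    proof
      assume "e \<in> K"
      then have "u \<notin> \<eta> e" "w \<notin> \<eta> e" using touch[OF K that(1)] by auto
      then show False using that(2) r.ends by auto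
    qed
    then show "h \<in> K \<or> K \<inter> {f, eB, eC, eD} = {}" by blast
  qed
qed

text \<open>It suffices to find an edge \<open>h\<close> of \<open>K\<close> at an end of
  \<open>f\<close> with \<open>h \<noteq> f\<close> and \<open>h \<noteq> g\<close>. By
  \<open>odd_family_touch\<close> no other member reaches the ends of \<open>h\<close>, so
  \<open>single_step\<close> applies.\<close>

lemma quelled_on_circuit:
  assumes fam: "odd_family V E \<eta> \<C>" and f: "f \<in> E" and g: "g \<in> E" and K: "K \<in> \<C>" "e \<in> K" "x \<in> \<eta> e" "x \<in> \<eta> f"
  shows "quelled V E \<eta> f g \<C>"
proof -
  have KE: "K \<subseteq> E" "even_degrees V \<eta> K" using fam K by (auto simp: odd_family_def)
  have two: "\<exists>p\<in>K. v \<in> \<eta> p \<and> p \<noteq> r" if "v \<in> \<eta> r" "r \<in> K" for v r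
  proof (rule ccontr)
    assume "\<not> ?thesis"
    then have "{e \<in> K. v \<in> \<eta> e} = {r}" using that by blast
    moreover have "v \<in> V" using mcubicD(3)[OF cubic] KE that by blast
    ultimately show False using KE(2) by (auto simp: even_degrees_def deg_def)
  qed
  obtain p where p: "p \<in> K" "x \<in> \<eta> p" "p \<noteq> e" using two[OF K(3,2)] by blast
  have "\<exists>v h. v \<in> \<eta> f \<and> h \<in> K \<and> v \<in> \<eta> h \<and> h \<noteq> f \<and> h \<noteq> g"
  proof (cases "e \<notin> {f, g} \<or> p \<notin> {f, g}")
    case True
    then show ?thesis using K p by blast
  next
    \<comment> \<open>The two edges of \<open>K\<close> at \<open>x\<close> are \<open>f\<close> and
      \<open>g\<close>. The next edge of \<open>K\<close> after \<open>f\<close>, at its other end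
      \<open>y\<close>, is not \<open>g\<close>, because \<open>g\<close> would be parallel to
      \<open>f\<close>.\<close>
    case False
    then have "f \<in> K" "g \<in> K" "f \<noteq> g" "x \<in> \<eta> g" using K p by auto
    obtain y where y: "\<eta> f = {x, y}" "y \<noteq> x" by (rule other_end[OF mcubicD(4)[OF cubic f] K(4)])
    obtain r where r: "r \<in> K" "y \<in> \<eta> r" "r \<noteq> f" using two[of y f] y \<open>f \<in> K\<close> by auto
    have "r \<noteq> g" using same_edge[OF f g, of x y] y r \<open>x \<in> \<eta> g\<close> \<open>f \<noteq> g\<close> by auto
    then show ?thesis using r y by blast
  qed
  then obtain v h where h: "v \<in> \<eta> f" "h \<in> K" "v \<in> \<eta> h" "h \<noteq> f" "h \<noteq> g" by blast
  obtain a where a: "\<eta> f = {v, a}" by (rule other_end[OF mcubicD(4)[OF cubic f] h(1)])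
  have hE: "h \<in> E" using h KE by blast
  obtain w where w: "\<eta> h = {v, w}" by (rule other_end[OF mcubicD(4)[OF cubic hE] h(3)])
  show ?thesis
  proof (rule single_step[OF fam f hE h(4)[symmetric] a w h(5)[symmetric]])
    fix K' e' assume K': "K' \<in> \<C>" "h \<notin> K'" "e' \<in> K'"
    show "v \<notin> \<eta> e' \<and> w \<notin> \<eta> e'"
      using odd_family_touch[OF cubic fam K(1) K'(1) h(2) K'(3)] w K'(2) h(2) by auto
  qed
qed

text \<open>If every two consecutive steps along \<open>K\<close> from \<open>N\<close> led back into \<open>N\<close>, then by minimality either
  every edge of \<open>K\<close> has exactly one end in \<open>N\<close>, which contradicts parity, or both ends of every edge
  lie in \<open>N\<close>, so that \<open>K\<close> is a triangle.\<close>

lemma two_step_exit: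
  assumes K: "K \<subseteq> E" "even_degrees V \<eta> K" "odd (card K)" and prime: "\<And>L. L \<subseteq> K \<Longrightarrow> even_degrees V \<eta> L \<Longrightarrow> L = {} \<or> L = K"
    and N: "finite N" "card N \<le> 4" "N \<subseteq> V" and ex: "e \<in> K" "\<eta> e \<inter> N \<noteq> {}"
    and out: "p \<in> V" "q \<in> V" "p \<noteq> q" "\<And>e. e \<in> K \<Longrightarrow> p \<notin> \<eta> e \<and> q \<notin> \<eta> e"
  obtains x y z e1 e2 where "e1 \<in> K" "e2 \<in> K" "e1 \<noteq> e2" "\<eta> e1 = {x, y}" "\<eta> e2 = {y, z}" "x \<in> N" "z \<notin> N"
proof (rule ccontr)
  note exit = that
  assume "\<not> thesis"
  then have closed: "z \<in> N" if "e1 \<in> K" "e2 \<in> K" "e1 \<noteq> e2" "\<eta> e1 = {x, y}" "\<eta> e2 = {y, z}" "x \<in> N" for x y z e1 e2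
    using exit[OF that(1-6)] by blast
  have finK: "finite K" using K fin finite_subset by blast
  have deg2: "deg \<eta> K v \<le> 2" if "v \<in> V" for v
  proof -
    have "card {e \<in> K. v \<in> \<eta> e} \<le> card {e \<in> E. v \<in> \<eta> e}" using K(1) fin by (intro card_mono) auto
    moreover have "even (deg \<eta> K v)" using K(2) that by (auto simp: even_degrees_def)
    ultimately show ?thesis using mcubicD(5)[OF cubic that] unfolding deg_def by presburger
  qed
  \<comment> \<open>A subset of \<open>K\<close> that is closed under passing to adjacent edges of
    \<open>K\<close> has at each vertex all or none of the edges of \<open>K\<close> there.\<close>
  have cycI: "even_degrees V \<eta> L" if L: "L \<subseteq> K" "\<And>v e e'. v \<in> V \<Longrightarrow> e \<in> L \<Longrightarrow> e' \<in> K \<Longrightarrow> v \<in> \<eta> e \<Longrightarrow> v \<in> \<eta> e' \<Longrightarrow> e' \<in> L" for L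
    unfolding even_degrees_def
  proof
    fix v assume v: "v \<in> V"
    show "even (deg \<eta> L v)"
    proof (cases "\<exists>e\<in>L. v \<in> \<eta> e")
      case True
      then have "{e \<in> L. v \<in> \<eta> e} = {e \<in> K. v \<in> \<eta> e}" using L v by blast
      then show ?thesis using K(2) v by (simp add: even_degrees_def deg_def)
    next
      case False
      then have "{e \<in> L. v \<in> \<eta> e} = {}" by blast
      then show ?thesis unfolding deg_def by (metis card.empty even_zero)
    qed
  qed
  \<comment> \<open>Since two steps from \<open>N\<close> lead back into \<open>N\<close>, the edges
    with some end in \<open>N\<close> and those with both ends in \<open>N\<close> are closed in
    this sense; each of the two sets is therefore empty or \<open>K\<close>.\<close>
  define L1 where "L1 = {e \<in> K. \<eta> e \<inter> N \<noteq> {}}"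
  define L2 where "L2 = {e \<in> K. \<eta> e \<subseteq> N}"
  have pair: "\<exists>y. \<eta> e = {v, y}" if "e \<in> K" "v \<in> \<eta> e" for e v
    using other_end[OF mcubicD(4)[OF cubic] that(2)] K(1) that(1) by (metis subsetD)
  have "even_degrees V \<eta> L1"
  proof (rule cycI)
    fix v e e' assume a: "v \<in> V" "e \<in> L1" "e' \<in> K" "v \<in> \<eta> e" "v \<in> \<eta> e'"
    then have eK: "e \<in> K" by (simp add: L1_def)
    obtain x z where xz: "\<eta> e = {v, x}" "\<eta> e' = {v, z}" using pair a eK by metis
    have "v \<in> N \<or> x \<in> N" using a(2) xz by (auto simp: L1_def)
    then show "e' \<in> L1"
      using closed[OF eK a(3), of x v z] a xz by (cases "e = e'") (auto simp: L1_def insert_commute)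
  qed (auto simp: L1_def)
  moreover have "e \<in> L1" using ex by (simp add: L1_def)
  ultimately have L1K: "L1 = K" using prime[of L1] by (auto simp: L1_def)
  have "even_degrees V \<eta> L2"
  proof (rule cycI)
    fix v e e' assume a: "v \<in> V" "e \<in> L2" "e' \<in> K" "v \<in> \<eta> e" "v \<in> \<eta> e'"
    then have eK: "e \<in> K" by (simp add: L2_def)
    obtain x z where xz: "\<eta> e = {v, x}" "\<eta> e' = {v, z}" using pair a eK by metis
    have "v \<in> N \<and> x \<in> N" using a(2) xz by (auto simp: L2_def)
    then show "e' \<in> L2"
      using closed[OF eK a(3), of x v z] a xz by (cases "e = e'") (auto simp: L2_def insert_commute)
  qed (auto simp: L2_def)
  then consider "L2 = {}" | "L2 = K" using prime[of L2] by (auto simp: L2_def)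
  then show False
  proof cases
    case 1
    have "card (\<eta> e \<inter> N) = 1" if eK: "e \<in> K" for e
    proof -
      have "e \<in> L1" "e \<notin> L2" using eK L1K 1 by auto
      then have ne: "\<eta> e \<inter> N \<noteq> {}" "\<not> \<eta> e \<subseteq> N" using eK by (auto simp: L1_def L2_def)
      obtain x y where xy: "\<eta> e = {x, y}" "x \<noteq> y"
        using mcubicD(4)[OF cubic, of e] K(1) eK by (meson card_2_iff subsetD)
      show ?thesis using ne unfolding xy(1) by (cases "x \<in> N"; cases "y \<in> N") auto
    qed
    then have "(\<Sum>v\<in>N. deg \<eta> K v) = card K" using handshake[OF N(1) finK, of \<eta>] by simp
    moreover have "even (\<Sum>v\<in>N. deg \<eta> K v)" using K(2) N(3) by (intro dvd_sum) (auto simp: even_degrees_def)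
    ultimately show False using K(3) by simp
  next
    case 2
    \<comment> \<open>All ends lie in \<open>N\<close> and degrees in \<open>K\<close> are at most
      2, so \<open>card K \<le> 4\<close>. As \<open>K\<close> is odd and has three distinct edges
      \<open>e\<close>, \<open>e2\<close>, \<open>e3\<close>, these are all of it and close up to a
      triangle.\<close>
    have "card (\<eta> e \<inter> N) = 2" if "e \<in> K" for e
    proof -
      have "\<eta> e \<subseteq> N" using that 2 by (auto simp: L2_def)
      then show ?thesis using mcubicD(4)[OF cubic, of e] K(1) that by (auto simp: Int_absorb2)
    qed
    then have "2 * card K = (\<Sum>v\<in>N. deg \<eta> K v)" using handshake[OF N(1) finK, of \<eta>] by simp
    also have "\<dots> \<le> (\<Sum>v\<in>N. 2)" using deg2 N(3) by (intro sum_mono) auto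
    finally have "card K \<le> 4" using N(2) by simp
    have "K \<noteq> {}" using ex by auto
    have nxt: "\<exists>r\<in>K. v \<in> \<eta> r \<and> r \<noteq> e" if "e \<in> K" "v \<in> \<eta> e" for v e
    proof (rule ccontr)
      assume "\<not> ?thesis"
      then have "{e \<in> K. v \<in> \<eta> e} = {e}" using that by blast
      moreover have "v \<in> V" using mcubicD(3)[OF cubic] K(1) that by blast
      ultimately show False using K(2) by (auto simp: even_degrees_def deg_def)
    qed
    obtain x y where xy: "\<eta> e = {x, y}" "x \<noteq> y"
      using mcubicD(4)[OF cubic, of e] K(1) ex(1) by (meson card_2_iff subsetD)
    obtain e2 where e2: "e2 \<in> K" "y \<in> \<eta> e2" "e2 \<noteq> e" using nxt[of e y] ex xy by auto
    obtain z where z: "\<eta> e2 = {y, z}" "z \<noteq> y" by (rule other_end[of "\<eta> e2" y]) (use mcubicD(4)[OF cubic] e2 K(1) in auto)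
    have xz: "x \<noteq> z" using simple[of e e2] xy z e2 ex(1) K(1) by (auto simp: insert_commute)
    obtain e3 where e3: "e3 \<in> K" "x \<in> \<eta> e3" "e3 \<noteq> e" using nxt[of e x] ex xy by auto
    have "e3 \<noteq> e2" using e3 z xy xz by auto
    have c3: "card {e, e2, e3} = 3" and sub: "{e, e2, e3} \<subseteq> K"
      using e2 e3 ex(1) \<open>e3 \<noteq> e2\<close> by auto
    have "card K \<noteq> 4" using K(3) by auto
    then have "card K = 3" using \<open>card K \<le> 4\<close> card_mono[OF finK sub] c3 by linarith
    then have K3: "{e, e2, e3} = K" using card_subset_eq[OF finK sub] c3 by simp
    obtain r where r: "r \<in> K" "z \<in> \<eta> r" "r \<noteq> e2" using nxt[of e2 z] e2 z by auto
    then have "r \<in> {e, e2, e3}" using K3 by simp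
    moreover have "z \<notin> \<eta> e" using xy xz z by auto
    ultimately have "r = e3" using r by auto
    obtain t where t: "\<eta> e3 = {x, t}" "t \<noteq> x"
      by (rule other_end[of "\<eta> e3" x]) (use mcubicD(4)[OF cubic, of e3] e3 K(1) in auto)
    then have "\<eta> e3 = {x, z}" using r(2) xz \<open>r = e3\<close> by auto
    moreover have "p \<in> V - {x, y, z}" "q \<in> V - {x, y, z}" using out(1,2) out(4)[OF ex(1)] out(4)[OF e2(1)] xy z by auto
    ultimately show False
      using no_triangle[OF _ _ _ xy(1) z(1)] subsetD[OF K(1)] ex(1) e2(1) e3(1) out(3) by metis
  qed
qed

end

text \<open>The Boolean variables tell which ends of the three new edges of the double reduction lie
  in the vertex set. A new edge with a single end there contributes 1 to both sides, so only pairs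
  lying entirely inside are left, each counted twice. The second version treats pairs lying
  outside.\<close>

lemma three_pairs:
  fixes n :: nat
  assumes "1 + of_bool A + of_bool T + of_bool S + of_bool C + of_bool B + of_bool D
      = n + of_bool (A \<longleftrightarrow> \<not> S) + of_bool (T \<longleftrightarrow> \<not> C) + of_bool (B \<longleftrightarrow> \<not> D)"
  shows "n = 1 + 2 * (of_bool (A \<and> S) + of_bool (T \<and> C) + of_bool (B \<and> D))"
  using assms by (cases A; cases S; cases T; cases C; cases B; cases D) simp_all

lemma three_pairs':
  fixes n :: nat
  assumes "1 + of_bool (\<not> A) + of_bool (\<not> T) + of_bool (\<not> S) + of_bool (\<not> C) + of_bool (\<not> B) + of_bool (\<not> D)
      = n + of_bool (A \<longleftrightarrow> \<not> S) + of_bool (T \<longleftrightarrow> \<not> C) + of_bool (B \<longleftrightarrow> \<not> D)"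
  shows "n = 1 + 2 * (of_bool (\<not> A \<and> \<not> S) + of_bool (\<not> T \<and> \<not> C) + of_bool (\<not> B \<and> \<not> D))"
  using assms by (cases A; cases S; cases T; cases C; cases B; cases D) simp_all

context core_graph
begin

text \<open>Only the composition of the two reductions is bridgeless, not necessarily the graph in between.
  Every lift of a matching meets the circuit \<open>K\<close> through \<open>w\<close>, \<open>c1\<close>, \<open>c2\<close>.\<close>

lemma double_step:
  assumes fam: "odd_family V E \<eta> \<C>" and K: "K \<in> \<C>" "e1 \<in> K" "e2 \<in> K" "e1 \<noteq> e2" "\<eta> e1 = {w, c1}" "\<eta> e2 = {c1, c2}"
    and fh: "f \<in> E" "h \<in> E" "\<eta> f = {u, a}" "\<eta> h = {u, w}"
    and free: "\<And>L e. L \<in> \<C> \<Longrightarrow> e \<in> L \<Longrightarrow> u \<notin> \<eta> e \<and> a \<notin> \<eta> e"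
    and gfree: "\<And>L e. L \<in> \<C> \<Longrightarrow> e \<in> L \<Longrightarrow> \<eta> g \<inter> \<eta> e = {}"
    and c2: "\<And>e. e \<in> E \<Longrightarrow> c2 \<in> \<eta> e \<Longrightarrow> u \<notin> \<eta> e \<and> a \<notin> \<eta> e"
  shows "quelled V E \<eta> f g \<C>"
proof -
  have KE: "K \<subseteq> E" "even_degrees V \<eta> K" using fam K by (auto simp: odd_family_def)
  have eE: "e1 \<in> E" "e2 \<in> E" using K KE by auto
  have V: "w \<in> V" "c1 \<in> V" "c2 \<in> V" "u \<in> V" "a \<in> V" "w \<noteq> c1" "c1 \<noteq> c2" "u \<noteq> a" "u \<noteq> w"
    using edgeD[OF eE(1) K(5)] edgeD[OF eE(2) K(6)] edgeD[OF fh(1,3)] edgeD[OF fh(2,4)] by auto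
  have free1: "u \<noteq> w" "a \<noteq> w" "u \<noteq> c1" "a \<noteq> c1" "u \<noteq> c2" "a \<noteq> c2"
    using free[OF K(1,2)] free[OF K(1,3)] K(5,6) by auto
  have wc2: "w \<noteq> c2" using simple[OF eE] K by (auto simp: insert_commute)
  have fne: "f \<noteq> h" using fh free1 by (auto simp: doubleton_eq_iff)
  have nxt: "\<exists>r\<in>K. v \<in> \<eta> r \<and> r \<noteq> e" if "e \<in> K" "v \<in> \<eta> e" for v e
  proof (rule ccontr)
    assume "\<not> ?thesis"
    then have "{e \<in> K. v \<in> \<eta> e} = {e}" using that by blast
    moreover have "v \<in> V" using mcubicD(3)[OF cubic] KE(1) that by blast
    ultimately show False using KE(2) by (auto simp: even_degrees_def deg_def)
  qed
  have pair: "\<exists>y. \<eta> e = {v, y}" if "e \<in> E" "v \<in> \<eta> e" for e v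
    using other_end[OF mcubicD(4)[OF cubic that(1)] that(2)] by metis

  \<comment> \<open>Names along the path \<open>u\<close>, \<open>w\<close>, \<open>c1\<close>,
    \<open>c2\<close>: the edges at \<open>u\<close> are \<open>f\<close>, \<open>h\<close>,
    \<open>eB\<close>; at \<open>w\<close> they are \<open>h\<close>, \<open>e1\<close>,
    \<open>eD\<close>; at \<open>c1\<close> they are \<open>e1\<close>, \<open>e2\<close>,
    \<open>eS\<close>; at \<open>c2\<close> they are \<open>e2\<close>, \<open>eT\<close>,
    \<open>eR\<close>. The edges \<open>eD\<close>, \<open>e1\<close>, \<open>e2\<close>,
    \<open>eT\<close> belong to \<open>K\<close>.\<close>
  have mem: "u \<in> \<eta> f" "u \<in> \<eta> h" "w \<in> \<eta> h" "w \<in> \<eta> e1" "c1 \<in> \<eta> e1" "c1 \<in> \<eta> e2" "c2 \<in> \<eta> e2"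
    using fh(3,4) K(5,6) by auto
  obtain eB where incu: "{e \<in> E. u \<in> \<eta> e} = {f, h, eB}" and du: "distinct [f, h, eB]"
    using third_edge[OF cubic V(4) fh(1,2) mem(1,2) fne] by blast
  obtain eD where eD: "eD \<in> K" "w \<in> \<eta> eD" "eD \<noteq> e1" using nxt[of e1 w] K by auto
  have hK: "h \<notin> K" using free[OF K(1), of h] fh by auto
  have incw: "{e \<in> E. w \<in> \<eta> e} = {h, e1, eD}"
  proof -
    have "h \<noteq> e1" using hK K(2) by auto
    then obtain z where z: "{e \<in> E. w \<in> \<eta> e} = {h, e1, z}"
      using third_edge[OF cubic V(1) fh(2) eE(1) mem(3,4)] by blast
    have "eD \<in> {e \<in> E. w \<in> \<eta> e}" "eD \<noteq> h" using eD KE hK by auto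
    then have "eD = z" using eD(3) unfolding z by simp
    then show ?thesis using z by simp
  qed
  obtain eS where incc1: "{e \<in> E. c1 \<in> \<eta> e} = {e1, e2, eS}" and dc1: "distinct [e1, e2, eS]"
    using third_edge[OF cubic V(2) eE mem(5,6) K(4)] by blast
  obtain eT where eT: "eT \<in> K" "c2 \<in> \<eta> eT" "eT \<noteq> e2" using nxt[of e2 c2] K by auto
  obtain eR where incc2: "{e \<in> E. c2 \<in> \<eta> e} = {e2, eT, eR}" and dc2: "distinct [e2, eT, eR]"
    using third_edge[OF cubic V(3) eE(2) subsetD[OF KE(1) eT(1)] mem(7) eT(2) eT(3)[symmetric]] by blast
  have E: "eB \<in> E" "eD \<in> E" "eS \<in> E" "eT \<in> E" "eR \<in> E" and m: "u \<in> \<eta> eB" "c1 \<in> \<eta> eS" "c2 \<in> \<eta> eR"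
    using incu incc1 incc2 eD eT KE by blast+
  obtain b where b: "\<eta> eB = {u, b}" using pair[OF E(1) m(1)] by blast
  obtain d where d: "\<eta> eD = {w, d}" using pair[OF E(2) eD(2)] by blast
  obtain s1 where s1: "\<eta> eS = {c1, s1}" using pair[OF E(3) m(2)] by blast
  obtain c3 where c3': "\<eta> eT = {c2, c3}" using pair[OF E(4) eT(2)] by blast
  obtain s2 where s2: "\<eta> eR = {c2, s2}" using pair[OF E(5) m(3)] by blast
  have d': "d \<notin> {u, a, w, c1}" "c3 \<notin> {u, a, c1, c2}"
    using free[OF K(1) eD(1)] free[OF K(1) eT(1)] d c3' edgeD[OF E(2) d] edgeD[OF E(4) c3']
      simple[OF E(2) eE(1)] simple[OF E(4) eE(2)] eD(3) eT(3) K(5,6) by (auto simp: insert_commute)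
  \<comment> \<open>The next four coincidences would each create a triangle with two vertices
    outside. The equations \<open>b = c2\<close> and \<open>s2 = a\<close> are excluded by the
    hypothesis on \<open>c2\<close>.\<close>
  have "b \<noteq> c1"
  proof
    assume "b = c1"
    then show False using no_triangle[of h e1 eB u w c1 a d] fh eE E K(5) b d' V free1 edgeD[OF E(2) d] by auto
  qed
  have "b \<noteq> d"
  proof
    assume "b = d"
    then show False using no_triangle[of h eD eB u w d a c1] fh eE E d b d' V free1 by auto
  qed
  have "c2 \<noteq> d"
  proof
    assume "c2 = d"
    then show False using no_triangle[of e1 e2 eD w c1 c2 u a] fh eE E d K V free1 by auto
  qed
  have "s1 \<noteq> c3"
  proof
    assume "s1 = c3"
    then show False
      using no_triangle[of e2 eT eS c1 c2 c3 u a] eE E K(6) c3' s1 V free1 d' edgeD[OF E(4) c3'] by auto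
  qed
  have "b \<noteq> c2" "s2 \<noteq> a" using c2[OF E(1)] c2[OF E(5)] b s2 by auto
  have dist1: "distinct [f, eB, h, e1, eD]"
    using du eD(3) hK K eD(1) free[OF K(1), of f] free[OF K(1), of eB] fh b by auto
  have eSne: "eS \<noteq> h" "eS \<noteq> eD" "eS \<noteq> eB" "eS \<noteq> f"
    using s1 fh b d free1 V \<open>b \<noteq> c1\<close> d' by (auto simp: doubleton_eq_iff)
  \<comment> \<open>The first reduction, at \<open>h\<close>, turns \<open>f\<close> into
    \<open>ac1\<close> and \<open>eB\<close> into \<open>bd\<close>. The second, at
    \<open>e2\<close>, again takes \<open>f\<close> as the forbidden edge; it turns \<open>f\<close>
    into \<open>as2\<close> and \<open>eS\<close> into \<open>s1c3\<close>.\<close>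
  interpret r1: edge_reduction V E \<eta> u w a b c1 d f eB h e1 eD
  proof unfold_locales
    show "{e \<in> E. u \<in> \<eta> e} = {f, eB, h}" using incu by auto
  qed (use cubic incw dist1 fh b K(5) d free1 \<open>b \<noteq> d\<close> in auto)
  have e2ne: "e2 \<notin> {f, eB, h, e1, eD}" using K(4,6) fh b d free1 V wc2 by (auto simp: doubleton_eq_iff)
  have c2ends: "c2 \<notin> \<eta> e" if "e \<in> {f, eB, h, e1, eD}" for e
    using that fh b K(5) d free1 V wc2 \<open>b \<noteq> c2\<close> \<open>c2 \<noteq> d\<close> by auto
  have eTne: "eT \<notin> {f, eB, h, e1, eD}" "eR \<notin> {f, eB, h, e1, eD}"
    using c2ends eT(2) m(3) by blast+
  have eSne2: "eS \<noteq> eT" "eS \<noteq> eR"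
    using same_edge[OF E(3) eE(2), of c1 c2] m(2) eT(2) m(3) K(6) dc1 V by auto
  have dist2: "distinct [f, eS, e2, eR, eT]"
    using eSne eSne2 dc1 dc2 e2ne eTne by auto
  interpret r2: edge_reduction r1.V' r1.E' r1.\<eta>' c1 c2 a s1 s2 c3 f eS e2 eR eT
  proof unfold_locales
    show "mcubic r1.V' r1.E' r1.\<eta>'" by (rule r1.cubic')
    have "c1 \<in> r1.\<eta>' e \<longleftrightarrow> e \<in> {f, eS, e2}" if "e \<in> r1.E'" for e
    proof -
      have "e \<in> E" "e \<noteq> e1" using that by (auto simp: r1.E'_def)
      then have "c1 \<in> \<eta> e \<longleftrightarrow> e \<in> {eS, e2}" using incc1 by blast
      then show ?thesis using dist1 eSne e2ne \<open>b \<noteq> c1\<close> d' by (auto simp: r1.\<eta>'_def)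
    qed
    moreover have "{f, eS, e2} \<subseteq> r1.E'" using fh E eE dist1 eSne e2ne dc1 by (auto simp: r1.E'_def)
    ultimately show "{e \<in> r1.E'. c1 \<in> r1.\<eta>' e} = {f, eS, e2}" by blast
    have "c2 \<in> r1.\<eta>' e \<longleftrightarrow> e \<in> {e2, eR, eT}" if "e \<in> r1.E'" for e
    proof -
      have "e \<in> E" using that by (auto simp: r1.E'_def)
      then have "c2 \<in> \<eta> e \<longleftrightarrow> e \<in> {e2, eR, eT}" using incc2 by blast
      then show ?thesis using eTne e2ne free1 V \<open>b \<noteq> c2\<close> \<open>c2 \<noteq> d\<close> by (auto simp: r1.\<eta>'_def)
    qed
    moreover have "{e2, eR, eT} \<subseteq> r1.E'" using E eE e2ne eTne by (auto simp: r1.E'_def)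
    ultimately show "{e \<in> r1.E'. c2 \<in> r1.\<eta>' e} = {e2, eR, eT}" by blast
    show "distinct [f, eS, e2, eR, eT]" by (rule dist2)
    show "r1.\<eta>' f = {c1, a}" using dist1 by (auto simp: r1.\<eta>'_def)
    show "r1.\<eta>' eS = {c1, s1}" "r1.\<eta>' e2 = {c1, c2}" "r1.\<eta>' eR = {c2, s2}" "r1.\<eta>' eT = {c2, c3}"
      using eSne e2ne eTne s1 K(6) s2 c3' by (auto simp: r1.\<eta>'_def)
    show "a \<noteq> s2" "s1 \<noteq> c3" using \<open>s2 \<noteq> a\<close> \<open>s1 \<noteq> c3\<close> by auto
  qed
  have V2: "r2.V' = V - {u, w, c1, c2}" by (subst r2.V'_def) (auto simp: r1.V'_def)
  have E2: "r2.E' = E - {h, e1, eD, e2, eR, eT}" by (subst r2.E'_def) (auto simp: r1.E'_def)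
  have H2: "r2.\<eta>' = \<eta>(f := {a, c1}, eB := {b, d}, f := {a, s2}, eS := {s1, c3})"
    by (subst r2.\<eta>'_def) (simp add: r1.\<eta>'_def)
  \<comment> \<open>A cut of size 1 gives two cuts of \<open>E\<close>, with the four deleted
    vertices all outside or all inside. Their sizes are 1 plus twice the number of pairs
    \<open>{a, s2}\<close>, \<open>{s1, c3}\<close>, \<open>{b, d}\<close> inside \<open>X\<close>,
    or outside \<open>X\<close>. Size 1 is excluded, and size 3 because both sides have two
    vertices. So at least two pairs are inside and at least two outside, but there are only
    three.\<close>
  have nb2: "mbridgeless r2.E' r2.\<eta>'"
    unfolding mbridgeless_def
  proof (intro allI notI)
    fix X0 assume X0: "cut_size r2.\<eta>' r2.E' X0 = 1"
    define X where "X = X0 \<inter> r2.V'"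
    let ?all = "X \<union> {u, w, c1, c2}"
    have XV: "X \<subseteq> V" "?all \<subseteq> V" using V by (auto simp: X_def V2)
    have uX: "u \<notin> X" "w \<notin> X" "c1 \<notin> X" "c2 \<notin> X" by (auto simp: X_def V2)
    have loc: "cut_size r2.\<eta>' r2.E' (X \<union> S) = 1" if "S \<subseteq> {u, w, c1, c2}" for S
    proof -
      have "(X \<union> S) \<inter> r2.V' = X0 \<inter> r2.V'" using that by (auto simp: X_def V2)
      then show ?thesis using X0 r2.ct_local by metis
    qed
    have two: "2 \<le> card S" if "p \<in> S" "q \<in> S" "p \<noteq> q" "S \<subseteq> V" for p q S
    proof -
      have "card {p, q} \<le> card S" using that fin by (intro card_mono) (auto intro: finite_subset)
      then show ?thesis using that by simp
    qed
    have pairs: "a \<noteq> s2" "s1 \<noteq> c3" "b \<noteq> d" "u \<noteq> w" using \<open>s2 \<noteq> a\<close> \<open>s1 \<noteq> c3\<close> \<open>b \<noteq> d\<close> V by auto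
    have vsV: "a \<in> V" "s2 \<in> V" "s1 \<in> V" "c3 \<in> V" "b \<in> V" "d \<in> V"
      using r1.vsV r2.vsV by (auto simp: r1.V'_def)
    have out: "a \<notin> {u, w, c1, c2}" "b \<notin> {u, w, c1, c2}" "d \<notin> {u, w, c1, c2}" "s1 \<notin> {u, w, c1, c2}"
      "s2 \<notin> {u, w, c1, c2}" "c3 \<notin> {u, w, c1, c2}"
      using r1.vs r2.vs r2.vsV \<open>b \<noteq> c1\<close> \<open>b \<noteq> c2\<close> \<open>c2 \<noteq> d\<close> d' by (auto simp: r1.V'_def)
    have "2 \<le> card (V - X)" using two[of u "V - X" w] V uX by auto
    moreover have "2 \<le> card X" if "a \<in> X \<and> s2 \<in> X \<or> s1 \<in> X \<and> c3 \<in> X \<or> b \<in> X \<and> d \<in> X"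
      using two[of a X s2] two[of s1 X c3] two[of b X d] pairs XV that by auto
    ultimately have X3: "cut_size \<eta> E X \<noteq> 3" if "a \<in> X \<and> s2 \<in> X \<or> s1 \<in> X \<and> c3 \<in> X \<or> b \<in> X \<and> d \<in> X"
      using c3[OF XV(1)] that by linarith
    have "2 \<le> card ?all" using two[of u ?all w] V XV by auto
    moreover have "2 \<le> card (V - ?all)" if "a \<notin> X \<and> s2 \<notin> X \<or> s1 \<notin> X \<and> c3 \<notin> X \<or> b \<notin> X \<and> d \<notin> X"
      using two[of a "V - ?all" s2] two[of s1 "V - ?all" c3] two[of b "V - ?all" d] pairs vsV out that by auto
    ultimately have all3: "cut_size \<eta> E ?all \<noteq> 3" if "a \<notin> X \<and> s2 \<notin> X \<or> s1 \<notin> X \<and> c3 \<notin> X \<or> b \<notin> X \<and> d \<notin> X"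
      using c3[OF XV(2)] that by linarith
    have n1: "cut_size \<eta> E Z \<noteq> 1" for Z using nb by (auto simp: mbridgeless_def)
    have red: "1 + of_bool (crosses Z {c1, a}) + of_bool (crosses Z {c1, s1}) + of_bool (crosses Z {c1, c2}) + of_bool (crosses Z {c2, s2})
       + of_bool (crosses Z {c2, c3}) + of_bool (crosses Z {u, a}) + of_bool (crosses Z {u, b}) + of_bool (crosses Z {u, w})
       + of_bool (crosses Z {w, c1}) + of_bool (crosses Z {w, d}) = cut_size \<eta> E Z + of_bool (crosses Z {a, s2}) + of_bool (crosses Z {s1, c3})
       + of_bool (crosses Z {a, c1}) + of_bool (crosses Z {b, d})" if "Z = X \<union> S" "S \<subseteq> {u, w, c1, c2}" for Z S
      using r1.ct_red[of Z] r2.ct_red[of Z] loc[OF that(2)] that(1) by simp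
    let ?in = "of_bool (a \<in> X \<and> s2 \<in> X) + of_bool (s1 \<in> X \<and> c3 \<in> X) + of_bool (b \<in> X \<and> d \<in> X) :: nat"
    let ?out = "of_bool (a \<notin> X \<and> s2 \<notin> X) + of_bool (s1 \<notin> X \<and> c3 \<notin> X) + of_bool (b \<notin> X \<and> d \<notin> X) :: nat"
    have ctX: "cut_size \<eta> E X = 1 + 2 * ?in"
      using red[of X "{}"] uX by - (rule three_pairs, simp)
    have ctall: "cut_size \<eta> E ?all = 1 + 2 * ?out"
      using red[of ?all "{u, w, c1, c2}"] out by - (rule three_pairs', simp)
    have "2 \<le> ?in" "2 \<le> ?out" using n1[of X] X3 n1[of ?all] all3 unfolding ctX ctall by (auto split: if_splits)
    then show False
      by (cases "a \<in> X"; cases "s1 \<in> X"; cases "b \<in> X"; cases "s2 \<in> X"; cases "c3 \<in> X"; cases "d \<in> X") simp_all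
  qed
  have touch: "e \<notin> L" if "L \<in> \<C> - {K}" "u \<in> \<eta> e \<or> w \<in> \<eta> e \<or> c1 \<in> \<eta> e \<or> c2 \<in> \<eta> e" for L e
  proof
    assume e: "e \<in> L"
    have L: "L \<in> \<C>" "L \<noteq> K" using that by auto
    have "w \<notin> \<eta> e" "c1 \<notin> \<eta> e" using odd_family_touch[OF cubic fam K(1) L(1) K(2) e] L(2) K(5) by auto
    moreover have "c2 \<notin> \<eta> e" using odd_family_touch[OF cubic fam K(1) L(1) K(3) e] L(2) K(6) by auto
    ultimately show False using free[OF L(1) e] that(2) by auto
  qed
  have "odd_family r2.V' r2.E' r2.\<eta>' (\<C> - {K})"
    unfolding odd_family_def
  proof (intro conjI ballI)
    fix L assume L: "L \<in> \<C> - {K}"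
    then have LE: "L \<subseteq> E" "even_degrees V \<eta> L" "odd (card L)" using fam by (auto simp: odd_family_def)
    have no: "f \<notin> L" "eB \<notin> L" "h \<notin> L" "e1 \<notin> L" "eD \<notin> L" "eS \<notin> L" "e2 \<notin> L" "eR \<notin> L" "eT \<notin> L"
      using touch[OF L] fh b K(5) d s1 K(6) s2 c3' by auto
    show "L \<subseteq> r2.E'" using LE(1) no by (auto simp: E2)
    have "{e \<in> L. v \<in> r2.\<eta>' e} = {e \<in> L. v \<in> \<eta> e}" for v
      using no by (auto simp: H2)
    then show "even_degrees r2.V' r2.\<eta>' L" using LE(2) by (auto simp: even_degrees_def deg_def V2)
    show "odd (card L)" by fact
  next
    show "pairwise disjnt (\<C> - {K})" using fam by (auto simp: odd_family_def intro: pairwise_subset)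
  qed
  from IH[OF less_trans[OF r2.card' r1.card'] r2.cubic' nb2 this, of f g] obtain M where
    M: "pmatching r2.V' r2.E' r2.\<eta>' M" "f \<notin> M" "g \<notin> M" "\<And>L. L \<in> \<C> - {K} \<Longrightarrow> M \<inter> L \<noteq> {}"
    unfolding quelled_def by blast
  \<comment> \<open>The reductions are undone in reverse order. The first lift adds
    \<open>eT\<close> or \<open>e2\<close>, both in \<open>K\<close>, which is why \<open>K\<close>
    could be left out of the family.\<close>
  define M' where "M' = insert (if eS \<in> M then eT else e2) M"
  define M'' where "M'' = insert (if eB \<in> M' then eD else h) M'"
  have M': "pmatching r1.V' r1.E' r1.\<eta>' M'" unfolding M'_def by (rule r2.pm_lift[OF M(1,2)])
  \<comment> \<open>As \<open>g\<close> has no end in common with an edge of \<open>K\<close>, it is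
    none of the edges added by the lifts.\<close>
  have gne: "g \<noteq> e" if "\<eta> e \<inter> {w, c1, c2} \<noteq> {}" for e
    using gfree[OF K(1,2)] gfree[OF K(1,3)] K(5,6) that by auto
  have "g \<noteq> eT" "g \<noteq> e2" "g \<noteq> eD" "g \<noteq> h" using gne[of eT] gne[of e2] gne[of eD] gne[of h] c3' K(6) d fh by auto
  moreover have "f \<noteq> eT" "f \<noteq> e2" "f \<noteq> eD" "f \<noteq> h" using dist1 dist2 by auto
  ultimately have fg: "f \<notin> M'" "f \<notin> M''" "g \<notin> M''" using M(2,3) by (auto simp: M'_def M''_def)
  have "pmatching V E \<eta> M''" unfolding M''_def by (rule r1.pm_lift[OF M' fg(1)])
  moreover have "M'' \<inter> L \<noteq> {}" if "L \<in> \<C>" for L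
  proof (cases "L = K")
    case True
    then show ?thesis using K(3) eT(1) by (auto simp: M'_def M''_def)
  next
    case False
    then show ?thesis using M(4)[of L] that by (auto simp: M'_def M''_def)
  qed
  ultimately show ?thesis using fg(2,3) unfolding quelled_def by blast
qed

text \<open>The roles of \<open>f\<close> and \<open>g\<close> are symmetric, so a member touching
  either of them is handled by \<open>quelled_on_circuit\<close>. Otherwise it matters whether a
  member reaches the set \<open>N\<close> of neighbours of the ends of \<open>f\<close>: if not,
  \<open>single_step\<close> applies at an edge from \<open>u\<close> into \<open>N\<close>, and if
  so, \<open>double_step\<close>.\<close>

lemma core_quelled_prime:
  assumes fam: "odd_family V E \<eta> \<C>" and fg: "f \<in> E" "g \<in> E"
    and prime: "\<And>K L. K \<in> \<C> \<Longrightarrow> L \<subseteq> K \<Longrightarrow> even_degrees V \<eta> L \<Longrightarrow> L = {} \<or> L = K"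
  shows "quelled V E \<eta> f g \<C>"
proof -
  consider (f) K e x where "K \<in> \<C>" "e \<in> K" "x \<in> \<eta> e" "x \<in> \<eta> f" | (g) K e x where "K \<in> \<C>" "e \<in> K" "x \<in> \<eta> e" "x \<in> \<eta> g"
    | (no) "\<forall>K\<in>\<C>. \<forall>e\<in>K. \<forall>x. x \<in> \<eta> e \<longrightarrow> x \<notin> \<eta> f \<and> x \<notin> \<eta> g" by metis
  then show ?thesis
  proof cases
    case f
    then show ?thesis using quelled_on_circuit[OF fam fg] by blast
  next
    case g
    then have "quelled V E \<eta> g f \<C>" using quelled_on_circuit[OF fam fg(2,1)] by blast
    then show ?thesis unfolding quelled_def by blast
  next
    case apart: no
    have no: "\<eta> f \<inter> \<eta> e = {} \<and> \<eta> g \<inter> \<eta> e = {}" if "K \<in> \<C>" "e \<in> K" for K e using apart that by blast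
    obtain u a where ua: "\<eta> f = {u, a}" "u \<noteq> a" using mcubicD(4)[OF cubic fg(1)] by (auto simp: card_2_iff)
    have uaV: "u \<in> V" "a \<in> V" using edgeD[OF fg(1) ua(1)] by auto
    define N where "N = {v \<in> V - {u, a}. \<exists>e\<in>E. v \<in> \<eta> e \<and> \<eta> e \<inter> {u, a} \<noteq> {}}"
    have free: "u \<notin> \<eta> e \<and> a \<notin> \<eta> e" if "K \<in> \<C>" "e \<in> K" for K e using no[OF that] ua by auto
    show ?thesis
    proof (cases "\<exists>K\<in>\<C>. \<exists>e\<in>K. \<eta> e \<inter> N \<noteq> {}")
      case False
      obtain p q where pq: "{e \<in> E. u \<in> \<eta> e} = {f, p, q}" "distinct [f, p, q]"
        using other_edges[OF cubic uaV(1) fg(1)] ua by blast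
      obtain h where h: "h \<in> {p, q}" "h \<noteq> g" using pq by auto
      then have "h \<in> {e \<in> E. u \<in> \<eta> e}" "f \<noteq> h" using pq by auto
      then have hE: "h \<in> E" "u \<in> \<eta> h" by auto
      obtain w where w: "\<eta> h = {u, w}" "w \<noteq> u" by (rule other_end[OF mcubicD(4)[OF cubic hE(1)] hE(2)])
      have "w \<noteq> a" using simple[OF fg(1) hE(1)] w ua \<open>f \<noteq> h\<close> by auto
      then have "w \<in> N" using w hE mcubicD(3)[OF cubic hE(1)] by (auto simp: N_def)
      show ?thesis
        using single_step[OF fam fg(1) hE(1) \<open>f \<noteq> h\<close> ua(1) w(1) h(2)[symmetric]] False free \<open>w \<in> N\<close> by blast
    next
      case True
      then obtain K e where K: "K \<in> \<C>" "e \<in> K" "\<eta> e \<inter> N \<noteq> {}" by blast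
      have KE: "K \<subseteq> E" "even_degrees V \<eta> K" "odd (card K)" using fam K by (auto simp: odd_family_def)
      have N4: "card N \<le> 4" "finite N" "N \<subseteq> V"
      proof -
        have nb2: "\<exists>p q. {v \<in> V - {u, a}. \<exists>e\<in>E. v \<in> \<eta> e \<and> x \<in> \<eta> e} \<subseteq> {p, q}" if x: "x \<in> {u, a}" for x
        proof -
          have xV: "x \<in> V" "x \<in> \<eta> f" using uaV ua x by auto
          obtain p q where pq: "{e \<in> E. x \<in> \<eta> e} = {f, p, q}"
            using other_edges[OF cubic xV(1) fg(1) xV(2)] by blast
          then have pqE: "p \<in> E" "q \<in> E" "x \<in> \<eta> p" "x \<in> \<eta> q" by blast+
          obtain y where y: "\<eta> p = {x, y}" by (rule other_end[OF mcubicD(4)[OF cubic pqE(1)] pqE(3)])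
          obtain z where z: "\<eta> q = {x, z}" by (rule other_end[OF mcubicD(4)[OF cubic pqE(2)] pqE(4)])
          have "v \<in> {y, z}" if "v \<in> V - {u, a}" "e \<in> E" "v \<in> \<eta> e" "x \<in> \<eta> e" for v e
          proof -
            have "e \<in> {f, p, q}" using pq that by blast
            then show ?thesis using that x ua y z by auto
          qed
          then show ?thesis by blast
        qed
        obtain p q where 1: "{v \<in> V - {u, a}. \<exists>e\<in>E. v \<in> \<eta> e \<and> u \<in> \<eta> e} \<subseteq> {p, q}" using nb2[of u] by blast
        obtain r s where 2: "{v \<in> V - {u, a}. \<exists>e\<in>E. v \<in> \<eta> e \<and> a \<in> \<eta> e} \<subseteq> {r, s}" using nb2[of a] by blast
        have "N \<subseteq> set [p, q, r, s]" using 1 2 unfolding N_def by auto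
        then have "card N \<le> card (set [p, q, r, s])" by (intro card_mono) auto
        also have "\<dots> \<le> 4" using card_length[of "[p, q, r, s]"] by simp
        finally show "card N \<le> 4" .
        show "finite N" "N \<subseteq> V" using fin by (auto simp: N_def)
      qed
      \<comment> \<open>These become \<open>w\<close>, \<open>c1\<close>, \<open>c2\<close> of
        \<open>double_step\<close>. That \<open>z\<close> is outside \<open>N\<close> provides its
        hypothesis that no edge joins \<open>c2\<close> to an end of \<open>f\<close>.\<close>
      obtain x y z e1 e2 where st: "e1 \<in> K" "e2 \<in> K" "e1 \<noteq> e2" "\<eta> e1 = {x, y}" "\<eta> e2 = {y, z}" "x \<in> N" "z \<notin> N"
        by (rule two_step_exit[OF KE prime[OF K(1)] N4(2,1,3) K(2,3) uaV ua(2) free[OF K(1)]])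
      obtain h where h: "h \<in> E" "x \<in> \<eta> h" "\<eta> h \<inter> {u, a} \<noteq> {}" using st(6) by (auto simp: N_def)
      have xne: "x \<notin> {u, a}" using st(6) by (auto simp: N_def)
      have z: "z \<in> V" "z \<notin> {u, a}" using edgeD[OF _ st(5)] KE(1) st(2) free[OF K(1) st(2)] st(5) by auto
      have zc: "u \<notin> \<eta> e \<and> a \<notin> \<eta> e" if "e \<in> E" "z \<in> \<eta> e" for e
        using st(7) z that by (auto simp: N_def)
      show ?thesis
      proof (cases "u \<in> \<eta> h")
        case True
        obtain t where "\<eta> h = {u, t}" by (rule other_end[OF mcubicD(4)[OF cubic h(1)] True])
        then have "\<eta> h = {u, x}" using h(2) xne by auto
        then show ?thesis
          using double_step[OF fam K(1) st(1-5) fg(1) h(1) ua(1)] free no zc by blast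
      next
        case False
        then have "a \<in> \<eta> h" using h(3) by auto
        obtain t where "\<eta> h = {a, t}" by (rule other_end[OF mcubicD(4)[OF cubic h(1)] \<open>a \<in> \<eta> h\<close>])
        then have "\<eta> h = {a, x}" using h(2) xne by auto
        moreover have "\<eta> f = {a, u}" using ua by auto
        ultimately show ?thesis
        proof (intro double_step[OF fam K(1) st(1-5) fg(1) h(1), of a u])
          show "a \<notin> \<eta> e \<and> u \<notin> \<eta> e" if "L \<in> \<C>" "e \<in> L" for L e using free[OF that] by simp
          show "\<eta> g \<inter> \<eta> e = {}" if "L \<in> \<C>" "e \<in> L" for L e using no[OF that] by simp
          show "a \<notin> \<eta> e \<and> u \<notin> \<eta> e" if "e \<in> E" "z \<in> \<eta> e" for e using zc[OF that] by simp
        qed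
      qed
    qed
  qed
qed

end

subsection \<open>The finite theorem\<close>

lemma min_odd_cyc:
  assumes "finite K" "even_degrees V \<eta> K" "odd (card K)"
  shows "\<exists>L. L \<subseteq> K \<and> even_degrees V \<eta> L \<and> odd (card L) \<and> (\<forall>L'. L' \<subset> L \<longrightarrow> even_degrees V \<eta> L' \<longrightarrow> even (card L'))"
  using assms
proof (induction rule: finite_psubset_induct)
  case (psubset K)
  show ?case
  proof (cases "\<forall>L'. L' \<subset> K \<longrightarrow> even_degrees V \<eta> L' \<longrightarrow> even (card L')")
    case True
    then show ?thesis using psubset.prems by (intro exI[of _ K]) simp
  next
    case False
    then obtain L' where L': "L' \<subset> K" "even_degrees V \<eta> L'" "odd (card L')" by auto
    obtain L where "L \<subseteq> L'" "even_degrees V \<eta> L \<and> odd (card L) \<and> (\<forall>L'. L' \<subset> L \<longrightarrow> even_degrees V \<eta> L' \<longrightarrow> even (card L'))"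
      using psubset.IH[OF L'] by (elim exE conjE) simp
    then show ?thesis using L'(1) by (intro exI[of _ L]) auto
  qed
qed

lemma cyc_diff:
  assumes "finite K" "L \<subseteq> K" "even_degrees V \<eta> K" "even_degrees V \<eta> L"
  shows "even_degrees V \<eta> (K - L)"
  unfolding even_degrees_def
proof
  fix v assume v: "v \<in> V"
  have "{e \<in> K - L. v \<in> \<eta> e} = {e \<in> K. v \<in> \<eta> e} - {e \<in> L. v \<in> \<eta> e}" by blast
  moreover have "card \<dots> = deg \<eta> K v - deg \<eta> L v"
    unfolding deg_def using assms(1,2) by (intro card_Diff_subset) (auto intro: finite_subset)
  ultimately show "even (deg \<eta> (K - L) v)" using assms(3,4) v by (simp add: even_degrees_def deg_def)
qed

text \<open>A nonempty proper subset with even degrees would split \<open>K\<close> into two proper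
  subsets with even degrees, one of them of odd size.\<close>

lemma min_odd_cyc_prime:
  assumes "finite K" "even_degrees V \<eta> K" "odd (card K)" "\<And>L. L \<subset> K \<Longrightarrow> even_degrees V \<eta> L \<Longrightarrow> even (card L)" "L \<subseteq> K" "even_degrees V \<eta> L"
  shows "L = {} \<or> L = K"
proof (rule ccontr)
  assume "\<not> ?thesis"
  then have L: "L \<subset> K" "K - L \<subset> K" using assms(5) by auto
  have "even (card L)" "even (card (K - L))"
    using assms(4)[OF L(1) assms(6)] assms(4)[OF L(2) cyc_diff[OF assms(1,5,2,6)]] by auto
  then show False using assms(1,3,5) card_Diff_subset[of L K] finite_subset[of L K] card_mono[of K L] by auto
qed

text \<open>Each member is shrunk to a minimal odd part \<open>\<mu> K\<close>. A matching that
  meets the parts meets the members, and the parts are again disjoint.\<close>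

lemma (in core_graph) core_quelled:
  assumes fam: "odd_family V E \<eta> \<C>"
  shows "quelled V E \<eta> f g \<C>"
proof -
  have K: "finite K \<and> even_degrees V \<eta> K \<and> odd (card K)" if "K \<in> \<C>" for K
    using fam that fin finite_subset by (auto simp: odd_family_def)
  define \<mu> where "\<mu> K = (SOME L. L \<subseteq> K \<and> even_degrees V \<eta> L \<and> odd (card L) \<and>
      (\<forall>L'. L' \<subset> L \<longrightarrow> even_degrees V \<eta> L' \<longrightarrow> even (card L')))" for K
  have \<mu>: "\<mu> K \<subseteq> K \<and> even_degrees V \<eta> (\<mu> K) \<and> odd (card (\<mu> K)) \<and>
      (\<forall>L'. L' \<subset> \<mu> K \<longrightarrow> even_degrees V \<eta> L' \<longrightarrow> even (card L'))" if "K \<in> \<C>" for K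
    unfolding \<mu>_def by (rule someI_ex, rule min_odd_cyc) (use K[OF that] in auto)
  have fam': "odd_family V E \<eta> (\<mu> ` \<C>)"
    unfolding odd_family_def
  proof
    show "\<forall>K\<in>\<mu> ` \<C>. K \<subseteq> E \<and> even_degrees V \<eta> K \<and> odd (card K)" using \<mu> fam by (fastforce simp: odd_family_def)
    show "pairwise disjnt (\<mu> ` \<C>)"
      unfolding pairwise_def
    proof (intro ballI impI)
      fix A B assume "A \<in> \<mu> ` \<C>" "B \<in> \<mu> ` \<C>" "A \<noteq> B"
      then obtain K L where KL: "A = \<mu> K" "B = \<mu> L" "K \<in> \<C>" "L \<in> \<C>" "K \<noteq> L" by blast
      then have "disjnt K L" using fam by (auto simp: odd_family_def pairwise_def)
      then show "disjnt A B" using \<mu>[OF KL(3)] \<mu>[OF KL(4)] KL(1,2) by (auto simp: disjnt_def)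
    qed
  qed
  have prime: "L = {} \<or> L = A" if A: "A \<in> \<mu> ` \<C>" "L \<subseteq> A" "even_degrees V \<eta> L" for A L
  proof -
    obtain J where J: "A = \<mu> J" "J \<in> \<C>" using A(1) by blast
    have "finite A" using \<mu>[OF J(2)] K[OF J(2)] J(1) finite_subset by blast
    then show ?thesis using min_odd_cyc_prime[of A V \<eta> L] \<mu>[OF J(2)] J(1) A(2,3) by simp
  qed
  show ?thesis
  proof (cases "E = {}")
    case True
    then have "V = {}" using cubic by (auto simp: mcubic_def deg_def)
    moreover have "\<C> = {}" using fam True by (fastforce simp: odd_family_def)
    ultimately show ?thesis by (auto simp: quelled_def pmatching_def)
  next
    case False
    then obtain e0 where e0: "e0 \<in> E" by blast
    \<comment> \<open>A forbidden name outside \<open>E\<close> lies in no matching, so an arbitrary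
      edge \<open>e0\<close> can take its place.\<close>
    have "(if f \<in> E then f else e0) \<in> E" "(if g \<in> E then g else e0) \<in> E" using e0 by auto
    from core_quelled_prime[OF fam' this prime] obtain M where
      M: "pmatching V E \<eta> M" "(if f \<in> E then f else e0) \<notin> M" "(if g \<in> E then g else e0) \<notin> M" "\<forall>K\<in>\<C>. M \<inter> \<mu> K \<noteq> {}"
      unfolding quelled_def by auto
    then have "f \<notin> M" "g \<notin> M" by (auto simp: pmatching_def split: if_splits)
    moreover have "M \<inter> K \<noteq> {}" if "K \<in> \<C>" for K
    proof -
      have "M \<inter> \<mu> K \<noteq> {}" "\<mu> K \<subseteq> K" using M(4) \<mu>[OF that] that by auto
      then show ?thesis by blast
    qed
    ultimately show ?thesis using M(1) unfolding quelled_def by blast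
  qed
qed

theorem odd_family_quelled:
  fixes V :: "'v set" and E :: "'e set" and \<eta> :: "'e \<Rightarrow> 'v set"
  assumes "mcubic V E \<eta>" "mbridgeless E \<eta>" "odd_family V E \<eta> \<C>"
  shows "quelled V E \<eta> f g \<C>"
  using assms
proof (induction "card V" arbitrary: V E \<eta> f g \<C> rule: less_induct)
  case less
  have IH: "quelled V' E' \<eta>' f g \<C>" if "card V' < card V" "mcubic V' E' \<eta>'" "mbridgeless E' \<eta>'" "odd_family V' E' \<eta>' \<C>"
    for V' :: "'v set" and E' :: "'e set" and \<eta>' f g \<C>
    using less.hyps[OF that(1-4)] .
  show ?case
  proof (cases "\<exists>X\<subseteq>V. cut_size \<eta> E X = 3 \<and> 2 \<le> card X \<and> 2 \<le> card (V - X)")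
    case True
    then obtain X where "X \<subseteq> V" "2 \<le> card X" "2 \<le> card (V - X)" "cut_size \<eta> E X = 3" by blast
    then show ?thesis using quelled_3cut[OF IH less.prems] by blast
  next
    case c3: False
    show ?thesis
    proof (cases "\<exists>e1\<in>E. \<exists>e2\<in>E. e1 \<noteq> e2 \<and> \<eta> e1 = \<eta> e2")
      case True
      then obtain e1 e2 where e: "e1 \<in> E" "e2 \<in> E" "e1 \<noteq> e2" "\<eta> e1 = \<eta> e2" by blast
      obtain x y where xy: "\<eta> e1 = {x, y}" "x \<noteq> y" using mcubicD(4)[OF less.prems(1) e(1)] by (meson card_2_iff)
      then have xyV: "x \<in> V" "y \<in> V" using mcubicD(3)[OF less.prems(1) e(1)] by auto
      have xy2: "\<eta> e2 = {x, y}" using xy e by simp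
      obtain e3 where e3: "{e \<in> E. x \<in> \<eta> e} = {e1, e2, e3}" "distinct [e1, e2, e3]"
        using card3_obtain1[OF mcubicD(5)[OF less.prems(1) xyV(1)], of e1 e2] e xy xy2 by auto
      obtain e4 where e4: "{e \<in> E. y \<in> \<eta> e} = {e1, e2, e4}" "distinct [e1, e2, e4]"
        using card3_obtain1[OF mcubicD(5)[OF less.prems(1) xyV(2)], of e1 e2] e xy xy2 by auto
      have m: "e3 \<in> E" "x \<in> \<eta> e3" "e4 \<in> E" "y \<in> \<eta> e4" using e3 e4 by blast+
      obtain p where p: "\<eta> e3 = {x, p}" by (rule other_end[OF mcubicD(4)[OF less.prems(1) m(1)] m(2)])
      obtain q where q: "\<eta> e4 = {y, q}" by (rule other_end[OF mcubicD(4)[OF less.prems(1) m(3)] m(4)])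
      show ?thesis
      \<comment> \<open>If the remaining edges at \<open>x\<close> and \<open>y\<close> coincide,
        there are three parallel edges; otherwise there is a digon with two distinct outgoing
        edges.\<close>
      proof (cases "e3 = e4")
        case True
        then have "\<eta> e3 = {x, y}" using m(4) p xy(2) by auto
        then show ?thesis using quelled_theta[OF IH less.prems e3 xy(1) xy2] by blast
      next
        case False
        then have "distinct [e1, e2, e3, e4]" using e3 e4 by auto
        then show ?thesis using quelled_digon[OF IH less.prems e3(1) e4(1) _ xy(2) xy(1) xy2 p q] by blast
      qed
    next
      case False
      interpret core_graph V E \<eta>
      proof
        show "card X \<le> 1 \<or> card (V - X) \<le> 1" if "X \<subseteq> V" "cut_size \<eta> E X = 3" for X
          using c3 that by (metis (no_types) One_nat_def Suc_1 not_less_eq_eq)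
        show "e1 = e2" if "e1 \<in> E" "e2 \<in> E" "\<eta> e1 = \<eta> e2" for e1 e2 using False that by blast
      qed (use less.prems IH in blast)+
      show ?thesis by (rule core_quelled[OF less.prems(3)])
    qed
  qed
qed

subsection \<open>Two perfect matchings of a finite graph\<close>

definition proper :: "('e \<Rightarrow> 'v set) \<Rightarrow> 'e set \<Rightarrow> ('v \<Rightarrow> bool) \<Rightarrow> bool" where
  "proper \<eta> B \<kappa> \<longleftrightarrow> (\<forall>e\<in>B. \<forall>a b. \<eta> e = {a, b} \<longrightarrow> \<kappa> a \<noteq> \<kappa> b)"

lemma properD: "proper \<eta> B \<kappa> \<Longrightarrow> e \<in> B \<Longrightarrow> \<eta> e = {a, b} \<Longrightarrow> \<kappa> a \<noteq> \<kappa> b"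
  by (simp add: proper_def)

text \<open>\<open>P\<close> is the sum modulo 2 of the edges of the walk. Adding an edge as a
  symmetric difference flips the parity of the size and of the degrees at its two ends, just as the
  colour flips along the edge.\<close>

lemma path_edge_set:
  assumes B: "finite B" and walk: "(x, v) \<in> {(a, b). \<exists>e\<in>B. \<eta> e = {a, b}}\<^sup>*"
    and \<kappa>: "proper \<eta> B \<kappa>" and two: "\<And>e. e \<in> B \<Longrightarrow> card (\<eta> e) = 2"
  shows "\<exists>P\<subseteq>B. (\<forall>w. odd (deg \<eta> P w) \<longleftrightarrow> (w = x) \<noteq> (w = v)) \<and> (even (card P) \<longleftrightarrow> \<kappa> x = \<kappa> v)"
  using walk
proof (induction rule: rtrancl_induct)
  case base
  show ?case by (intro exI[of _ "{}"]) (auto simp: deg_def)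
next
  case (step v w)
  then obtain P where P: "P \<subseteq> B" "\<And>z. odd (deg \<eta> P z) \<longleftrightarrow> (z = x) \<noteq> (z = v)" "even (card P) \<longleftrightarrow> \<kappa> x = \<kappa> v" by blast
  obtain e where e: "e \<in> B" "\<eta> e = {v, w}" using step.hyps by blast
  have finP: "finite P" using P(1) B finite_subset by blast
  have vw: "v \<noteq> w" "\<kappa> v \<noteq> \<kappa> w" using two[OF e(1)] e properD[OF \<kappa> e] by auto
  define Q where "Q = (if e \<in> P then P - {e} else insert e P)"
  have split: "card {y \<in> Q. R y} + 2 * of_bool (e \<in> P \<and> R e) = card {y \<in> P. R y} + of_bool (R e)" for R
  proof (cases "e \<in> P \<and> R e")
    case True
    have "{y \<in> P. R y} = insert e {y \<in> Q. R y}" "e \<notin> {y \<in> Q. R y}" using True by (auto simp: Q_def)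
    then show ?thesis using finP True by (simp add: Q_def)
  next
    case False
    then consider "\<not> R e" | "R e" "e \<notin> P" by blast
    then show ?thesis
    proof cases
      case 1
      then have "{y \<in> Q. R y} = {y \<in> P. R y}" by (auto simp: Q_def)
      then show ?thesis using 1 by simp
    next
      case 2
      then have "{y \<in> Q. R y} = insert e {y \<in> P. R y}" "e \<notin> {y \<in> P. R y}" by (auto simp: Q_def)
      then show ?thesis using finP 2 by simp
    qed
  qed
  have "odd (card {y \<in> Q. R y}) \<longleftrightarrow> odd (card {y \<in> P. R y}) \<noteq> R e" for R
    using arg_cong[OF split[of R], of even] by auto
  from this[of "\<lambda>_. True"] this have par: "even (card Q) \<longleftrightarrow> odd (card P)" "\<And>z. odd (deg \<eta> Q z) \<longleftrightarrow> odd (deg \<eta> P z) \<noteq> (z \<in> \<eta> e)"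
    by (auto simp: deg_def)
  have "Q \<subseteq> B" using P(1) e(1) by (auto simp: Q_def)
  moreover have "odd (deg \<eta> Q z) \<longleftrightarrow> (z = x) \<noteq> (z = w)" for z
    using par(2)[of z] P(2)[of z] e(2) vw by auto
  moreover have "even (card Q) \<longleftrightarrow> \<kappa> x = \<kappa> w" using par(1) P(3) vw(2) by auto
  ultimately show ?case by blast
qed

text \<open>Edges are added one at a time. If the ends of the new edge are already connected, the
  set \<open>P\<close> from \<open>path_edge_set\<close> together with this edge has even degrees,
  hence even size, so the ends already have different colours.\<close>

lemma two_colouring:
  assumes "finite B" "\<And>e. e \<in> B \<Longrightarrow> card (\<eta> e) = 2" "\<And>L. L \<subseteq> B \<Longrightarrow> even_degrees UNIV \<eta> L \<Longrightarrow> even (card L)"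
  shows "\<exists>\<kappa>. proper \<eta> B \<kappa>"
  using assms
proof (induction rule: finite_induct)
  case empty
  then show ?case by (simp add: proper_def)
next
  case (insert e B)
  have "\<exists>\<kappa>. proper \<eta> B \<kappa>" using insert.prems by (intro insert.IH) auto
  then obtain \<kappa> where \<kappa>: "proper \<eta> B \<kappa>" by blast
  obtain x y where xy: "\<eta> e = {x, y}" "x \<noteq> y" using insert.prems(1)[of e] by (meson card_2_iff insertI1)
  let ?R = "{(a, b). \<exists>e\<in>B. \<eta> e = {a, b}}"
  show ?case
  proof (cases "(x, y) \<in> ?R\<^sup>*")
    case True
    have "\<exists>P\<subseteq>B. (\<forall>w. odd (deg \<eta> P w) \<longleftrightarrow> (w = x) \<noteq> (w = y)) \<and> (even (card P) \<longleftrightarrow> \<kappa> x = \<kappa> y)"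
      using insert.prems(1) by (intro path_edge_set[OF insert.hyps(1) True] \<kappa>) auto
    then obtain P where P: "P \<subseteq> B" "\<And>w. odd (deg \<eta> P w) \<longleftrightarrow> (w = x) \<noteq> (w = y)" "even (card P) \<longleftrightarrow> \<kappa> x = \<kappa> y"
      by (elim exE conjE) simp
    have finP: "finite P" "e \<notin> P" using P(1) insert.hyps finite_subset by auto
    have "even (deg \<eta> (insert e P) w)" for w
    proof -
      have "{z \<in> insert e P. w \<in> \<eta> z} = {z \<in> P. w \<in> \<eta> z} \<union> (if w \<in> \<eta> e then {e} else {})" by auto
      then have "deg \<eta> (insert e P) w = deg \<eta> P w + of_bool (w \<in> \<eta> e)"
        using finP by (cases "w \<in> \<eta> e") (simp_all add: deg_def)
      then show ?thesis using P(2)[of w] xy by auto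
    qed
    then have "even_degrees UNIV \<eta> (insert e P)" by (simp add: even_degrees_def)
    then have "even (card (insert e P))" using P(1) by (intro insert.prems(2)) auto
    then have "\<kappa> x \<noteq> \<kappa> y" using finP P(3) by simp
    then have "proper \<eta> (insert e B) \<kappa>" using \<kappa> xy by (auto simp: proper_def doubleton_eq_iff)
    then show ?thesis by blast
  next
    case False
    \<comment> \<open>The colours on the component of \<open>x\<close> are exchanged exactly if
      \<open>x\<close> and \<open>y\<close> have the same colour; \<open>\<noteq>\<close> acts as
      exclusive or.\<close>
    define \<kappa>' where "\<kappa>' v = (if (x, v) \<in> ?R\<^sup>* then \<kappa> v \<noteq> (\<kappa> x = \<kappa> y) else \<kappa> v)" for v
    have "\<kappa>' a \<noteq> \<kappa>' b" if f: "f \<in> B" "\<eta> f = {a, b}" for f a b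
    proof -
      have "(a, b) \<in> ?R" "(b, a) \<in> ?R" using f by (auto simp: insert_commute)
      then have "(x, a) \<in> ?R\<^sup>* \<longleftrightarrow> (x, b) \<in> ?R\<^sup>*" by (meson rtrancl.rtrancl_into_rtrancl)
      then show ?thesis using properD[OF \<kappa> f] by (auto simp: \<kappa>'_def)
    qed
    moreover have "\<kappa>' x \<noteq> \<kappa>' y" using False by (auto simp: \<kappa>'_def)
    ultimately have "proper \<eta> (insert e B) \<kappa>'" using xy by (auto simp: proper_def doubleton_eq_iff)
    then show ?thesis by blast
  qed
qed

text \<open>The complement \<open>R\<close> of \<open>M1\<close> is 2-regular, so a subset with even
  degrees has all or none of the edges of \<open>R\<close> at each vertex. Such sets are closed
  under intersection, and the minimal odd ones are therefore disjoint. A matching \<open>M2\<close>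
  meeting all of them leaves only edge sets that satisfy \<open>two_colouring\<close>.\<close>

theorem two_perfect_matchings:
  fixes \<eta> :: "'e \<Rightarrow> 'v set"
  assumes cubic: "mcubic V E \<eta>" and nb: "mbridgeless E \<eta>"
  shows "\<exists>M1 M2 \<kappa>. pmatching V E \<eta> M1 \<and> pmatching V E \<eta> M2 \<and> proper \<eta> (E - (M1 \<union> M2)) \<kappa>"
proof -
  have fin: "finite E" using mcubicD[OF cubic] by auto
  have "odd_family V E \<eta> {}" by (simp add: odd_family_def)
  then obtain M1 where M1: "pmatching V E \<eta> M1"
    \<comment> \<open>\<open>undefined\<close> stands for arbitrary forbidden edges.\<close>
    using odd_family_quelled[OF cubic nb, of "{}" undefined undefined] by (auto simp: quelled_def)
  define R where "R = E - M1"
  define \<C> where "\<C> = {K. K \<subseteq> R \<and> even_degrees V \<eta> K \<and> odd (card K) \<and> (\<forall>L. L \<subset> K \<longrightarrow> even_degrees V \<eta> L \<longrightarrow> even (card L))}"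
  have all: "{e \<in> K. v \<in> \<eta> e} = {} \<or> {e \<in> K. v \<in> \<eta> e} = {e \<in> R. v \<in> \<eta> e}" if K: "K \<subseteq> R" "even_degrees V \<eta> K" and v: "v \<in> V" for K v
  proof -
    have "{e \<in> R. v \<in> \<eta> e} = {e \<in> E. v \<in> \<eta> e} - {e \<in> M1. v \<in> \<eta> e}" by (auto simp: R_def)
    moreover have "card \<dots> = 3 - 1"
      using M1 v mcubicD(5)[OF cubic v] fin by (subst card_Diff_subset) (auto simp: pmatching_def deg_def intro: finite_subset)
    ultimately have R2: "card {e \<in> R. v \<in> \<eta> e} = 2" by simp
    have finR: "finite {e \<in> R. v \<in> \<eta> e}" "finite {e \<in> K. v \<in> \<eta> e}"
      using fin K(1) by (auto simp: R_def intro: finite_subset)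
    have sub: "{e \<in> K. v \<in> \<eta> e} \<subseteq> {e \<in> R. v \<in> \<eta> e}" using K(1) by auto
    then have "card {e \<in> K. v \<in> \<eta> e} \<le> 2" using card_mono[OF finR(1) sub] R2 by simp
    moreover have "even (card {e \<in> K. v \<in> \<eta> e})" using K(2) v by (auto simp: even_degrees_def deg_def)
    ultimately have "card {e \<in> K. v \<in> \<eta> e} = 0 \<or> card {e \<in> K. v \<in> \<eta> e} = 2" by presburger
    then show ?thesis using finR card_subset_eq[OF finR(1) sub] R2 by auto
  qed
  have inter: "even_degrees V \<eta> (K \<inter> L)" if "K \<subseteq> R" "even_degrees V \<eta> K" "L \<subseteq> R" "even_degrees V \<eta> L" for K L
    unfolding even_degrees_def
  proof
    fix v assume v: "v \<in> V"
    have "{e \<in> K \<inter> L. v \<in> \<eta> e} = {e \<in> K. v \<in> \<eta> e} \<inter> {e \<in> L. v \<in> \<eta> e}" by blast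
    then have "{e \<in> K \<inter> L. v \<in> \<eta> e} = {} \<or> {e \<in> K \<inter> L. v \<in> \<eta> e} = {e \<in> K. v \<in> \<eta> e}"
      using all[OF that(1,2) v] all[OF that(3,4) v] by auto
    then show "even (deg \<eta> (K \<inter> L) v)" using that(2) v unfolding deg_def even_degrees_def by (metis card.empty even_zero)
  qed
  have "odd_family V E \<eta> \<C>"
    unfolding odd_family_def
  proof (intro conjI ballI)
    fix K assume "K \<in> \<C>"
    then show "K \<subseteq> E" "even_degrees V \<eta> K" "odd (card K)" by (auto simp: \<C>_def R_def)
  next
    show "pairwise disjnt \<C>"
      unfolding pairwise_def
    proof (intro ballI impI)
      fix K L assume KL: "K \<in> \<C>" "L \<in> \<C>" "K \<noteq> L"
      have K: "K \<subseteq> R" "even_degrees V \<eta> K" "odd (card K)" "\<And>L. L \<subset> K \<Longrightarrow> even_degrees V \<eta> L \<Longrightarrow> even (card L)"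
        and L: "L \<subseteq> R" "even_degrees V \<eta> L" "odd (card L)" "\<And>K. K \<subset> L \<Longrightarrow> even_degrees V \<eta> K \<Longrightarrow> even (card K)"
        using KL by (auto simp: \<C>_def)
      have finKL: "finite K" "finite L" using K(1) L(1) fin by (auto simp: R_def intro: finite_subset)
      have "K \<inter> L = {} \<or> K \<inter> L = K"
        using min_odd_cyc_prime[OF finKL(1) K(2-4), of "K \<inter> L"] inter[OF K(1,2) L(1,2)] by simp
      moreover have "L \<inter> K = {} \<or> L \<inter> K = L"
        using min_odd_cyc_prime[OF finKL(2) L(2-4), of "L \<inter> K"] inter[OF L(1,2) K(1,2)] by simp
      ultimately show "disjnt K L" using KL(3) by (auto simp: disjnt_def)
    qed
  qed
  then obtain M2 where M2: "pmatching V E \<eta> M2" "\<And>K. K \<in> \<C> \<Longrightarrow> M2 \<inter> K \<noteq> {}"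
    using odd_family_quelled[OF cubic nb, of \<C> undefined undefined] by (auto simp: quelled_def)
  have "\<exists>\<kappa>. proper \<eta> (E - (M1 \<union> M2)) \<kappa>"
  proof (rule two_colouring)
    show "finite (E - (M1 \<union> M2))" "\<And>e. e \<in> E - (M1 \<union> M2) \<Longrightarrow> card (\<eta> e) = 2" using fin mcubicD(4)[OF cubic] by auto
    fix L assume L: "L \<subseteq> E - (M1 \<union> M2)" "even_degrees UNIV \<eta> L"
    show "even (card L)"
    proof (rule ccontr)
      assume "odd (card L)"
      moreover have "finite L" using L(1) fin finite_subset by blast
      moreover have "even_degrees V \<eta> L" using L(2) by (simp add: even_degrees_def)
      ultimately obtain K where K: "K \<subseteq> L" "even_degrees V \<eta> K" "odd (card K)" "\<forall>L'. L' \<subset> K \<longrightarrow> even_degrees V \<eta> L' \<longrightarrow> even (card L')"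
        using min_odd_cyc[of L V \<eta>] by auto
      moreover have "K \<subseteq> R" using K(1) L(1) by (auto simp: R_def)
      ultimately have "K \<in> \<C>" by (simp add: \<C>_def)
      then show False using M2(2)[of K] K(1) L(1) by blast
    qed
  qed
  then show ?thesis using M1 M2(1) by blast
qed

subsection \<open>Compactness\<close>

text \<open>By Zorn's lemma there is a maximal set \<open>A\<close> of prescribed values all of
  whose finite parts are compatible with all finite sets of constraints. It decides every variable,
  and the assignment is read off from it.\<close>

lemma bool_compactness:
  fixes P :: "'c \<Rightarrow> ('i \<Rightarrow> bool) \<Rightarrow> bool"
  assumes fin: "\<And>c. c \<in> C \<Longrightarrow> finite (J c)"
    and loc: "\<And>c \<sigma> \<tau>. c \<in> C \<Longrightarrow> (\<And>i. i \<in> J c \<Longrightarrow> \<sigma> i = \<tau> i) \<Longrightarrow> P c \<sigma> \<Longrightarrow> P c \<tau>"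
    and sat: "\<And>S. finite S \<Longrightarrow> S \<subseteq> C \<Longrightarrow> \<exists>\<sigma>. \<forall>c\<in>S. P c \<sigma>"
  shows "\<exists>\<sigma>. \<forall>c\<in>C. P c \<sigma>"
proof -
  define ok where "ok A \<longleftrightarrow> (\<forall>S B. finite S \<and> S \<subseteq> C \<and> finite B \<and> B \<subseteq> A \<longrightarrow>
    (\<exists>\<sigma>. (\<forall>c\<in>S. P c \<sigma>) \<and> (\<forall>(i, b)\<in>B. \<sigma> i = b)))" for A :: "('i \<times> bool) set"
  have okD: "\<exists>\<sigma>. (\<forall>c\<in>S. P c \<sigma>) \<and> (\<forall>(i, b)\<in>B. \<sigma> i = b)" if "ok A" "finite S" "S \<subseteq> C" "finite B" "B \<subseteq> A" for A S B
    using that unfolding ok_def by blast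
  have "\<exists>A\<in>{A. ok A}. \<forall>X\<in>{A. ok A}. A \<subseteq> X \<longrightarrow> X = A"
  proof (rule subset_Zorn_nonempty)
    have "ok {}" using sat by (auto simp: ok_def)
    then show "{A. ok A} \<noteq> {}" by blast
    fix \<A> assume \<A>: "\<A> \<noteq> {}" "subset.chain {A. ok A} \<A>"
    have "ok (\<Union>\<A>)"
      unfolding ok_def
    proof (intro allI impI, elim conjE)
      fix S B assume S: "finite S" "S \<subseteq> C" and B: "finite B" "B \<subseteq> \<Union>\<A>"
      obtain A where A: "A \<in> \<A>" "B \<subseteq> A" using finite_subset_Union_chain[OF B \<A>] by blast
      then have "ok A" using \<A>(2) by (auto simp: subset.chain_def)
      then show "\<exists>\<sigma>. (\<forall>c\<in>S. P c \<sigma>) \<and> (\<forall>(i, b)\<in>B. \<sigma> i = b)" using okD S B(1) A(2) by blast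
    qed
    then show "\<Union>\<A> \<in> {A. ok A}" by blast
  qed
  then obtain A where A: "ok A" and max: "\<And>X. ok X \<Longrightarrow> A \<subseteq> X \<Longrightarrow> X = A" by blast
  \<comment> \<open>If neither value could be added, the two finite obstructions together would
    leave no value for \<open>i\<close>.\<close>
  have total: "(i, True) \<in> A \<or> (i, False) \<in> A" for i
  proof (rule ccontr)
    assume no: "\<not> ?thesis"
    have "\<exists>S B. finite S \<and> S \<subseteq> C \<and> finite B \<and> B \<subseteq> A \<and> (\<forall>\<sigma>. (\<forall>c\<in>S. P c \<sigma>) \<and> (\<forall>(j, b)\<in>B. \<sigma> j = b) \<longrightarrow> \<sigma> i \<noteq> b)" for b
    proof -
      have "\<not> ok (insert (i, b) A)" using max[of "insert (i, b) A"] no by (cases b) blast+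
      then obtain S B where SB: "finite S" "S \<subseteq> C" "finite B" "B \<subseteq> insert (i, b) A"
        "\<not> (\<exists>\<sigma>. (\<forall>c\<in>S. P c \<sigma>) \<and> (\<forall>(j, b)\<in>B. \<sigma> j = b))" unfolding ok_def by blast
      have "\<sigma> i \<noteq> b" if "\<forall>c\<in>S. P c \<sigma>" "\<forall>(j, b)\<in>B - {(i, b)}. \<sigma> j = b" for \<sigma>
      proof
        assume "\<sigma> i = b"
        then have "\<forall>(j, b)\<in>B. \<sigma> j = b" using that(2) by auto
        then show False using SB(5) that(1) by blast
      qed
      moreover have "finite (B - {(i, b)})" "B - {(i, b)} \<subseteq> A" using SB by auto
      ultimately show ?thesis
        using SB(1,2) by (intro exI[of _ S] exI[of _ "B - {(i, b)}"]) simp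
    qed
    then obtain S B where SB: "\<And>b. finite (S b) \<and> S b \<subseteq> C \<and> finite (B b) \<and> B b \<subseteq> A \<and>
        (\<forall>\<sigma>. (\<forall>c\<in>S b. P c \<sigma>) \<and> (\<forall>(j, b)\<in>B b. \<sigma> j = b) \<longrightarrow> \<sigma> i \<noteq> b)" by metis
    obtain \<sigma> where \<sigma>: "\<forall>c\<in>S True \<union> S False. P c \<sigma>" "\<forall>(j, b)\<in>B True \<union> B False. \<sigma> j = b"
      using okD[OF A, of "S True \<union> S False" "B True \<union> B False"] SB by auto
    have "(\<forall>c\<in>S b. P c \<sigma>) \<and> (\<forall>(j, b)\<in>B b. \<sigma> j = b)" for b using \<sigma> by (cases b) auto
    then have "\<sigma> i \<noteq> b" for b using SB[of b] by simp
    then show False by blast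
  qed
  define \<sigma> where "\<sigma> i \<longleftrightarrow> (i, True) \<in> A" for i
  have "P c \<sigma>" if c: "c \<in> C" for c
  proof -
    \<comment> \<open>The constraint \<open>c\<close> depends on finitely many values of
      \<open>\<sigma>\<close>, all prescribed by \<open>A\<close>; a solution \<open>\<tau>\<close>
      of \<open>c\<close> with these values exists, and \<open>loc\<close> transfers
      \<open>c\<close> to \<open>\<sigma>\<close>.\<close>
    have "(i, \<sigma> i) \<in> A" for i using total[of i] by (cases "(i, True) \<in> A") (auto simp: \<sigma>_def)
    then have "(\<lambda>i. (i, \<sigma> i)) ` J c \<subseteq> A" by blast
    then obtain \<tau> where \<tau>: "P c \<tau>" "\<And>i. i \<in> J c \<Longrightarrow> \<tau> i = \<sigma> i"
      using okD[OF A, of "{c}" "(\<lambda>i. (i, \<sigma> i)) ` J c"] fin[OF c] c by auto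
    show ?thesis by (rule loc[OF c \<tau>(2) \<tau>(1)])
  qed
  then show ?thesis by blast
qed

subsection \<open>Closing up a finite piece of an infinite graph\<close>

text \<open>Links bridges defined by components to cuts: if \<open>e\<close> is the only edge
  crossing \<open>Z\<close>, no walk leaves \<open>Z\<close> after its deletion, so the ends of
  \<open>e\<close> fall into different components.\<close>

lemma bridgeless_no_cut1:
  assumes simple: "simple_graph V E" and nb: "bridgeless V E"
  shows "card {e \<in> E. crosses Z e} \<noteq> 1"
proof
  assume "card {e \<in> E. crosses Z e} = 1"
  then obtain e where e: "{e \<in> E. crosses Z e} = {e}" by (auto simp: card_1_singleton_iff)
  then have eE: "e \<in> E" "crosses Z e" by auto
  then obtain x y where xy: "x \<in> e" "x \<in> Z" "y \<in> e" "y \<notin> Z" by (auto simp: crosses_def)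
  have "card e = 2" "e \<subseteq> V" using simple eE by (auto simp: simple_graph_def)
  then have exy: "e = {x, y}" "x \<in> V" "y \<in> V" using xy by (auto simp: card_2_iff)
  have stay: "v \<in> Z" if "(x, v) \<in> (adj (E - {e}))\<^sup>*" for v
    using that
  proof (induction rule: rtrancl_induct)
    case (step v w)
    then have "{v, w} \<in> E" "{v, w} \<noteq> e" by (auto simp: adj_def)
    then have "{v, w} \<notin> {e \<in> E. crosses Z e}" unfolding e by simp
    then have "\<not> crosses Z {v, w}" using \<open>{v, w} \<in> E\<close> by simp
    then show ?case using step.IH by simp
  qed (use xy in simp)
  let ?S = "conn_rel V E" and ?R = "conn_rel V (E - {e})"
  have RS: "?R \<subseteq> ?S" by (rule conn_rel_mono) auto
  have "(x, y) \<in> adj E" using exy eE by (simp add: adj_def)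
  then have "(x, y) \<in> ?S" using exy by (simp add: conn_rel_def r_into_rtrancl)
  then have "?S `` {y} = ?S `` {x}" using equiv_class_eq[OF equiv_conn_rel] by metis
  then have sub: "?R `` {x} \<subseteq> ?S `` {x}" "?R `` {y} \<subseteq> ?S `` {x}" using RS by auto
  have "y \<in> ?R `` {y}" "y \<notin> ?R `` {x}" using exy stay xy(4) by (auto simp: conn_rel_def)
  then have ne: "?R `` {x} \<noteq> ?R `` {y}" by blast
  have comps: "?S `` {x} \<in> components V E" "?R `` {x} \<in> components V (E - {e})" "?R `` {y} \<in> components V (E - {e})"
    using exy by (auto simp: components_def intro: quotientI)
  have "is_bridge V E e"
    unfolding is_bridge_def
    by (intro conjI eE(1) bexI[OF _ comps(1)] bexI[OF _ comps(2)] bexI[OF _ comps(3)] ne sub)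
  then show False using nb eE by (simp add: bridgeless_def)
qed

lemma incident_finite:
  assumes "cubic V E" "v \<in> V"
  shows "finite {e \<in> E. v \<in> e}" "card {e \<in> E. v \<in> e} = 3"
proof -
  show "card {e \<in> E. v \<in> e} = 3" using assms by (simp add: cubic_def incident_edges_def)
  then show "finite {e \<in> E. v \<in> e}" by (metis card.infinite zero_neq_numeral)
qed

text \<open>The edges leaving \<open>X\<close> are attached to the vertices of a new circuit, whose vertices and edges
  are numbered by \<open>{..<d}\<close>; as the number \<open>d\<close> of these edges is not 1, there are no loops.\<close>

lemma finite_piece:
  fixes V :: "'a set"
  assumes simple: "simple_graph V E" and cub: "cubic V E" and nb: "bridgeless V E" and X: "finite X" "X \<subseteq> V"
  shows "\<exists>M1 M2 \<kappa>. (\<forall>v\<in>X. (\<exists>!e. e \<in> E \<and> e \<in> M1 \<and> v \<in> e) \<and> (\<exists>!e. e \<in> E \<and> e \<in> M2 \<and> v \<in> e)) \<and>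
    proper (\<lambda>e. e) {e \<in> E - (M1 \<union> M2). e \<subseteq> X} \<kappa>"
proof -
  define IX where "IX = {e \<in> E. e \<inter> X \<noteq> {}}"
  define D where "D = {e \<in> E. crosses X e}"
  define d where "d = card D"
  have "IX = (\<Union>v\<in>X. {e \<in> E. v \<in> e})" by (auto simp: IX_def)
  then have finIX: "finite IX" using incident_finite(1)[OF cub] X by auto
  have DIX: "D \<subseteq> IX" by (auto simp: D_def IX_def crosses_def)
  then have finD: "finite D" using finIX finite_subset by blast
  have d1: "d \<noteq> 1" using bridgeless_no_cut1[OF simple nb] by (simp add: d_def D_def)
  obtain en where en: "bij_betw en {..<d} D" using ex_bij_betw_nat_finite[OF finD] by (auto simp: d_def atLeast0LessThan)
  then have eninj: "en i = en j \<longleftrightarrow> i = j" if "i < d" "j < d" for i j using that by (auto simp: bij_betw_def inj_on_def)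
  have enD: "en i \<in> D" if "i < d" for i using en that by (auto simp: bij_betw_def)
  define VH :: "('a + nat) set" where "VH = Inl ` X \<union> Inr ` {..<d}"
  define EH :: "('a set + nat) set" where "EH = Inl ` IX \<union> Inr ` {..<d}"
  \<comment> \<open>An edge \<open>Inl e\<close> keeps its ends in \<open>X\<close>, and if it is
    the leaving edge \<open>en i\<close>, its outer end becomes the circuit vertex
    \<open>Inr i\<close>. For \<open>d = 2\<close> the circuit is a pair of parallel edges, for
    \<open>d = 0\<close> it is empty.\<close>
  define \<eta> :: "'a set + nat \<Rightarrow> ('a + nat) set" where
    "\<eta> = case_sum (\<lambda>e. Inl ` (e \<inter> X) \<union> Inr ` {i. i < d \<and> en i = e}) (\<lambda>i. {Inr i, Inr (Suc i mod d)})"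
  have two: "card e = 2" if "e \<in> E" for e using simple that by (auto simp: simple_graph_def)
  have inside: "\<eta> (Inl e) = Inl ` e" if "e \<in> E" "e \<subseteq> X" for e
  proof -
    have "e \<notin> D" using that by (auto simp: D_def crosses_def)
    then have none: "{i. i < d \<and> en i = e} = {}" using enD by auto
    have "e \<inter> X = e" using that by blast
    then show ?thesis by (simp only: \<eta>_def sum.case none image_empty Un_empty_right)
  qed
  have leaving: "\<exists>x y i. e = {x, y} \<and> x \<in> X \<and> y \<notin> X \<and> i < d \<and> en i = e \<and> \<eta> (Inl e) = {Inl x, Inr i}" if eD: "e \<in> D" for e
  proof -
    have e: "e \<in> E" "crosses X e" using eD by (auto simp: D_def)
    then obtain x y where xy: "x \<in> e" "x \<in> X" "y \<in> e" "y \<notin> X" by (auto simp: crosses_def)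
    then have exy: "e = {x, y}" using two[OF e(1)] by (auto simp: card_2_iff)
    have "e \<in> en ` {..<d}" using en eD by (simp add: bij_betw_def)
    then obtain i where i: "i < d" "e = en i" by auto
    then have one: "{j. j < d \<and> en j = e} = {i}" using eninj by auto
    have "e \<inter> X = {x}" using exy xy by auto
    then have "\<eta> (Inl e) = {Inl x, Inr i}" by (simp only: \<eta>_def sum.case one) auto
    then show ?thesis using exy xy i by blast
  qed
  have IXcases: "e \<subseteq> X \<or> e \<in> D" if "e \<in> IX" for e using that by (auto simp: IX_def D_def crosses_def)
  have suc_ne: "Suc i mod d \<noteq> i" "Suc i mod d < d" if "i < d" for i
    using that d1 by (cases "Suc i = d"; simp)+
  have edges: "\<eta> e \<subseteq> VH \<and> card (\<eta> e) = 2" if "e \<in> EH" for e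
  proof (cases e)
    case (Inl e')
    then have e': "e' \<in> IX" "e' \<in> E" using that by (auto simp: EH_def IX_def)
    show ?thesis
    proof (cases "e' \<subseteq> X")
      case True
      then show ?thesis using inside[OF e'(2) True] two[OF e'(2)] Inl by (auto simp: VH_def card_image)
    next
      case False
      then obtain x y i where "x \<in> X" "i < d" "\<eta> (Inl e') = {Inl x, Inr i}" using IXcases[OF e'(1)] leaving[of e'] by blast
      then show ?thesis using Inl by (auto simp: VH_def)
    qed
  next
    case (Inr i)
    then have "i < d" using that by (auto simp: EH_def)
    then show ?thesis using suc_ne[of i] Inr by (auto simp: \<eta>_def VH_def)
  qed
  have incL: "{e \<in> M. Inl v \<in> \<eta> e} = Inl ` {e \<in> E. Inl e \<in> M \<and> v \<in> e}" if "v \<in> X" "M \<subseteq> EH" for v M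
  proof -
    have "Inl v \<in> \<eta> (Inl e) \<longleftrightarrow> v \<in> e" "Inl v \<notin> \<eta> (Inr i)" for e i using that(1) by (auto simp: \<eta>_def)
    moreover have "e \<in> E" if "Inl e \<in> M" for e using that \<open>M \<subseteq> EH\<close> by (auto simp: EH_def IX_def)
    ultimately have "z \<in> {e \<in> M. Inl v \<in> \<eta> e} \<longleftrightarrow> z \<in> Inl ` {e \<in> E. Inl e \<in> M \<and> v \<in> e}" for z
      by (cases z) auto
    then show ?thesis by blast
  qed
  have degR: "card {e \<in> EH. Inr j \<in> \<eta> e} = 3" "card {e \<in> Inr ` {..<d}. Inr j \<in> \<eta> e} = 2" if j: "j < d" for j
  proof -
    \<comment> \<open>The cyclic predecessor of \<open>j\<close>, so that the circuit edges at
      \<open>Inr j\<close> are those numbered \<open>j\<close> and \<open>i\<close>.\<close>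
    define i where "i = (if j = 0 then d - 1 else j - 1)"
    have i: "i < d" "i \<noteq> j" using j d1 by (auto simp: i_def)
    have pre: "Suc k mod d = j \<longleftrightarrow> k = i" if "k < d" for k
      using that j d1 by (cases "Suc k = d") (auto simp: i_def)
    have R: "{e \<in> Inr ` {..<d}. Inr j \<in> \<eta> e} = {Inr j, Inr i}"
    proof -
      have "Inr j \<in> \<eta> (Inr k) \<longleftrightarrow> k = j \<or> k = i" if "k < d" for k using pre[OF that] by (auto simp: \<eta>_def)
      then show ?thesis using i j by auto
    qed
    then show "card {e \<in> Inr ` {..<d}. Inr j \<in> \<eta> e} = 2" using i by simp
    have L: "{e \<in> Inl ` IX. Inr j \<in> \<eta> e} = {Inl (en j)}"
      using enD[OF j] DIX j by (auto simp: \<eta>_def)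
    have "{e \<in> EH. Inr j \<in> \<eta> e} = {Inl (en j), Inr j, Inr i}"
      using L R by (auto simp: EH_def)
    then show "card {e \<in> EH. Inr j \<in> \<eta> e} = 3" using i by simp
  qed
  have deg: "deg \<eta> EH v = 3" if "v \<in> VH" for v
  proof (cases v)
    case (Inl x)
    then have "x \<in> X" using that by (auto simp: VH_def)
    then have "{e \<in> E. Inl e \<in> EH \<and> x \<in> e} = {e \<in> E. x \<in> e}" by (auto simp: EH_def IX_def)
    then have "deg \<eta> EH v = card (Inl ` {e \<in> E. x \<in> e} :: ('a set + nat) set)"
      using incL[OF \<open>x \<in> X\<close>, of EH] Inl by (simp add: deg_def)
    then show ?thesis using incident_finite(2)[OF cub, of x] X \<open>x \<in> X\<close> by (auto simp: card_image)
  next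
    case (Inr j)
    then show ?thesis using degR(1)[of j] that by (auto simp: VH_def deg_def)
  qed
  have cubicH: "mcubic VH EH \<eta>"
    using X finIX edges deg by (auto simp: mcubic_def VH_def EH_def)
  have nbH: "mbridgeless EH \<eta>"
    unfolding mbridgeless_def
  proof (intro allI notI)
    fix Z assume Z: "cut_size \<eta> EH Z = 1"
    have finH: "finite VH" "finite EH" using mcubicD[OF cubicH] by auto
    let ?K = "Inr ` {..<d} :: ('a set + nat) set"
    have crZ: "crosses (Z \<inter> VH) (\<eta> e) \<longleftrightarrow> crosses Z (\<eta> e)" if "e \<in> EH" for e
      using edges[OF that] by (auto simp: crosses_def)
    \<comment> \<open>The circuit crosses every cut an even number of times. In a cut of size 1 it
      does not cross at all, so all its vertices are on the same side.\<close>
    have "even (card {e \<in> ?K. crosses (Z \<inter> VH) (\<eta> e)})"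
    proof (rule even_crossing)
      fix v assume "v \<in> Z \<inter> VH"
      show "even (deg \<eta> ?K v)"
      proof (cases v)
        case (Inl x)
        then have "{e \<in> ?K. v \<in> \<eta> e} = {}" by (auto simp: \<eta>_def)
        then show ?thesis unfolding deg_def by (metis card.empty even_zero)
      next
        case (Inr j)
        then show ?thesis using degR(2)[of j] \<open>v \<in> Z \<inter> VH\<close> by (auto simp: VH_def deg_def)
      qed
    qed (use finH edges in \<open>auto simp: EH_def\<close>)
    moreover have "{e \<in> ?K. crosses (Z \<inter> VH) (\<eta> e)} = {e \<in> ?K. crosses Z (\<eta> e)}" using crZ by (auto simp: EH_def)
    ultimately have evK: "even (card {e \<in> ?K. crosses Z (\<eta> e)})" by simp
    have "{e \<in> EH. crosses Z (\<eta> e)} = {e \<in> Inl ` IX. crosses Z (\<eta> e)} \<union> {e \<in> ?K. crosses Z (\<eta> e)}" by (auto simp: EH_def)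
    moreover have "card \<dots> = card {e \<in> Inl ` IX. crosses Z (\<eta> e)} + card {e \<in> ?K. crosses Z (\<eta> e)}"
      using finIX by (intro card_Un_disjoint) auto
    ultimately have sum1: "card {e \<in> Inl ` IX. crosses Z (\<eta> e)} + card {e \<in> ?K. crosses Z (\<eta> e)} = 1" using Z by (simp add: cut_size_def)
    then have K0: "card {e \<in> ?K. crosses Z (\<eta> e)} = 0" and L1: "card {e \<in> Inl ` IX. crosses Z (\<eta> e)} = 1"
    proof -
      have "l = 0 \<and> k = 1" if "k + l = 1" "even l" for k l :: nat using that by presburger
      from this[OF sum1 evK] show "card {e \<in> ?K. crosses Z (\<eta> e)} = 0" "card {e \<in> Inl ` IX. crosses Z (\<eta> e)} = 1" by auto
    qed
    then have noK: "\<not> crosses Z (\<eta> (Inr i))" if "i < d" for i using that by auto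
    have const: "Inr i \<in> Z \<longleftrightarrow> Inr 0 \<in> Z" if "i < d" for i
      using that
    proof (induction i)
      case (Suc i)
      then show ?case using noK[of i] by (auto simp: \<eta>_def)
    qed simp
    \<comment> \<open>Everything outside \<open>X\<close> is put on the side of the circuit. The cut
      of \<open>Y\<close> in the infinite graph then also has size 1.\<close>
    define Y where "Y = (if Inr 0 \<in> Z then Inl -` Z \<union> - X else Inl -` Z \<inter> X)"
    have crY: "crosses Y e \<longleftrightarrow> e \<in> IX \<and> crosses Z (\<eta> (Inl e))" if e: "e \<in> E" for e
    proof (cases "e \<in> IX")
      case False
      then have "e \<inter> X = {}" using e by (auto simp: IX_def)
      then show ?thesis using False by (auto simp: crosses_def Y_def)
    next
      case True
      show ?thesis
      proof (cases "e \<subseteq> X")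
        case True
        then show ?thesis using \<open>e \<in> IX\<close> inside[OF e True] by (auto simp: crosses_def Y_def)
      next
        case False
        then obtain x y i where "e = {x, y}" "x \<in> X" "y \<notin> X" "i < d" "\<eta> (Inl e) = {Inl x, Inr i}"
          using IXcases[OF True] leaving[of e] by blast
        then show ?thesis using True const[of i] by (auto simp: Y_def)
      qed
    qed
    then have "{e \<in> Inl ` IX. crosses Z (\<eta> e)} = Inl ` {e \<in> E. crosses Y e}" by (auto simp: IX_def)
    then have "card {e \<in> E. crosses Y e} = 1" using L1 by (simp add: card_image)
    then show False using bridgeless_no_cut1[OF simple nb] by blast
  qed
  obtain N1 N2 \<kappa> where N: "pmatching VH EH \<eta> N1" "pmatching VH EH \<eta> N2" "proper \<eta> (EH - (N1 \<union> N2)) \<kappa>"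
    using two_perfect_matchings[OF cubicH nbH] by blast
  have match: "\<exists>!e. e \<in> E \<and> e \<in> {e. Inl e \<in> N} \<and> v \<in> e" if N: "pmatching VH EH \<eta> N" and v: "v \<in> X" for N v
  proof -
    have "card {e \<in> N. Inl v \<in> \<eta> e} = 1" "N \<subseteq> EH" using N v by (auto simp: pmatching_def deg_def VH_def)
    then have "card {e \<in> E. Inl e \<in> N \<and> v \<in> e} = 1" using incL[OF v, of N] by (simp add: card_image)
    then obtain e where e: "{e \<in> E. Inl e \<in> N \<and> v \<in> e} = {e}" by (auto simp: card_1_singleton_iff)
    have "e' \<in> E \<and> Inl e' \<in> N \<and> v \<in> e' \<longleftrightarrow> e' = e" for e'
      using arg_cong[OF e, of "(\<in>) e'"] by simp
    then show ?thesis by simp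
  qed
  have both: "\<forall>v\<in>X. (\<exists>!e. e \<in> E \<and> e \<in> {e. Inl e \<in> N1} \<and> v \<in> e) \<and> (\<exists>!e. e \<in> E \<and> e \<in> {e. Inl e \<in> N2} \<and> v \<in> e)"
    by (intro ballI conjI match N)
  have col: "proper (\<lambda>e. e) {e \<in> E - ({e. Inl e \<in> N1} \<union> {e. Inl e \<in> N2}). e \<subseteq> X} (\<lambda>v. \<kappa> (Inl v))"
    unfolding proper_def
  proof (intro ballI allI impI)
    fix e a b assume e: "e \<in> {e \<in> E - ({e. Inl e \<in> N1} \<union> {e. Inl e \<in> N2}). e \<subseteq> X}" "e = {a, b}"
    show "\<kappa> (Inl a) \<noteq> \<kappa> (Inl b)"
    proof (rule properD[OF N(3)])
      have "e \<inter> X \<noteq> {}" using e by auto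
      then show "Inl e \<in> EH - (N1 \<union> N2)" using e(1) by (auto simp: EH_def IX_def)
      show "\<eta> (Inl e) = {Inl a, Inl b}" using inside[of e] e by auto
    qed
  qed
  show ?thesis by (rule exI, rule exI, rule exI, rule conjI, rule both, rule col)
qed

section \<open>From finite pieces to the infinite graph\<close>

theorem corollary3p6:
  fixes V :: "'a set" and E :: "'a set set"
  assumes "simple_graph V E"
    and "infinite V"
    and "cubic V E"
    and "bridgeless V E"
  shows "\<exists>M1 M2. perfect_matching V E M1 \<and> perfect_matching V E M2 \<and>
           bipartite V (E - (M1 \<union> M2))"
proof -
  \<comment> \<open>The three kinds of variables encode membership in the first matching, membership
    in the second, and the colours of vertices. \<open>P v\<close> collects the conditions at
    \<open>v\<close>; it depends only on the edges at \<open>v\<close> and their ends, which form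
    the finite set \<open>J v\<close>.\<close>
  define P :: "'a \<Rightarrow> ('a set + 'a set + 'a \<Rightarrow> bool) \<Rightarrow> bool" where
    "P v \<sigma> \<longleftrightarrow> (\<exists>!e. e \<in> E \<and> \<sigma> (Inl e) \<and> v \<in> e) \<and> (\<exists>!e. e \<in> E \<and> \<sigma> (Inr (Inl e)) \<and> v \<in> e) \<and>
      (\<forall>e\<in>E. \<not> \<sigma> (Inl e) \<longrightarrow> \<not> \<sigma> (Inr (Inl e)) \<longrightarrow> (\<forall>w. e = {v, w} \<longrightarrow> \<sigma> (Inr (Inr v)) \<noteq> \<sigma> (Inr (Inr w))))" for v \<sigma>
  define I where "I v = {e \<in> E. v \<in> e}" for v
  define J :: "'a \<Rightarrow> ('a set + 'a set + 'a) set" where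
    "J v = Inl ` I v \<union> Inr ` Inl ` I v \<union> Inr ` Inr ` (\<Union>(I v))" for v
  have edge: "e \<subseteq> V" "card e = 2" "finite e" if "e \<in> E" for e
    using assms(1) that by (auto simp: simple_graph_def intro: card_ge_0_finite)
  have finI: "finite (I v)" if "v \<in> V" for v unfolding I_def by (rule incident_finite(1)[OF assms(3) that])
  have "\<exists>\<sigma>. \<forall>v\<in>V. P v \<sigma>"
  proof (rule bool_compactness)
    fix v assume v: "v \<in> V"
    have "finite (\<Union>(I v))" using finI[OF v] edge(3) by (intro finite_Union) (auto simp: I_def)
    then show "finite (J v)" using finI[OF v] by (simp only: J_def finite_Un finite_imageI)
  next
    fix v and \<sigma> \<tau> :: "'a set + 'a set + 'a \<Rightarrow> bool"
    assume eq: "\<And>i. i \<in> J v \<Longrightarrow> \<sigma> i = \<tau> i" and P: "P v \<sigma>"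
    have s: "\<sigma> (Inl e) = \<tau> (Inl e)" "\<sigma> (Inr (Inl e)) = \<tau> (Inr (Inl e))" if "e \<in> E" "v \<in> e" for e
      using eq[of "Inl e"] eq[of "Inr (Inl e)"] that by (auto simp: J_def I_def)
    have t: "\<sigma> (Inr (Inr w)) = \<tau> (Inr (Inr w))" if "e \<in> E" "v \<in> e" "w \<in> e" for e w
      using eq[of "Inr (Inr w)"] that by (auto simp: J_def I_def)
    have "(e \<in> E \<and> \<sigma> (Inl e) \<and> v \<in> e) = (e \<in> E \<and> \<tau> (Inl e) \<and> v \<in> e)"
      "(e \<in> E \<and> \<sigma> (Inr (Inl e)) \<and> v \<in> e) = (e \<in> E \<and> \<tau> (Inr (Inl e)) \<and> v \<in> e)" for e using s by auto
    moreover have "\<forall>e\<in>E. \<not> \<tau> (Inl e) \<longrightarrow> \<not> \<tau> (Inr (Inl e)) \<longrightarrow> (\<forall>w. e = {v, w} \<longrightarrow> \<tau> (Inr (Inr v)) \<noteq> \<tau> (Inr (Inr w)))"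
    proof (intro ballI impI allI)
      fix e w assume e: "e \<in> E" "\<not> \<tau> (Inl e)" "\<not> \<tau> (Inr (Inl e))" "e = {v, w}"
      then have "v \<in> e" "w \<in> e" by auto
      have "\<sigma> (Inr (Inr v)) \<noteq> \<sigma> (Inr (Inr w))" if "\<not> \<sigma> (Inl e)" "\<not> \<sigma> (Inr (Inl e))"
        using P e(1,4) that unfolding P_def by blast
      then show "\<tau> (Inr (Inr v)) \<noteq> \<tau> (Inr (Inr w))"
        using s[OF e(1) \<open>v \<in> e\<close>] t[OF e(1) \<open>v \<in> e\<close> \<open>v \<in> e\<close>] t[OF e(1) \<open>v \<in> e\<close> \<open>w \<in> e\<close>] e(2,3) by simp
    qed
    ultimately show "P v \<tau>" using P unfolding P_def by simp
  next
    fix S assume S: "finite S" "S \<subseteq> V"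
    \<comment> \<open>The neighbours are included because \<open>finite_piece\<close> controls the
      colours only on edges with both ends in \<open>X\<close>.\<close>
    define X where "X = S \<union> (\<Union>v\<in>S. \<Union>(I v))"
    have X: "finite X" "X \<subseteq> V"
      using S finI edge(1,3) by (auto simp: X_def I_def) blast
    from finite_piece[OF assms(1,3,4) X] obtain M1 M2 \<kappa> where
      M: "(\<forall>v\<in>X. (\<exists>!e. e \<in> E \<and> e \<in> M1 \<and> v \<in> e) \<and> (\<exists>!e. e \<in> E \<and> e \<in> M2 \<and> v \<in> e)) \<and>
        proper (\<lambda>e. e) {e \<in> E - (M1 \<union> M2). e \<subseteq> X} \<kappa>"
      by (elim exE) (rule that)
    define \<sigma> :: "'a set + 'a set + 'a \<Rightarrow> bool" where
      "\<sigma> = case_sum (\<lambda>e. e \<in> M1) (case_sum (\<lambda>e. e \<in> M2) \<kappa>)"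
    have "P v \<sigma>" if v: "v \<in> S" for v
    proof -
      have "v \<in> X" using v by (simp add: X_def)
      moreover have "e \<subseteq> X" if "e \<in> E" "v \<in> e" for e using that v by (auto simp: X_def I_def)
      moreover have "\<kappa> v \<noteq> \<kappa> w" if "{v, w} \<in> E" "{v, w} \<notin> M1" "{v, w} \<notin> M2" for w
        using properD[OF conjunct2[OF M], of "{v, w}" v w] calculation(2)[of "{v, w}"] that by auto
      ultimately show ?thesis using M by (auto simp: P_def \<sigma>_def)
    qed
    then show "\<exists>\<sigma>. \<forall>v\<in>S. P v \<sigma>" by blast
  qed
  then obtain \<sigma> where \<sigma>: "\<forall>v\<in>V. P v \<sigma>" by (rule exE)
  let ?M1 = "{e \<in> E. \<sigma> (Inl e)}" and ?M2 = "{e \<in> E. \<sigma> (Inr (Inl e))}"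
  let ?A = "{v \<in> V. \<sigma> (Inr (Inr v))}" and ?B = "{v \<in> V. \<not> \<sigma> (Inr (Inr v))}"
  have "perfect_matching V E ?M1" "perfect_matching V E ?M2"
    using \<sigma> by (auto simp: perfect_matching_def P_def)
  moreover have "\<exists>a\<in>?A. \<exists>b\<in>?B. e = {a, b}" if e: "e \<in> E - (?M1 \<union> ?M2)" for e
  proof -
    obtain a b where ab: "e = {a, b}" using edge(2)[of e] e by (auto simp: card_2_iff)
    then have "a \<in> V" "b \<in> V" using edge(1)[of e] e by auto
    moreover have "\<sigma> (Inr (Inr a)) \<noteq> \<sigma> (Inr (Inr b))" using \<sigma> calculation(1) e ab by (auto simp: P_def)
    ultimately show ?thesis using ab by (cases "\<sigma> (Inr (Inr a))") (auto simp: insert_commute)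
  qed
  then have "bipartite V (E - (?M1 \<union> ?M2))"
    unfolding bipartite_def by (intro exI[of _ ?A] exI[of _ ?B]) auto
  ultimately show ?thesis by blast
qed

end
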